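(* Let $\alpha:S^1\to S^1$ be an orientation preserving homeomorphism with $\alpha(1)\neq1$, let $\gamma$ be its lift with $0<\gamma(0)<1$, let $\mathcal B_\alpha$ be the associated $C^*$-algebra and $\widetilde M_\alpha=\bigcup_{N\in\mathbb N}M_N\cup M_\infty$ its maximal ideal space. The following cases may occur: 1) If $\tau(\alpha)=\frac mn$ where $m$ and $n$ are coprime, then the limit points of the endpoints of the arcs $\{M_N\}_{N\in\mathbb N}$ form a subset of $M_\infty$ with cardinality $n$, and $$\mathcal B_\alpha\cong\mathcal B_{\Theta_{m/n}}.$$ 2) If $\tau(\alpha)\notin\mathbb Q$, then two subcases are possible: a) $\alpha$ is topologically transitive, and then $M_\infty$ is the set of limit points of the endpoints of the arcs $\{M_N\}_{N\in\mathbb N}$ and $$\mathcal B_\alpha\cong\mathcal B_{\Theta_{\tau(\alpha)}};$$ b) $\alpha$ is not topologically transitive, and then the set of limit points of the endpoints of the arcs $\{M_N\}_{N\in\mathbb N}$ forms a perfect nowhere dense subset of $M_\infty$. In particular, $$\mathcal B_\alpha\not\cong\mathcal B_{\Theta_\tau},\qquad \tau\in[0,1).$$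
   Context: $\mathbb N=\{0,1,2,\dots\}$; $\overline{\mathbb N}=\mathbb N\cup\{\infty\}$ is the one-point compactification of the discrete space $\mathbb N$. $S^1=\{z\in\mathbb C:|z|=1\}$. A lift of an orientation preserving homeomorphism $\alpha$ of $S^1$ is a continuous $\gamma:\mathbb R\to\mathbb R$ with $\alpha(e^{2\pi it})=e^{2\pi i\gamma(t)}$; it is an increasing homeomorphism with $\gamma(t+1)=\gamma(t)+1$. The rotation number $\tau(\alpha)\in[0,1)$ is the fractional part of $\lim_{n\to\infty}\gamma^n(t)/n$ (independent of $t$ and of the lift). $\Theta_\tau(z)=e^{2\pi i\tau}z$ is the rotation by $2\pi\tau$. For $\tau(\alpha)\notin\mathbb Q$ the set $\Omega(\alpha)$ of accumulation points of an orbit $\{\alpha^n(x)\}_{n\in\mathbb Z}$ does not depend on $x\in S^1$, and $\alpha$ is topologically transitive when $\Omega(\alpha)=S^1$. Algebra $\mathcal B_\alpha$: $\gamma$ is the lift of $\alpha$ with $0<\gamma(0)<1$ (it exists, and is then unique, provided $1$ is not a fixed point of $\alpha$); $\mathbb U$ is the unitary operator on $L^2(\mathbb R)$ given by $(\mathbb Uf)(t)=\sqrt{|\gamma'(t)|}f(\gamma(t))$, a formula which (by monotonicity of $\gamma$) makes sense for almost all $t$; $P$ is the orthogonal projection of $L^2(\mathbb R)$ onto $H=L^2([0,\infty))$; $U=P\mathbb UP\in L(H)$; $\mathcal A\subset L(H)$ is the algebra of operators of multiplication by continuous functions of period $1$; $\mathcal B_\alpha=C^*\big(\bigcup_{n=0}^\infty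 U^{*n}\mathcal AU^n\big)$, a commutative $C^*$-algebra. Its maximal ideal space is identified with $\widetilde M_\alpha=\bigcup_{N\in\mathbb N}M_N\cup M_\infty\subset\overline{\mathbb N}\times S^1$, where $M_\infty=\{\infty\}\times S^1$ and $M_N=\{N\}\times[\alpha^N(1),\alpha^{N+1}(1)]$ with $[\alpha^N(1),\alpha^{N+1}(1)]=\{e^{2\pi it}:t\in[\gamma^N(0),\gamma^{N+1}(0)]\}$.
   Formalization: That the formula for U defines a unitary operator on L²(R) is made an explicit hypothesis (it fails for singular γ); the isomorphism in case 1 is claimed only if m/n≠0, as Θ_0 fixes 1 and B_{Θ_0} is undefined; in 2b, B_{Θ_0} is built from the lift γ(t)=t. *)

theory Defs
  imports "HOL-Analysis.Analysis"
begin

definition sq_int :: "(real \<Rightarrow> complex) \<Rightarrow> bool" where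
  "sq_int f \<longleftrightarrow> f \<in> borel_measurable lborel \<and> integrable lborel (\<lambda>t. (cmod (f t))\<^sup>2)"

definition l2_eq :: "(real \<Rightarrow> complex) \<Rightarrow> (real \<Rightarrow> complex) \<Rightarrow> bool" where
  "l2_eq f g \<longleftrightarrow> sq_int f \<and> sq_int g \<and> (AE t in lborel. f t = g t)"

lemma sq_int_zero: "sq_int (\<lambda>t. 0)"
  by (simp add: sq_int_def)

lemma l2_eq_part_equivp: "part_equivp l2_eq"
proof (rule part_equivpI)
  show "\<exists>x. l2_eq x x"
    by (rule exI[of _ "\<lambda>t. 0"]) (simp add: l2_eq_def sq_int_zero)
  show "symp l2_eq"
    by (rule sympI) (auto simp: l2_eq_def elim: AE_mp)
  show "transp l2_eq"
    by (rule transpI) (auto simp: l2_eq_def elim: AE_mp)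
qed

quotient_type L2 = "real \<Rightarrow> complex" / partial: l2_eq
  by (rule l2_eq_part_equivp)

lemma l2_eqD: "l2_eq f g \<Longrightarrow> sq_int f" "l2_eq f g \<Longrightarrow> sq_int g"
  "l2_eq f g \<Longrightarrow> AE t in lborel. f t = g t"
  by (auto simp: l2_eq_def)

lemma sq_int_add:
  assumes "sq_int f" "sq_int g"
  shows "sq_int (\<lambda>t. f t + g t)"
proof -
  have [measurable]: "f \<in> borel_measurable lborel" "g \<in> borel_measurable lborel"
    using assms by (auto simp: sq_int_def)
  have "integrable lborel (\<lambda>t. 2 * (cmod (f t))\<^sup>2 + 2 * (cmod (g t))\<^sup>2)"
    using assms by (auto simp: sq_int_def)
  then have "integrable lborel (\<lambda>t. (cmod (f t + g t))\<^sup>2)"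
  proof (rule Bochner_Integration.integrable_bound)
    show "AE t in lborel. norm ((cmod (f t + g t))\<^sup>2)
        \<le> norm (2 * (cmod (f t))\<^sup>2 + 2 * (cmod (g t))\<^sup>2)"
    proof (rule AE_I2)
      fix t
      have "(cmod (f t + g t))\<^sup>2 \<le> (cmod (f t) + cmod (g t))\<^sup>2"
        by (intro power_mono norm_triangle_ineq) auto
      also have "\<dots> \<le> 2 * (cmod (f t))\<^sup>2 + 2 * (cmod (g t))\<^sup>2"
        using sum_squares_bound[of "cmod (f t)" "cmod (g t)"] by (simp add: power2_sum)
      finally show "norm ((cmod (f t + g t))\<^sup>2)
        \<le> norm (2 * (cmod (f t))\<^sup>2 + 2 * (cmod (g t))\<^sup>2)" by simp
    qed
  qed measurable
  then show ?thesis by (simp add: sq_int_def)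
qed

lemma sq_int_cmult:
  assumes "sq_int f"
  shows "sq_int (\<lambda>t. c * f t)"
  using assms by (auto simp: sq_int_def norm_mult power_mult_distrib)

lemma borel_measurable_cnj [measurable]: "cnj \<in> borel_measurable borel"
  by (intro borel_measurable_continuous_onI continuous_intros)

lemma integrable_mult_cnj:
  assumes "sq_int f" "sq_int g"
  shows "integrable lborel (\<lambda>t. f t * cnj (g t))"
proof -
  have [measurable]: "f \<in> borel_measurable lborel" "g \<in> borel_measurable lborel"
    using assms by (auto simp: sq_int_def)
  have "integrable lborel (\<lambda>t. (cmod (f t))\<^sup>2 + (cmod (g t))\<^sup>2)"
    using assms by (auto simp: sq_int_def)
  then show ?thesis
  proof (rule Bochner_Integration.integrable_bound)
    show "AE t in lborel. norm (f t * cnj (g t)) \<le> norm ((cmod (f t))\<^sup>2 + (cmod (g t))\<^sup>2)"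
    proof (rule AE_I2)
      fix t
      have "2 * cmod (f t) * cmod (g t) \<le> (cmod (f t))\<^sup>2 + (cmod (g t))\<^sup>2"
        by (rule sum_squares_bound)
      moreover have "0 \<le> cmod (f t) * cmod (g t)" by simp
      ultimately have "cmod (f t) * cmod (g t) \<le> (cmod (f t))\<^sup>2 + (cmod (g t))\<^sup>2"
        by linarith
      then show "norm (f t * cnj (g t)) \<le> norm ((cmod (f t))\<^sup>2 + (cmod (g t))\<^sup>2)"
        by (simp add: norm_mult)
    qed
  qed measurable
qed

lift_definition cinner :: "L2 \<Rightarrow> L2 \<Rightarrow> complex"
  is "\<lambda>f g. integral\<^sup>L lborel (\<lambda>t. f t * cnj (g t))"
proof -
  fix f f' g g' :: "real \<Rightarrow> complex"
  assume a: "l2_eq f f'" "l2_eq g g'"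
  then have [measurable]: "f \<in> borel_measurable lborel" "g \<in> borel_measurable lborel"
    "f' \<in> borel_measurable lborel" "g' \<in> borel_measurable lborel"
    by (auto simp: l2_eq_def sq_int_def)
  show "integral\<^sup>L lborel (\<lambda>t. f t * cnj (g t)) = integral\<^sup>L lborel (\<lambda>t. f' t * cnj (g' t))"
  proof (rule integral_cong_AE)
    show "AE t in lborel. f t * cnj (g t) = f' t * cnj (g' t)"
      using l2_eqD(3)[OF a(1)] l2_eqD(3)[OF a(2)] by eventually_elim simp
  qed measurable
qed

lift_definition scaleC :: "complex \<Rightarrow> L2 \<Rightarrow> L2" is "\<lambda>c f t. c * f t"
  by (auto simp: l2_eq_def intro: sq_int_cmult)

instantiation L2 :: real_inner
begin

lift_definition zero_L2 :: L2 is "\<lambda>t. 0"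
  by (simp add: l2_eq_def sq_int_zero)

lift_definition plus_L2 :: "L2 \<Rightarrow> L2 \<Rightarrow> L2" is "\<lambda>f g t. f t + g t"
  by (auto simp: l2_eq_def intro: sq_int_add elim!: AE_mp)

definition scaleR_L2 :: "real \<Rightarrow> L2 \<Rightarrow> L2" where
  "scaleR_L2 r x = scaleC (complex_of_real r) x"

definition uminus_L2 :: "L2 \<Rightarrow> L2" where
  "uminus_L2 x = scaleC (- 1) x"

definition minus_L2 :: "L2 \<Rightarrow> L2 \<Rightarrow> L2" where
  "minus_L2 x y = x + (- y)"

definition inner_L2 :: "L2 \<Rightarrow> L2 \<Rightarrow> real" where
  "inner_L2 x y = Re (cinner x y)"

definition norm_L2 :: "L2 \<Rightarrow> real" where
  "norm_L2 x = sqrt (inner x x)"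

definition sgn_L2 :: "L2 \<Rightarrow> L2" where
  "sgn_L2 x = scaleR (inverse (norm x)) x"

definition dist_L2 :: "L2 \<Rightarrow> L2 \<Rightarrow> real" where
  "dist_L2 x y = norm (x - y)"

definition uniformity_L2 :: "(L2 \<times> L2) filter" where
  "uniformity_L2 = (INF e\<in>{0 <..}. principal {(x, y). dist x y < e})"

definition open_L2 :: "L2 set \<Rightarrow> bool" where
  "open_L2 U \<longleftrightarrow> (\<forall>x\<in>U. \<forall>\<^sub>F (x', y) in uniformity. x' = x \<longrightarrow> y \<in> U)"

lemma l2_eq_refl: "sq_int f \<Longrightarrow> l2_eq f f"
  by (simp add: l2_eq_def)

instance
proof
  fix x y z :: L2 and a b :: real
  show "x + y + z = x + (y + z)"
    by transfer (auto simp: l2_eq_def add.assoc intro!: sq_int_add)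
  show "x + y = y + x"
    by transfer (auto simp: l2_eq_def add.commute intro!: sq_int_add)
  show "0 + x = x"
    by transfer (auto simp: l2_eq_def)
  show "- x + x = 0"
    unfolding uminus_L2_def
    by transfer (auto simp: l2_eq_def sq_int_zero)
  show "x - y = x + - y"
    by (simp add: minus_L2_def)
  show "a *\<^sub>R (x + y) = a *\<^sub>R x + a *\<^sub>R y"
    unfolding scaleR_L2_def
    by transfer (auto simp: l2_eq_def distrib_left intro!: sq_int_add sq_int_cmult)
  show "(a + b) *\<^sub>R x = a *\<^sub>R x + b *\<^sub>R x"
    unfolding scaleR_L2_def
    by transfer (auto simp: l2_eq_def distrib_right intro!: sq_int_add sq_int_cmult)
  show "a *\<^sub>R b *\<^sub>R x = (a * b) *\<^sub>R x"
    unfolding scaleR_L2_def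
    by transfer (auto simp: l2_eq_def mult.assoc intro!: sq_int_cmult dest: sq_int_cmult[of _ "_ * _"])
  show "1 *\<^sub>R x = x"
    unfolding scaleR_L2_def by transfer (auto simp: l2_eq_def)
  show "dist x y = norm (x - y)"
    by (rule dist_L2_def)
  show "sgn x = scaleR (inverse (norm x)) x"
    by (rule sgn_L2_def)
  show "uniformity = (INF e\<in>{0 <..}. principal {(x::L2, y). dist x y < e})"
    by (rule uniformity_L2_def)
  show "open U \<longleftrightarrow> (\<forall>x\<in>U. \<forall>\<^sub>F (x', y) in uniformity. x' = x \<longrightarrow> y \<in> U)" for U :: "L2 set"
    by (rule open_L2_def)
  show "norm x = sqrt (inner x x)"
    by (rule norm_L2_def)
  show "inner x y = inner y x"
    unfolding inner_L2_def
  proof transfer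
    fix f g :: "real \<Rightarrow> complex"
    assume "l2_eq f f" "l2_eq g g"
    then have i: "integrable lborel (\<lambda>t. f t * cnj (g t))" "integrable lborel (\<lambda>t. g t * cnj (f t))"
      by (auto intro: integrable_mult_cnj dest: l2_eqD)
    show "Re (integral\<^sup>L lborel (\<lambda>t. f t * cnj (g t))) = Re (integral\<^sup>L lborel (\<lambda>t. g t * cnj (f t)))"
      unfolding integral_Re[OF i(1), symmetric] integral_Re[OF i(2), symmetric]
      by (simp add: mult.commute)
  qed
  show "inner (x + y) z = inner x z + inner y z"
    unfolding inner_L2_def
    by transfer (simp add: distrib_right integrable_mult_cnj l2_eqD)
  show "inner (a *\<^sub>R x) y = a * inner x y"
    unfolding inner_L2_def scaleR_L2_def
    by transfer (simp add: mult.assoc)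
  have sq: "z * cnj z = complex_of_real ((cmod z)\<^sup>2)" for z
    by (rule complex_norm_square[symmetric])
  show "0 \<le> inner x x"
    unfolding inner_L2_def
    by transfer (simp only: sq integral_complex_of_real Re_complex_of_real, simp)
  show "inner x x = 0 \<longleftrightarrow> x = 0"
    unfolding inner_L2_def
  proof transfer
    fix f :: "real \<Rightarrow> complex"
    assume "l2_eq f f"
    then have f: "sq_int f" "integrable lborel (\<lambda>t. (cmod (f t))\<^sup>2)"
      by (auto simp: l2_eq_def sq_int_def)
    have "Re (integral\<^sup>L lborel (\<lambda>t. f t * cnj (f t))) = 0
        \<longleftrightarrow> integral\<^sup>L lborel (\<lambda>t. (cmod (f t))\<^sup>2) = 0"
      by (simp only: sq integral_complex_of_real Re_complex_of_real)
    also have "\<dots> \<longleftrightarrow> (AE t in lborel. (cmod (f t))\<^sup>2 = 0)"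
      by (rule integral_nonneg_eq_0_iff_AE[OF f(2)]) simp
    also have "\<dots> \<longleftrightarrow> l2_eq f (\<lambda>t. 0)"
      using f(1) by (simp add: l2_eq_def sq_int_zero)
    finally show "Re (integral\<^sup>L lborel (\<lambda>t. f t * cnj (f t))) = 0 \<longleftrightarrow> l2_eq f (\<lambda>t. 0)" .
  qed
qed

end

lemma norm_L2_eq_integral: "(norm x)\<^sup>2 = integral\<^sup>L lborel (\<lambda>t. (cmod (rep_L2 x t))\<^sup>2)"
proof -
  have sq: "z * cnj z = complex_of_real ((cmod z)\<^sup>2)" for z
    by (rule complex_norm_square[symmetric])
  have "(norm x)\<^sup>2 = Re (cinner x x)"
    by (metis inner_L2_def power2_norm_eq_inner)
  also have "\<dots> = integral\<^sup>L lborel (\<lambda>t. (cmod (rep_L2 x t))\<^sup>2)"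
    unfolding cinner.rep_eq
    by (simp only: sq integral_complex_of_real Re_complex_of_real)
  finally show ?thesis .
qed

lemma cinner_scaleC_left: "cinner (scaleC c x) y = c * cinner x y"
  by transfer (simp add: mult.assoc)

lemma scaleC_add_right: "scaleC c (x + y) = scaleC c x + scaleC c y"
  by transfer (auto simp: l2_eq_def distrib_left intro!: sq_int_add sq_int_cmult)

lemma scaleC_scaleC: "scaleC c (scaleC d x) = scaleC (c * d) x"
  by transfer (auto simp: l2_eq_def mult.assoc intro!: sq_int_cmult dest: sq_int_cmult[of _ "_ * _"])

lemma norm_scaleC: "norm (scaleC c x) = cmod c * norm x"
proof -
  have "Re (cinner (scaleC c x) (scaleC c x)) = (cmod c)\<^sup>2 * Re (cinner x x)"
  proof transfer
    fix c :: complex and f :: "real \<Rightarrow> complex"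
    have *: "c * f t * cnj (c * f t) = complex_of_real ((cmod c)\<^sup>2) * (f t * cnj (f t))" for t
      unfolding complex_norm_square by (simp add: mult_ac)
    show "Re (integral\<^sup>L lborel (\<lambda>t. c * f t * cnj (c * f t)))
        = (cmod c)\<^sup>2 * Re (integral\<^sup>L lborel (\<lambda>t. f t * cnj (f t)))"
      by (simp only: * integral_mult_right_zero times_complex.sel(1) Re_complex_of_real
          Im_complex_of_real)
  qed
  then show ?thesis
    by (simp add: norm_L2_def inner_L2_def real_sqrt_mult)
qed

lift_definition scalar_op :: "complex \<Rightarrow> L2 \<Rightarrow>\<^sub>L L2" is scaleC
proof (rule bounded_linear_intro)
  fix c :: complex and x y :: L2 and r :: real
  show "scaleC c (x + y) = scaleC c x + scaleC c y"
    by (rule scaleC_add_right)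
  show "scaleC c (r *\<^sub>R x) = r *\<^sub>R scaleC c x"
    by (simp add: scaleR_L2_def scaleC_scaleC mult.commute)
  show "norm (scaleC c x) \<le> norm x * cmod c"
    by (simp add: norm_scaleC mult.commute)
qed

definition complex_linear :: "(L2 \<Rightarrow>\<^sub>L L2) \<Rightarrow> bool" where
  "complex_linear T \<longleftrightarrow> (\<forall>c f. T (scaleC c f) = scaleC c (T f))"

text \<open>The adjoint exists for complex-linear operators; for others the value is unspecified.\<close>

definition adj :: "(L2 \<Rightarrow>\<^sub>L L2) \<Rightarrow> (L2 \<Rightarrow>\<^sub>L L2)" where
  "adj T = (THE S :: L2 \<Rightarrow>\<^sub>L L2. \<forall>f g. cinner (T f) g = cinner f (S g))"

definition unitary_op :: "(L2 \<Rightarrow>\<^sub>L L2) \<Rightarrow> bool" where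
  "unitary_op T \<longleftrightarrow> (\<forall>f g. cinner (T f) (T g) = cinner f g) \<and> surj (blinfun_apply T)"

primrec op_power :: "(L2 \<Rightarrow>\<^sub>L L2) \<Rightarrow> nat \<Rightarrow> (L2 \<Rightarrow>\<^sub>L L2)" where
  "op_power T 0 = id_blinfun"
| "op_power T (Suc n) = T o\<^sub>L op_power T n"

definition cstar_subalgebra :: "(L2 \<Rightarrow>\<^sub>L L2) set \<Rightarrow> bool" where
  "cstar_subalgebra A \<longleftrightarrow> closed A \<and> 0 \<in> A \<and>
     (\<forall>T\<in>A. complex_linear T \<and> adj T \<in> A \<and> (\<forall>c. scalar_op c o\<^sub>L T \<in> A)) \<and>
     (\<forall>S\<in>A. \<forall>T\<in>A. S + T \<in> A \<and> S o\<^sub>L T \<in> A)"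

definition generated_cstar_algebra :: "(L2 \<Rightarrow>\<^sub>L L2) set \<Rightarrow> (L2 \<Rightarrow>\<^sub>L L2) set" where
  "generated_cstar_algebra G = \<Inter>{A. cstar_subalgebra A \<and> G \<subseteq> A}"

definition cstar_isomorphic :: "(L2 \<Rightarrow>\<^sub>L L2) set \<Rightarrow> (L2 \<Rightarrow>\<^sub>L L2) set \<Rightarrow> bool"
    (infix \<open>\<cong>\<^sub>*\<close> 50) where
  "A \<cong>\<^sub>* B \<longleftrightarrow> (\<exists>\<phi>. bij_betw \<phi> A B \<and>
     (\<forall>S\<in>A. \<forall>T\<in>A. \<phi> (S + T) = \<phi> S + \<phi> T \<and> \<phi> (S o\<^sub>L T) = \<phi> S o\<^sub>L \<phi> T) \<and>
     (\<forall>T\<in>A. \<phi> (adj T) = adj (\<phi> T) \<and> (\<forall>c. \<phi> (scalar_op c o\<^sub>L T) = scalar_op c o\<^sub>L \<phi> T)))"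

text \<open>\<open>op_given_by \<Phi> T\<close>: the operator \<open>T\<close> is given almost everywhere by the formula \<open>\<Phi>\<close>, for every
  choice of a representative. It determines \<open>T\<close> uniquely; \<open>op_of\<close> is meaningful only when such an
  operator exists.\<close>

definition op_given_by :: "((real \<Rightarrow> complex) \<Rightarrow> real \<Rightarrow> complex) \<Rightarrow> (L2 \<Rightarrow>\<^sub>L L2) \<Rightarrow> bool" where
  "op_given_by \<Phi> T \<longleftrightarrow>
     (\<forall>f. sq_int f \<longrightarrow> (AE t in lborel. rep_L2 (T (abs_L2 f)) t = \<Phi> f t))"

definition op_of :: "((real \<Rightarrow> complex) \<Rightarrow> real \<Rightarrow> complex) \<Rightarrow> (L2 \<Rightarrow>\<^sub>L L2)" where
  "op_of \<Phi> = (THE T. op_given_by \<Phi> T)"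

abbreviation circle :: "complex set" where
  "circle \<equiv> sphere 0 1"

definition circle_lift :: "(complex \<Rightarrow> complex) \<Rightarrow> (real \<Rightarrow> real) \<Rightarrow> bool" where
  "circle_lift \<alpha> \<gamma> \<longleftrightarrow> continuous_on UNIV \<gamma> \<and> (\<forall>t. \<alpha> (cis (2 * pi * t)) = cis (2 * pi * \<gamma> t))"

definition orientation_preserving_homeo :: "(complex \<Rightarrow> complex) \<Rightarrow> bool" where
  "orientation_preserving_homeo \<alpha> \<longleftrightarrow>
     (\<exists>\<beta>. homeomorphism circle circle \<alpha> \<beta>) \<and> (\<exists>\<gamma>. circle_lift \<alpha> \<gamma> \<and> strict_mono \<gamma>)"

text \<open>The limit exists for every lift and its fractional part is independent of all choices when
  \<open>\<alpha>\<close> is an orientation preserving homeomorphism of the circle.\<close>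

definition rotation_number :: "(complex \<Rightarrow> complex) \<Rightarrow> real" where
  "rotation_number \<alpha> = (THE \<tau>. \<forall>\<gamma> t. circle_lift \<alpha> \<gamma> \<longrightarrow>
     (\<exists>l. (\<lambda>n. (\<gamma> ^^ n) t / real n) \<longlonglongrightarrow> l \<and> \<tau> = frac l))"

definition rotation :: "real \<Rightarrow> complex \<Rightarrow> complex" where
  "rotation \<tau> z = cis (2 * pi * \<tau>) * z"

definition full_orbit :: "(complex \<Rightarrow> complex) \<Rightarrow> complex \<Rightarrow> complex set" where
  "full_orbit \<alpha> x = range (\<lambda>n. (\<alpha> ^^ n) x) \<union> range (\<lambda>n. (inv_into circle \<alpha> ^^ n) x)"

text \<open>For irrational rotation number the set of accumulation points of the orbit of \<open>x\<close> is the
  same for all \<open>x\<close> in the circle, so the quantifier over \<open>x\<close> is immaterial in that case.\<close>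

definition topologically_transitive :: "(complex \<Rightarrow> complex) \<Rightarrow> bool" where
  "topologically_transitive \<alpha> \<longleftrightarrow> (\<forall>x\<in>circle. {y. y islimpt full_orbit \<alpha> x} = circle)"

text \<open>If 1 is not fixed by \<open>\<alpha>\<close>, this is the lift with \<open>0 < \<gamma> 0 < 1\<close>. Allowing the value 0 gives a
  meaning to the algebra also when 1 is a fixed point; the identity then has the lift
  \<open>\<gamma> t = t\<close>, and every rotation by \<open>\<tau> \<in> {0..<1}\<close> has the lift \<open>\<gamma> t = t + \<tau>\<close>.\<close>

definition normal_lift :: "(complex \<Rightarrow> complex) \<Rightarrow> real \<Rightarrow> real" where
  "normal_lift \<alpha> = (THE \<gamma>. circle_lift \<alpha> \<gamma> \<and> 0 \<le> \<gamma> 0 \<and> \<gamma> 0 < 1)"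

text \<open>Where \<open>\<gamma>\<close> is not differentiable, \<open>deriv\<close> is arbitrary; this is a null set, as \<open>\<gamma>\<close> is
  monotone. The formula gives a unitary operator only if \<open>\<gamma>\<close> and its inverse are locally absolutely
  continuous.\<close>

definition shift_formula :: "(real \<Rightarrow> real) \<Rightarrow> (real \<Rightarrow> complex) \<Rightarrow> real \<Rightarrow> complex" where
  "shift_formula \<gamma> f t = complex_of_real (sqrt \<bar>deriv \<gamma> t\<bar>) * f (\<gamma> t)"

definition mult_op :: "(real \<Rightarrow> complex) \<Rightarrow> (L2 \<Rightarrow>\<^sub>L L2)" where
  "mult_op a = op_of (\<lambda>f t. a t * f t)"

definition half_line_proj :: "L2 \<Rightarrow>\<^sub>L L2" where
  "half_line_proj = mult_op (indicator {0..})"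

text \<open>Operators on the subspace of functions supported on the half-line are represented by
  operators \<open>T\<close> on the whole space with \<open>T = P T P\<close>, that is, extended by 0 to the orthogonal
  complement. Only the zeroth power of \<open>U\<close> is affected by this: it is the identity of the whole
  space rather than \<open>P\<close>, which makes no difference when it is multiplied with such \<open>T\<close>.\<close>

definition compression :: "(L2 \<Rightarrow>\<^sub>L L2) \<Rightarrow> (L2 \<Rightarrow>\<^sub>L L2)" where
  "compression T = half_line_proj o\<^sub>L T o\<^sub>L half_line_proj"

definition periodic_mult_ops :: "(L2 \<Rightarrow>\<^sub>L L2) set" where
  "periodic_mult_ops =
     {compression (mult_op a) |a. continuous_on UNIV a \<and> (\<forall>t. a (t + 1) = a t)}"

definition circle_algebra :: "(complex \<Rightarrow> complex) \<Rightarrow> (L2 \<Rightarrow>\<^sub>L L2) set" where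
  "circle_algebra \<alpha> =
     (let U = compression (op_of (shift_formula (normal_lift \<alpha>)))
      in generated_cstar_algebra
           (\<Union>n. {op_power (adj U) n o\<^sub>L T o\<^sub>L op_power U n |T. T \<in> periodic_mult_ops}))"

text \<open>The order topology of \<open>enat\<close> is that of the one-point compactification of the discrete
  space of natural numbers.\<close>

definition M_arc :: "(real \<Rightarrow> real) \<Rightarrow> nat \<Rightarrow> (enat \<times> complex) set" where
  "M_arc \<gamma> N = {enat N} \<times> (\<lambda>t. cis (2 * pi * t)) ` {(\<gamma> ^^ N) 0 .. (\<gamma> ^^ Suc N) 0}"

definition M_infinity :: "(enat \<times> complex) set" where
  "M_infinity = {\<infinity>} \<times> circle"

definition M_tilde :: "(real \<Rightarrow> real) \<Rightarrow> (enat \<times> complex) set" where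
  "M_tilde \<gamma> = (\<Union>N. M_arc \<gamma> N) \<union> M_infinity"

definition M_endpoints :: "(real \<Rightarrow> real) \<Rightarrow> (enat \<times> complex) set" where
  "M_endpoints \<gamma> = (\<Union>N. {enat N} \<times> {cis (2 * pi * (\<gamma> ^^ N) 0), cis (2 * pi * (\<gamma> ^^ Suc N) 0)})"

definition endpoint_limits :: "(real \<Rightarrow> real) \<Rightarrow> (enat \<times> complex) set" where
  "endpoint_limits \<gamma> = top_of_set (M_tilde \<gamma>) derived_set_of M_endpoints \<gamma>"

definition perfect_in :: "'a topology \<Rightarrow> 'a set \<Rightarrow> bool" where
  "perfect_in X S \<longleftrightarrow> S \<noteq> {} \<and> X derived_set_of S = S"

definition nowhere_dense_in :: "'a topology \<Rightarrow> 'a set \<Rightarrow> bool" where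
  "nowhere_dense_in X S \<longleftrightarrow> X interior_of (X closure_of S) = {}"

end

theory Submission
  imports Defs
begin

text \<open>
  Conjugation by the compressed shift turns multiplication by a periodic function into
  multiplication by a periodic function cut off at \<open>\<gamma>\<^sup>n(0)\<close>. By the Stone-Weierstrass theorem these
  products generate exactly the multiplications by functions \<open>F \<circ> q\<close>, where \<open>F\<close> is continuous on the
  compact space \<open>M\<close> made of the arcs and the circle at infinity and \<open>q\<close> is the path that runs through
  the arcs one after the other. Since a character of \<open>C(M)\<close> is a point evaluation, two such algebras
  are isomorphic if and only if their spaces \<open>M\<close> are homeomorphic.

  Such a homeomorphism onto the space of the rotation by \<open>\<tau>\<close> exists as soon as some homeomorphism
  \<open>k\<close> of the circle satisfies \<open>k(\<gamma>\<^sup>N(0)) - N\<tau> \<rightarrow> 0\<close>: correct \<open>k\<close> by an affine map on each arc. For a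
  rational rotation number \<open>\<gamma>\<^sup>N(0)\<close> approaches a periodic orbit, and averaging \<open>\<gamma>\<^sup>0, \<dots>, \<gamma>\<^sup>n\<^sup>-\<^sup>1\<close>
  linearizes that orbit. For an irrational one there is a monotone semiconjugacy \<open>h\<close> to the rotation;
  the limit points of every orbit are the points near which \<open>h\<close> is not constant, and they form either
  the whole circle, in which case \<open>h\<close> is a homeomorphism, or a perfect nowhere dense set.

  Conversely, the endpoints of the arcs are the points whose removal does not disconnect an open
  connected neighbourhood, so a homeomorphism preserves their limit points. For rotations these are
  finite in number or fill the whole circle.
\<close>

section \<open>Multiplication operators\<close>

text \<open>The weight \<open>sqrt \<bar>deriv \<gamma> t\<bar>\<close> enters only through the
  assumption that the shift is unitary: passing a multiplication by \<open>b\<close> through the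
  shift merely substitutes \<gamma> in \<open>b\<close>, and the compression does no harm as long as
  both functions vanish on the negative axis. The delicate point is the lift. The rotation number is
  the fractional part of a translation number in [0,1], and the condition 0 < \<gamma>(0) < 1 allows
  both end values. For translation number 0 the points \<gamma>^N(0) stay below a fixed point, and
  the half line beyond it belongs to no arc; hence everything that identifies the algebra with C(M)
  assumes that these points are unbounded. The rotation by 0 has degenerate arcs and is told apart
  by its idempotents. The condition k(\<gamma>^N(0)) - N\<tau> -> 0 is what continuity at infinity
  asks for: on the arc N the affine correction moves points by at most the sum of two consecutive
  errors.\<close>

definition bounded_borel :: "(real \<Rightarrow> complex) \<Rightarrow> bool" where
  "bounded_borel a \<longleftrightarrow> a \<in> borel_measurable borel \<and> bounded (range a)"

lemma bounded_borel_const [simp]: "bounded_borel (\<lambda>t. c)"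
  by (simp add: bounded_borel_def)

lemma bounded_borel_add: "bounded_borel a \<Longrightarrow> bounded_borel b \<Longrightarrow> bounded_borel (\<lambda>t. a t + b t)"
  by (auto simp: bounded_borel_def bounded_plus_comp)

lemma bounded_borel_mult:
  assumes "bounded_borel a" "bounded_borel b"
  shows "bounded_borel (\<lambda>t. a t * b t)"
proof -
  obtain A B where AB: "\<And>t. cmod (a t) \<le> A" "\<And>t. cmod (b t) \<le> B"
    using assms by (auto simp: bounded_borel_def bounded_iff)
  have "cmod (a t * b t) \<le> A * B" for t
    unfolding norm_mult using AB norm_ge_zero order_trans by (intro mult_mono) blast+
  then show ?thesis using assms by (auto simp: bounded_borel_def bounded_iff)
qed

lemma bounded_borel_cnj: "bounded_borel a \<Longrightarrow> bounded_borel (\<lambda>t. cnj (a t))"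
  by (auto simp: bounded_borel_def bounded_iff intro: measurable_compose[OF _ borel_measurable_cnj])

lemma bounded_borel_diff: "bounded_borel a \<Longrightarrow> bounded_borel b \<Longrightarrow> bounded_borel (\<lambda>t. a t - b t)"
  by (auto simp: bounded_borel_def bounded_minus_comp)

lemma bounded_borel_indicator:
  "A \<in> sets borel \<Longrightarrow> bounded_borel (indicator A)"
  by (auto simp: bounded_borel_def bounded_iff indicator_def)

lemma bounded_borel_comp:
  assumes "bounded_borel a" "continuous_on UNIV \<gamma>"
  shows "bounded_borel (\<lambda>t. a (\<gamma> t))"
proof -
  have "\<gamma> \<in> borel_measurable borel" using assms(2) by (rule borel_measurable_continuous_onI)
  then show ?thesis using assms
    by (auto simp: bounded_borel_def intro: measurable_compose bounded_subset)
qed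

lemma abs_L2_cases: obtains f where "sq_int f" "x = abs_L2 f"
  using Quotient_L2 unfolding Quotient_def by (metis l2_eqD(1))

lemma abs_L2_eq_iff:
  "sq_int f \<Longrightarrow> sq_int g \<Longrightarrow> abs_L2 f = abs_L2 g \<longleftrightarrow> (AE t in lborel. f t = g t)"
  using Quotient_L2 unfolding Quotient_def by (metis l2_eq_def l2_eq_refl)

lemma rep_abs_L2: "sq_int f \<Longrightarrow> l2_eq (rep_L2 (abs_L2 f)) f"
  using Quotient_rep_abs[OF Quotient_L2] l2_eq_refl by metis

lemma sq_int_rep: "sq_int (rep_L2 x)"
  using Quotient_L2 unfolding Quotient_def by (metis l2_eqD(1))

lemma abs_rep_L2: "abs_L2 (rep_L2 x) = x"
  using Quotient_abs_rep[OF Quotient_L2] by metis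

lemma abs_L2_add: "sq_int f \<Longrightarrow> sq_int g \<Longrightarrow> abs_L2 f + abs_L2 g = abs_L2 (\<lambda>t. f t + g t)"
  by (rule plus_L2.abs_eq) (auto intro: l2_eq_refl)

lemma scaleC_abs_L2: "sq_int f \<Longrightarrow> scaleC c (abs_L2 f) = abs_L2 (\<lambda>t. c * f t)"
  by (rule scaleC.abs_eq) (auto intro: l2_eq_refl)

lemma cinner_abs_L2:
  "sq_int f \<Longrightarrow> sq_int g \<Longrightarrow> cinner (abs_L2 f) (abs_L2 g) = integral\<^sup>L lborel (\<lambda>t. f t * cnj (g t))"
  by (rule cinner.abs_eq) (auto intro: l2_eq_refl)

lemma norm_abs_L2: "sq_int f \<Longrightarrow> (norm (abs_L2 f))\<^sup>2 = integral\<^sup>L lborel (\<lambda>t. (cmod (f t))\<^sup>2)"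
proof -
  assume f: "sq_int f"
  have "integral\<^sup>L lborel (\<lambda>t. (cmod (rep_L2 (abs_L2 f) t))\<^sup>2) = integral\<^sup>L lborel (\<lambda>t. (cmod (f t))\<^sup>2)"
    using rep_abs_L2[OF f] l2_eqD(3)[OF rep_abs_L2[OF f]]
    by (intro integral_cong_AE) (auto simp: l2_eq_def sq_int_def)
  then show ?thesis by (simp add: norm_L2_eq_integral)
qed

lemma sq_int_mult:
  assumes "bounded_borel a" "sq_int f"
  shows "sq_int (\<lambda>t. a t * f t)"
proof -
  obtain B where B: "\<And>t. cmod (a t) \<le> B" using assms by (auto simp: bounded_borel_def bounded_iff)
  have [measurable]: "a \<in> borel_measurable borel" "f \<in> borel_measurable borel"
    using assms by (auto simp: bounded_borel_def sq_int_def)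
  have "integrable lborel (\<lambda>t. B\<^sup>2 * (cmod (f t))\<^sup>2)" using assms by (auto simp: sq_int_def)
  then have "integrable lborel (\<lambda>t. (cmod (a t * f t))\<^sup>2)"
    by (rule Bochner_Integration.integrable_bound)
       (auto simp: norm_mult power_mult_distrib intro!: mult_right_mono power_mono B)
  then show ?thesis by (auto simp: sq_int_def)
qed

lemma norm_mult_L2_le:
  assumes "bounded_borel a" "sq_int f" and B: "\<And>t. cmod (a t) \<le> B"
  shows "norm (abs_L2 (\<lambda>t. a t * f t)) \<le> B * norm (abs_L2 f)"
proof -
  have B0: "B \<ge> 0" using B[of 0] norm_ge_zero order_trans by blast
  have "(norm (abs_L2 (\<lambda>t. a t * f t)))\<^sup>2 \<le> (\<integral>t. B\<^sup>2 * (cmod (f t))\<^sup>2 \<partial>lborel)"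
    unfolding norm_abs_L2[OF sq_int_mult[OF assms(1,2)]]
    using sq_int_mult[OF assms(1,2)] assms(2)
    by (intro integral_mono) (auto simp: sq_int_def norm_mult power_mult_distrib intro!: mult_right_mono power_mono B)
  also have "\<dots> = (B * norm (abs_L2 f))\<^sup>2"
    using assms(2) by (simp add: norm_abs_L2 power_mult_distrib)
  finally show ?thesis by (rule power2_le_imp_le) (use B0 in auto)
qed

lemma op_given_by_unique:
  assumes "op_given_by \<Phi> S" "op_given_by \<Phi> T"
  shows "S = T"
proof (rule blinfun_eqI)
  fix x obtain f where f: "sq_int f" "x = abs_L2 f" by (rule abs_L2_cases)
  have "AE t in lborel. rep_L2 (S x) t = \<Phi> f t" "AE t in lborel. rep_L2 (T x) t = \<Phi> f t"
    using assms f unfolding op_given_by_def by auto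
  then have "AE t in lborel. rep_L2 (S x) t = rep_L2 (T x) t" by eventually_elim simp
  then have "abs_L2 (rep_L2 (S x)) = abs_L2 (rep_L2 (T x))" by (simp add: abs_L2_eq_iff sq_int_rep)
  then show "S x = T x" by (simp add: abs_rep_L2)
qed

lemma op_of_eq: "op_given_by \<Phi> T \<Longrightarrow> op_of \<Phi> = T"
  unfolding op_of_def using op_given_by_unique by (metis the_equality)

lemma op_given_by_apply:
  assumes "op_given_by \<Phi> T" "sq_int f" "sq_int (\<Phi> f)"
  shows "T (abs_L2 f) = abs_L2 (\<Phi> f)"
proof -
  have "abs_L2 (rep_L2 (T (abs_L2 f))) = abs_L2 (\<Phi> f)"
    using assms by (auto simp: abs_L2_eq_iff sq_int_rep op_given_by_def)
  then show ?thesis by (simp add: abs_rep_L2)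
qed

lemma op_given_byI:
  fixes T :: "L2 \<Rightarrow>\<^sub>L L2"
  assumes "\<And>f. sq_int f \<Longrightarrow> sq_int (\<Phi> f)"
    and "\<And>f. sq_int f \<Longrightarrow> T (abs_L2 f) = abs_L2 (\<Phi> f)"
  shows "op_given_by \<Phi> T"
  unfolding op_given_by_def using assms rep_abs_L2 l2_eqD(3) by metis

lemma scaleR_abs_L2: "sq_int f \<Longrightarrow> r *\<^sub>R abs_L2 f = abs_L2 (\<lambda>t. of_real r * f t)"
  by (simp add: scaleR_L2_def scaleC_abs_L2)

text \<open>\<open>\<Phi>\<close> acts on functions, the operator on classes: by \<open>cong\<close>
  the value on a class may be computed from the representative \<open>rep_L2 x\<close>, and
  \<open>bound\<close> makes the result continuous.\<close>

lemma op_given_by_exists: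
  assumes sq: "\<And>f. sq_int f \<Longrightarrow> sq_int (\<Phi> f)"
    and cong: "\<And>f g. sq_int f \<Longrightarrow> sq_int g \<Longrightarrow> AE t in lborel. f t = g t \<Longrightarrow> AE t in lborel. \<Phi> f t = \<Phi> g t"
    and add: "\<And>f g t. \<Phi> (\<lambda>t. f t + g t) t = \<Phi> f t + \<Phi> g t"
    and scale: "\<And>c f t. \<Phi> (\<lambda>t. c * f t) t = c * \<Phi> f t"
    and bound: "\<And>f. sq_int f \<Longrightarrow> norm (abs_L2 (\<Phi> f)) \<le> B * norm (abs_L2 f)"
  shows "\<exists>T. op_given_by \<Phi> T"
proof -
  define T where "T x = abs_L2 (\<Phi> (rep_L2 x))" for x
  have T: "T (abs_L2 f) = abs_L2 (\<Phi> f)" if "sq_int f" for f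
    unfolding T_def using rep_abs_L2[OF that] that
    by (metis abs_L2_eq_iff cong l2_eq_def sq)
  have "bounded_linear T"
  proof (rule bounded_linear_intro)
    fix x y :: L2 and r :: real
    obtain f g where fg: "sq_int f" "x = abs_L2 f" "sq_int g" "y = abs_L2 g" by (metis abs_L2_cases)
    show "T (x + y) = T x + T y"
      using fg by (simp add: abs_L2_add T sq_int_add add[abs_def] sq)
    show "T (r *\<^sub>R x) = r *\<^sub>R T x"
      using fg by (simp add: scaleR_abs_L2 T sq_int_cmult scale[abs_def] sq)
    show "norm (T x) \<le> norm x * B" using fg bound by (simp add: T mult.commute)
  qed
  then have "op_given_by \<Phi> (Blinfun T)"
    by (intro op_given_byI sq) (auto simp: bounded_linear_Blinfun_apply T)
  then show ?thesis ..
qed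

lemma mult_op_apply:
  assumes "bounded_borel a" "sq_int f"
  shows "mult_op a (abs_L2 f) = abs_L2 (\<lambda>t. a t * f t)"
proof -
  obtain B where B: "\<And>t. cmod (a t) \<le> B" using assms by (auto simp: bounded_borel_def bounded_iff)
  have "\<exists>T. op_given_by (\<lambda>f t. a t * f t) T"
    by (rule op_given_by_exists[where B=B])
       (auto simp: distrib_left mult.left_commute intro!: sq_int_mult assms norm_mult_L2_le B)
  then show ?thesis unfolding mult_op_def
    using assms op_given_by_apply op_of_eq sq_int_mult by metis
qed

lemma blinfun_eqI_abs_L2:
  assumes "\<And>f. sq_int f \<Longrightarrow> blinfun_apply S (abs_L2 f) = blinfun_apply T (abs_L2 f)"
  shows "S = T"
  by (rule blinfun_eqI) (metis assms abs_L2_cases)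

lemma mult_op_compose:
  "bounded_borel a \<Longrightarrow> bounded_borel b \<Longrightarrow> mult_op a o\<^sub>L mult_op b = mult_op (\<lambda>t. a t * b t)"
  by (rule blinfun_eqI_abs_L2) (simp add: mult_op_apply sq_int_mult bounded_borel_mult mult.assoc)

lemma mult_op_add:
  "bounded_borel a \<Longrightarrow> bounded_borel b \<Longrightarrow> mult_op a + mult_op b = mult_op (\<lambda>t. a t + b t)"
  by (rule blinfun_eqI_abs_L2)
     (simp add: mult_op_apply sq_int_mult bounded_borel_add plus_blinfun.rep_eq abs_L2_add distrib_right)

lemma scalar_op_mult_op:
  "bounded_borel a \<Longrightarrow> scalar_op c o\<^sub>L mult_op a = mult_op (\<lambda>t. c * a t)"
  by (rule blinfun_eqI_abs_L2)
     (simp add: mult_op_apply sq_int_mult bounded_borel_mult[of "\<lambda>t. c"] scalar_op.rep_eq scaleC_abs_L2 mult.assoc)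

lemma mult_op_diff:
  assumes "bounded_borel a" "bounded_borel b"
  shows "mult_op a - mult_op b = mult_op (\<lambda>t. a t - b t)"
proof -
  have "mult_op b + mult_op (\<lambda>t. a t - b t) = mult_op a"
    using assms by (simp add: mult_op_add bounded_borel_diff)
  then show ?thesis by (metis add_diff_cancel_left')
qed

lemma complex_linear_mult_op: "bounded_borel a \<Longrightarrow> complex_linear (mult_op a)"
  unfolding complex_linear_def
proof (intro allI)
  fix c x assume a: "bounded_borel a"
  obtain f where f: "sq_int f" "x = abs_L2 f" by (rule abs_L2_cases)
  show "mult_op a (scaleC c x) = scaleC c (mult_op a x)"
    using a f by (simp add: scaleC_abs_L2 mult_op_apply sq_int_cmult sq_int_mult mult_ac)
qed

lemma cinner_eq_zeroD: "(\<And>x. cinner x y = 0) \<Longrightarrow> y = 0"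
  by (metis inner_L2_def inner_eq_zero_iff zero_complex.sel(1))

lemma cinner_cnj: "cinner x y = cnj (cinner y x)"
proof -
  obtain f g where fg: "sq_int f" "x = abs_L2 f" "sq_int g" "y = abs_L2 g" by (metis abs_L2_cases)
  have "(\<lambda>t. f t * cnj (g t)) = (\<lambda>t. cnj (g t * cnj (f t)))" by (simp add: mult.commute)
  then show ?thesis using fg by (simp only: cinner_abs_L2 Bochner_Integration.integral_cnj)
qed

lemma cinner_add_left: "cinner (x + y) z = cinner x z + cinner y z"
  by transfer (simp add: distrib_right integrable_mult_cnj l2_eqD)

lemma cinner_diff_right: "cinner x (y - z) = cinner x y - cinner x z"
proof -
  have "cinner x y = cinner x (y - z) + cinner x z"
    by (metis cinner_add_left cinner_cnj complex_cnj_add diff_add_cancel)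
  then show ?thesis by simp
qed

text \<open>\<open>adj\<close> is a definite description, so its value is accessible only through a
  candidate; nondegeneracy of the inner product makes the candidate unique.\<close>

lemma adj_eqI:
  assumes "\<And>f g. cinner (blinfun_apply T f) g = cinner f (blinfun_apply S g)"
  shows "adj T = S"
  unfolding adj_def
proof (rule the_equality)
  fix R assume R: "\<forall>f g. cinner (blinfun_apply T f) g = cinner f (blinfun_apply R g)"
  show "R = S"
  proof (rule blinfun_eqI)
    fix y
    have "R y - S y = 0"
      by (rule cinner_eq_zeroD) (use R assms in \<open>simp add: cinner_diff_right\<close>)
    then show "R y = S y" by simp
  qed
qed (use assms in auto)

lemma cinner_mult_op:
  assumes "bounded_borel a"
  shows "cinner (mult_op a x) y = cinner x (mult_op (\<lambda>t. cnj (a t)) y)"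
proof -
  obtain f g where fg: "sq_int f" "x = abs_L2 f" "sq_int g" "y = abs_L2 g" by (metis abs_L2_cases)
  then show ?thesis using assms
    using sq_int_mult[OF bounded_borel_cnj[OF assms], of g]
    by (simp add: mult_op_apply bounded_borel_cnj sq_int_mult cinner_abs_L2) (simp add: mult_ac)
qed

lemma adj_mult_op: "bounded_borel a \<Longrightarrow> adj (mult_op a) = mult_op (\<lambda>t. cnj (a t))"
  by (rule adj_eqI) (rule cinner_mult_op)

lemma norm_mult_op_le:
  assumes "bounded_borel a" "\<And>t. cmod (a t) \<le> B"
  shows "norm (mult_op a) \<le> B"
proof (rule norm_blinfun_bound)
  show "0 \<le> B" using assms(2) norm_ge_zero order_trans by blast
  fix x obtain f where f: "sq_int f" "x = abs_L2 f" by (rule abs_L2_cases)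
  show "norm (mult_op a x) \<le> B * norm x" using f assms norm_mult_L2_le by (simp add: mult_op_apply)
qed

text \<open>The test vector is the indicator of the interval, of squared norm \<open>v - u\<close>.
  This lower bound is what makes symbols embed isometrically.\<close>

lemma norm_mult_op_ge:
  assumes a: "bounded_borel a" and "u < v" and c: "\<And>t. u < t \<Longrightarrow> t < v \<Longrightarrow> c \<le> cmod (a t)"
  shows "c \<le> norm (mult_op a)"
proof (cases "c \<le> 0")
  case True then show ?thesis using norm_ge_zero order_trans by blast
next
  case False
  define f :: "real \<Rightarrow> complex" where "f = indicator {u<..<v}"
  have fi: "(\<lambda>t. (cmod (f t))\<^sup>2) = indicator {u<..<v}" by (auto simp: f_def indicator_def)
  have "f \<in> borel_measurable lborel" by (simp add: f_def)
  moreover have "integrable lborel (indicator {u<..<v} :: real \<Rightarrow> real)"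
    by (rule integrable_real_indicator) (use \<open>u < v\<close> in auto)
  ultimately have sq: "sq_int f" unfolding sq_int_def fi by simp
  have nf: "(norm (abs_L2 f))\<^sup>2 = v - u" unfolding norm_abs_L2[OF sq] fi using \<open>u < v\<close> by simp
  have "c\<^sup>2 * (norm (abs_L2 f))\<^sup>2 = (\<integral>t. c\<^sup>2 * (cmod (f t))\<^sup>2 \<partial>lborel)"
    by (simp add: norm_abs_L2[OF sq])
  also have "\<dots> \<le> (\<integral>t. (cmod (a t * f t))\<^sup>2 \<partial>lborel)"
  proof (rule integral_mono)
    fix t show "c\<^sup>2 * (cmod (f t))\<^sup>2 \<le> (cmod (a t * f t))\<^sup>2"
      using c[of t] False by (auto simp: f_def indicator_def)
  qed (use sq sq_int_mult[OF a sq] in \<open>auto simp: sq_int_def\<close>)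
  also have "\<dots> = (norm (mult_op a (abs_L2 f)))\<^sup>2"
    by (simp add: mult_op_apply[OF a sq] norm_abs_L2 sq_int_mult[OF a sq])
  also have "\<dots> \<le> (norm (mult_op a) * norm (abs_L2 f))\<^sup>2"
    by (intro power_mono norm_blinfun) auto
  finally have "(c * norm (abs_L2 f))\<^sup>2 \<le> (norm (mult_op a) * norm (abs_L2 f))\<^sup>2"
    by (simp add: power_mult_distrib)
  then have "c * norm (abs_L2 f) \<le> norm (mult_op a) * norm (abs_L2 f)"
    by (rule power2_le_imp_le) simp
  moreover have "norm (abs_L2 f) > 0" using nf \<open>u < v\<close> by (cases "abs_L2 f = 0") auto
  ultimately show ?thesis by simp
qed

section \<open>Conjugation of multiplication operators by a weighted shift\<close>

lemma blinfun_compose_id [simp]: "id_blinfun o\<^sub>L T = T" "T o\<^sub>L id_blinfun = T"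
  by (auto intro: blinfun_eqI)

lemma blinfun_compose_assoc: "R o\<^sub>L S o\<^sub>L T = R o\<^sub>L (S o\<^sub>L T)"
  by (auto intro: blinfun_eqI)

lemma op_power_Suc_right: "op_power T n o\<^sub>L T = T o\<^sub>L op_power T n"
  by (induction n) (auto simp: blinfun_compose_assoc)

lemma op_power_commute_assoc:
  "op_power T n o\<^sub>L (T o\<^sub>L R) = T o\<^sub>L (op_power T n o\<^sub>L R)"
  by (simp add: op_power_Suc_right flip: blinfun_compose_assoc)

text \<open>Preservation of the inner product gives an isometry, so the inverse is bounded with
  constant 1; it is at the same time the adjoint.\<close>

lemma unitary_op_inverse:
  assumes "unitary_op T"
  obtains S where "S o\<^sub>L T = id_blinfun" "T o\<^sub>L S = id_blinfun"
    "\<And>f g. cinner (blinfun_apply T f) g = cinner f (blinfun_apply S g)"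
proof -
  have iso: "cinner (T f) (T g) = cinner f g" for f g
    using assms by (auto simp: unitary_op_def)
  have surj: "surj (blinfun_apply T)" using assms by (simp add: unitary_op_def)
  have norm: "norm (T f) = norm f" for f by (simp add: norm_L2_def inner_L2_def iso)
  then have inj: "inj (blinfun_apply T)" 
  proof (intro injI)
    fix x y assume "T x = T y"
    then have "norm (T (x - y)) = 0" by (simp add: blinfun.diff_right)
    then show "x = y" by (simp add: norm)
  qed
  have T1: "T (inv (blinfun_apply T) x) = x" and T2: "inv (blinfun_apply T) (T x) = x" for x
    using surj inj by (auto simp: surj_f_inv_f)
  have "bounded_linear (inv (blinfun_apply T))"
  proof (rule bounded_linear_intro[where K=1])
    fix x y and r :: real
    show "inv (blinfun_apply T) (x + y) = inv (blinfun_apply T) x + inv (blinfun_apply T) y" using T2[of "inv (blinfun_apply T) x + inv (blinfun_apply T) y"] by (simp add: blinfun.add_right T1)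
    show "inv (blinfun_apply T) (r *\<^sub>R x) = r *\<^sub>R inv (blinfun_apply T) x" using T2[of "r *\<^sub>R inv (blinfun_apply T) x"] by (simp add: blinfun.scaleR_right T1)
    show "norm (inv (blinfun_apply T) x) \<le> norm x * 1" using norm[of "inv (blinfun_apply T) x"] by (simp add: T1)
  qed
  note B = bounded_linear_Blinfun_apply[OF this]
  show ?thesis
  proof (rule that[of "Blinfun (inv (blinfun_apply T))"])
    show "Blinfun (inv (blinfun_apply T)) o\<^sub>L T = id_blinfun" "T o\<^sub>L Blinfun (inv (blinfun_apply T)) = id_blinfun"
      by (auto intro!: blinfun_eqI simp: B T1 T2)
    show "cinner (T f) g = cinner f (Blinfun (inv (blinfun_apply T)) g)" for f g
      using iso[of f "inv (blinfun_apply T) g"] by (simp add: B T1)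
  qed
qed

text \<open>The weight is a common factor of both sides, which leaves the pointwise identity
  \<open>(b f) \<circ> \<gamma> = (b \<circ> \<gamma>) (f \<circ> \<gamma>)\<close> for
  representatives.\<close>

lemma shift_mult_op_commute:
  assumes T: "op_given_by (shift_formula \<gamma>) T" and cont: "continuous_on UNIV \<gamma>" and b: "bounded_borel b"
  shows "T o\<^sub>L mult_op b = mult_op (\<lambda>t. b (\<gamma> t)) o\<^sub>L T"
proof (rule blinfun_eqI_abs_L2)
  fix f assume f: "sq_int f"
  have "AE t in lborel. rep_L2 (T (abs_L2 (\<lambda>t. b t * f t))) t = shift_formula \<gamma> (\<lambda>t. b t * f t) t"
    "AE t in lborel. rep_L2 (T (abs_L2 f)) t = shift_formula \<gamma> f t"
    using T sq_int_mult[OF b f] f by (auto simp: op_given_by_def)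
  then have "AE t in lborel. rep_L2 (T (abs_L2 (\<lambda>t. b t * f t))) t = b (\<gamma> t) * rep_L2 (T (abs_L2 f)) t"
    by eventually_elim (simp add: shift_formula_def)
  then have "abs_L2 (rep_L2 (T (abs_L2 (\<lambda>t. b t * f t)))) = abs_L2 (\<lambda>t. b (\<gamma> t) * rep_L2 (T (abs_L2 f)) t)"
    by (simp add: abs_L2_eq_iff sq_int_rep sq_int_mult bounded_borel_comp[OF b cont])
  then show "(T o\<^sub>L mult_op b) (abs_L2 f) = (mult_op (\<lambda>t. b (\<gamma> t)) o\<^sub>L T) (abs_L2 f)"
    using mult_op_apply[OF bounded_borel_comp[OF b cont] sq_int_rep, of "T (abs_L2 f)"]
    by (simp add: mult_op_apply b f abs_rep_L2)
qed

lemma bounded_borel_half_line: "bounded_borel (indicator {0::real..})"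
  by (simp add: bounded_borel_indicator)

lemma compression_mult_op:
  assumes "bounded_borel a"
  shows "compression (mult_op a) = mult_op (\<lambda>t. indicator {0..} t * a t)"
proof -
  have "(\<lambda>t. indicator {0..} t * a t * indicator {0::real..} t) = (\<lambda>t. indicator {0..} t * a t)"
    by (auto simp: indicator_def)
  then show ?thesis unfolding compression_def half_line_proj_def
    by (simp add: mult_op_compose bounded_borel_half_line assms bounded_borel_mult)
qed

lemma adj_compression:
  assumes "\<And>f g. cinner (blinfun_apply T f) g = cinner f (blinfun_apply S g)"
  shows "adj (compression T) = compression S"
proof (rule adj_eqI)
  have P: "cinner (half_line_proj x) y = cinner x (half_line_proj y)" for x y
  proof -
    have "(\<lambda>t::real. cnj (indicator {0..} t)) = indicator {0..}" by (auto simp: indicator_def)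
    then show ?thesis unfolding half_line_proj_def
      using cinner_mult_op[OF bounded_borel_half_line, of x y] by simp
  qed
  show "cinner (compression T f) g = cinner f (compression S g)" for f g
    by (simp add: compression_def P assms)
qed

text \<open>With \<open>S\<close> the inverse of \<open>T\<close>, the commutation relation gives
  \<open>S (b \<circ> \<gamma>) T = S T b = b\<close>. The half-line projections are absorbed by the
  multipliers: the inner ones because \<open>b \<circ> \<gamma>\<close> vanishes on the negative
  axis, the outer ones because \<open>b\<close> does.\<close>

lemma adj_shift_conj:
  assumes T: "op_given_by (shift_formula \<gamma>) T" "unitary_op T"
    and cont: "continuous_on UNIV \<gamma>" and pos: "\<And>t. 0 \<le> t \<Longrightarrow> 0 \<le> \<gamma> t"
    and b: "bounded_borel b" and supp: "\<And>t. t < 0 \<Longrightarrow> b t = 0" "\<And>t. t < 0 \<Longrightarrow> b (\<gamma> t) = 0"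
  shows "adj (compression T) o\<^sub>L mult_op (\<lambda>t. b (\<gamma> t)) o\<^sub>L compression T = mult_op b"
proof -
  obtain S where S: "S o\<^sub>L T = id_blinfun" "T o\<^sub>L S = id_blinfun"
    and adj: "\<And>f g. cinner (blinfun_apply T f) g = cinner f (blinfun_apply S g)"
    by (rule unitary_op_inverse[OF T(2)]) blast
  note b' = bounded_borel_comp[OF b cont]
  let ?P = "half_line_proj"
  have P: "?P o\<^sub>L mult_op c = mult_op c" "mult_op c o\<^sub>L ?P = mult_op c"
    if "bounded_borel c" "\<And>t. t < 0 \<Longrightarrow> c t = 0" for c
  proof -
    have "(\<lambda>t. indicator {0..} t * c t) = c" "(\<lambda>t. c t * indicator {0..} t) = c"
      using that(2) by (auto simp: indicator_def fun_eq_iff not_le)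
    then show "?P o\<^sub>L mult_op c = mult_op c" "mult_op c o\<^sub>L ?P = mult_op c"
      unfolding half_line_proj_def using that(1) by (simp_all add: mult_op_compose bounded_borel_half_line)
  qed
  define M where "M = mult_op b"
  define M' where "M' = mult_op (\<lambda>t. b (\<gamma> t))"
  have comm: "M' o\<^sub>L T = T o\<^sub>L M"
    unfolding M_def M'_def by (rule shift_mult_op_commute[OF T(1) cont b, symmetric])
  have PM: "?P o\<^sub>L M = M" "M o\<^sub>L ?P = M" unfolding M_def by (rule P[OF b supp(1)], assumption)+
  have PM': "?P o\<^sub>L M' = M'" "M' o\<^sub>L ?P = M'" unfolding M'_def by (rule P[OF b' supp(2)], assumption)+
  have "compression S o\<^sub>L M' o\<^sub>L compression T = ?P o\<^sub>L (S o\<^sub>L (((?P o\<^sub>L M') o\<^sub>L ?P) o\<^sub>L T)) o\<^sub>L ?P"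
    by (simp only: compression_def blinfun_compose_assoc)
  also have "\<dots> = ?P o\<^sub>L (S o\<^sub>L (T o\<^sub>L M)) o\<^sub>L ?P" by (simp only: PM' comm)
  also have "\<dots> = M"
    by (simp only: S PM blinfun_compose_id flip: blinfun_compose_assoc)
  finally show ?thesis unfolding M_def M'_def adj_compression[OF adj] .
qed

text \<open>The support condition travels with the induction: if \<open>b\<close> vanishes before
  \<open>(\<gamma> ^^ Suc n) 0\<close>, then \<open>b \<circ> \<gamma>\<close> vanishes before
  \<open>(\<gamma> ^^ n) 0\<close>. Both points are nonnegative, so the single-step identity applies
  at each stage.\<close>

lemma adj_shift_power_conj:
  assumes T: "op_given_by (shift_formula \<gamma>) T" "unitary_op T"
    and cont: "continuous_on UNIV \<gamma>" and mono: "strict_mono \<gamma>" and pos: "0 \<le> \<gamma> 0"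
    and b: "bounded_borel b" and supp: "\<And>t. t < (\<gamma> ^^ n) 0 \<Longrightarrow> b t = 0"
  defines "U \<equiv> compression T"
  shows "op_power (adj U) n o\<^sub>L mult_op (\<lambda>t. b ((\<gamma> ^^ n) t)) o\<^sub>L op_power U n = mult_op b"
  using b supp
proof (induction n arbitrary: b)
  case 0
  then show ?case by simp
next
  case (Suc n)
  have pos': "0 \<le> (\<gamma> ^^ n) 0" for n
  proof (induction n)
    case (Suc n)
    have "\<gamma> 0 \<le> \<gamma> ((\<gamma> ^^ n) 0)" using mono Suc by (simp add: strict_mono_less_eq)
    with pos show ?case by simp
  qed simp
  have b': "bounded_borel (\<lambda>t. b (\<gamma> t))" by (rule bounded_borel_comp[OF Suc.prems(1) cont])
  have supp': "b (\<gamma> t) = 0" if "t < (\<gamma> ^^ n) 0" for t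
    using that mono Suc.prems(2)[of "\<gamma> t"] by (simp add: strict_mono_less)
  have "op_power (adj U) (Suc n) o\<^sub>L mult_op (\<lambda>t. b ((\<gamma> ^^ Suc n) t)) o\<^sub>L op_power U (Suc n)
     = adj U o\<^sub>L (op_power (adj U) n o\<^sub>L mult_op (\<lambda>t. b (\<gamma> ((\<gamma> ^^ n) t))) o\<^sub>L op_power U n) o\<^sub>L U"
    by (simp add: blinfun_compose_assoc op_power_Suc_right op_power_commute_assoc)
  also have "\<dots> = adj U o\<^sub>L mult_op (\<lambda>t. b (\<gamma> t)) o\<^sub>L U"
    by (simp only: Suc.IH[OF b' supp'])
  also have "\<dots> = mult_op b"
    unfolding U_def
  proof (rule adj_shift_conj[OF T cont])
    show "0 \<le> \<gamma> t" if "0 \<le> t" for t using that pos strict_mono_less_eq[OF mono, of 0 t] by linarith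
    show "b t = 0" if "t < 0" for t using Suc.prems(2)[of t] that pos'[of "Suc n"] by linarith
    show "b (\<gamma> t) = 0" if "t < 0" for t using supp'[of t] that pos'[of n] by linarith
  qed (rule Suc.prems)
  finally show ?case .
qed

section \<open>Algebras of continuous functions on a compact space\<close>

text \<open>Relative openness of a preimage, put in terms of an open set of the whole space, so that
  covers and neighbourhoods can be taken there.\<close>

lemma continuous_on_open_trace:
  assumes "continuous_on X f" "open B"
  obtains W where "open W" "\<And>x. x \<in> X \<Longrightarrow> x \<in> W \<longleftrightarrow> f x \<in> B"
proof -
  obtain W where W: "open W" "W \<inter> X = f -` B \<inter> X"
    using assms unfolding continuous_on_open_invariant by meson
  have "x \<in> W \<longleftrightarrow> f x \<in> B" if "x \<in> X" for x
  proof -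
    have "x \<in> W \<longleftrightarrow> x \<in> W \<inter> X" using that by simp
    then show ?thesis unfolding W(2) using that by simp
  qed
  with W(1) show ?thesis by (rule that)
qed

definition half_line_function :: "(real \<Rightarrow> 'x) \<Rightarrow> ('x \<Rightarrow> complex) \<Rightarrow> real \<Rightarrow> complex" where
  "half_line_function q F t = indicator {0..} t * F (q t)"

definition function_algebra :: "(real \<Rightarrow> 'x::topological_space) \<Rightarrow> 'x set \<Rightarrow> (L2 \<Rightarrow>\<^sub>L L2) set" where
  "function_algebra q X = {mult_op (half_line_function q F) |F. continuous_on X F}"

text \<open>A path on the half line that is dense in \<open>X\<close> up to null sets, so that continuous
  functions on \<open>X\<close> embed isometrically into the multiplication operators.\<close>

locale half_line_param =
  fixes q :: "real \<Rightarrow> 'x::t2_space" and X :: "'x set"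
  assumes compact_X: "compact X"
    and q_in: "\<And>t. 0 \<le> t \<Longrightarrow> q t \<in> X"
    and borel: "\<And>F :: 'x \<Rightarrow> complex. continuous_on X F \<Longrightarrow> half_line_function q F \<in> borel_measurable borel"
    and dense: "\<And>V. open V \<Longrightarrow> V \<inter> X \<noteq> {} \<Longrightarrow> \<exists>u v. 0 \<le> u \<and> u < v \<and> (\<forall>t. u < t \<and> t < v \<longrightarrow> q t \<in> V)"
begin

lemma bound_on:
  assumes "continuous_on X (F :: 'x \<Rightarrow> complex)"
  obtains B where "B \<ge> 0" "\<And>x. x \<in> X \<Longrightarrow> cmod (F x) \<le> B"
proof -
  have "bounded (F ` X)" using compact_continuous_image[OF assms compact_X] by (rule compact_imp_bounded)
  then obtain B where B: "\<And>x. x \<in> X \<Longrightarrow> cmod (F x) \<le> B" by (auto simp: bounded_iff)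
  show ?thesis by (rule that[of "max B 0"]) (use B in force)+
qed

lemma cmod_half_line_le:
  assumes "B \<ge> 0" "\<And>x. x \<in> X \<Longrightarrow> cmod (F x) \<le> B"
  shows "cmod (half_line_function q F t) \<le> B"
  using assms q_in[of t] by (auto simp: half_line_function_def indicator_def)

lemma bounded_borel_half [simp]:
  assumes "continuous_on X F"
  shows "bounded_borel (half_line_function q F)"
proof -
  obtain B where "B \<ge> 0" "\<And>x. x \<in> X \<Longrightarrow> cmod (F x) \<le> B" using bound_on[OF assms] by blast
  then have "\<forall>t. cmod (half_line_function q F t) \<le> B" by (intro allI cmod_half_line_le)
  then show ?thesis
    using borel[OF assms] by (auto simp: bounded_borel_def bounded_iff)
qed

abbreviation M :: "('x \<Rightarrow> complex) \<Rightarrow> (L2 \<Rightarrow>\<^sub>L L2)" where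
  "M F \<equiv> mult_op (half_line_function q F)"

lemma M_add: "continuous_on X F \<Longrightarrow> continuous_on X G \<Longrightarrow> M F + M G = M (\<lambda>x. F x + G x)"
  by (simp add: mult_op_add) (simp add: half_line_function_def[abs_def] distrib_left)

lemma M_diff: "continuous_on X F \<Longrightarrow> continuous_on X G \<Longrightarrow> M F - M G = M (\<lambda>x. F x - G x)"
  by (simp add: mult_op_diff) (simp add: half_line_function_def[abs_def] right_diff_distrib)

lemma M_mult:
  assumes "continuous_on X F" "continuous_on X G"
  shows "M F o\<^sub>L M G = M (\<lambda>x. F x * G x)"
proof -
  have "half_line_function q F t * half_line_function q G t = half_line_function q (\<lambda>x. F x * G x) t" for t
    by (simp add: half_line_function_def indicator_def)
  then show ?thesis using assms by (simp add: mult_op_compose)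
qed

lemma M_scalar:
  assumes "continuous_on X F"
  shows "scalar_op c o\<^sub>L M F = M (\<lambda>x. c * F x)"
  using assms by (simp add: scalar_op_mult_op) (simp add: half_line_function_def[abs_def] mult.left_commute)

lemma M_adj:
  assumes "continuous_on X F"
  shows "adj (M F) = M (\<lambda>x. cnj (F x))"
proof -
  have "cnj (half_line_function q F t) = half_line_function q (\<lambda>x. cnj (F x)) t" for t
    by (simp add: half_line_function_def indicator_def)
  then show ?thesis using assms by (simp add: adj_mult_op)
qed

text \<open>For \<open>c\<close> below the value at \<open>x\<close>, the set where the modulus
  exceeds \<open>c\<close> is a relative neighbourhood of \<open>x\<close>, so the path stays in it
  for a whole time interval and the lower bound for multipliers applies.\<close>

lemma cmod_le_norm_M:
  assumes F: "continuous_on X F" and x: "x \<in> X"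
  shows "cmod (F x) \<le> norm (M F)"
proof (rule dense_le)
  fix c assume c: "c < cmod (F x)"
  obtain V where V: "open V" "\<And>x. x \<in> X \<Longrightarrow> x \<in> V \<longleftrightarrow> cmod (F x) \<in> {c<..}"
    by (rule continuous_on_open_trace[OF continuous_on_norm[OF F] open_greaterThan]) blast
  have "x \<in> V \<inter> X" using V(2)[OF x] c x by simp
  then obtain u v where uv: "0 \<le> u" "u < v" "\<And>t. u < t \<Longrightarrow> t < v \<Longrightarrow> q t \<in> V"
    using dense[OF V(1)] by blast
  show "c \<le> norm (M F)"
  proof (rule norm_mult_op_ge[OF bounded_borel_half[OF F] uv(2)])
    fix t assume t: "u < t" "t < v"
    then have "q t \<in> V" "q t \<in> X" using uv q_in[of t] by simp_all
    then have "c < cmod (F (q t))" using V(2) by simp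
    then show "c \<le> cmod (half_line_function q F t)"
      using t uv(1) by (simp add: half_line_function_def)
  qed
qed

lemma norm_M_le:
  assumes "continuous_on X F" "B \<ge> 0" "\<And>x. x \<in> X \<Longrightarrow> cmod (F x) \<le> B"
  shows "norm (M F) \<le> B"
  using assms by (intro norm_mult_op_le cmod_half_line_le) auto

lemma M_eq_iff:
  assumes "continuous_on X F" "continuous_on X G"
  shows "M F = M G \<longleftrightarrow> (\<forall>x\<in>X. F x = G x)"
proof
  assume "M F = M G"
  then have "M (\<lambda>x. F x - G x) = 0" using M_diff[OF assms] by simp
  then show "\<forall>x\<in>X. F x = G x"
    using cmod_le_norm_M[OF continuous_on_diff[OF assms]] by force
next
  assume "\<forall>x\<in>X. F x = G x"
  then have "half_line_function q F = half_line_function q G"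
    using q_in by (auto simp: half_line_function_def fun_eq_iff indicator_def)
  then show "M F = M G" by simp
qed

text \<open>The operator norm dominates the supremum norm of the symbol, so the symbols of a
  convergent sequence are uniformly Cauchy and have a continuous limit.\<close>

lemma closed_function_algebra: "closed (function_algebra q X)"
unfolding closed_sequential_limits
proof (intro allI impI, elim conjE)
  fix T l assume "\<forall>n. T n \<in> function_algebra q X" and lim: "T \<longlonglongrightarrow> l"
  then have "\<forall>n. \<exists>F. continuous_on X F \<and> T n = M F"
    by (auto simp: function_algebra_def)
  from choice[OF this] obtain F where F: "\<And>n. continuous_on X (F n)" and T: "\<And>n. T n = M (F n)"
    by blast
  have "Cauchy T" using lim LIMSEQ_imp_Cauchy by blast
  have "uniformly_Cauchy_on X F"
    unfolding uniformly_Cauchy_on_def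
  proof (intro allI impI)
    fix e :: real assume "e > 0"
    then obtain N where N: "\<And>m n. m \<ge> N \<Longrightarrow> n \<ge> N \<Longrightarrow> norm (T m - T n) < e"
      using \<open>Cauchy T\<close> unfolding Cauchy_iff by blast
    have "dist (F m x) (F n x) < e" if "x \<in> X" "m \<ge> N" "n \<ge> N" for x m n
      using cmod_le_norm_M[OF continuous_on_diff[OF F[of m] F[of n]] that(1)] N[OF that(2,3)]
      by (simp add: T M_diff F dist_norm)
    then show "\<exists>N. \<forall>x\<in>X. \<forall>m\<ge>N. \<forall>n\<ge>N. dist (F m x) (F n x) < e" by blast
  qed
  then obtain G where G: "uniform_limit X F G sequentially"
    using Cauchy_uniformly_convergent uniformly_convergent_on_def by blast
  have contG: "continuous_on X G"
    by (rule uniform_limit_theorem[OF _ G]) (auto simp: F)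
  have "T \<longlonglongrightarrow> M G"
  proof (rule LIMSEQ_I)
    fix e :: real assume "e > 0"
    then obtain N where N: "\<And>n x. n \<ge> N \<Longrightarrow> x \<in> X \<Longrightarrow> dist (F n x) (G x) < e / 2"
      using uniform_limitD[OF G, of "e / 2"] by (auto simp: eventually_sequentially)
    have "norm (T n - M G) \<le> e / 2" if "n \<ge> N" for n
      unfolding T M_diff[OF F contG]
      using \<open>e > 0\<close> N[OF that] by (intro norm_M_le continuous_on_diff F contG) (auto simp: dist_norm less_imp_le)
    moreover have "e / 2 < e" using \<open>e > 0\<close> by simp
    ultimately show "\<exists>N. \<forall>n\<ge>N. norm (T n - M G) < e" using le_less_trans by blast
  qed
  then have "l = M G" using lim LIMSEQ_unique by blast
  then show "l \<in> function_algebra q X" using contG by (auto simp: function_algebra_def)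
qed

lemma function_algebra_cases:
  assumes "T \<in> function_algebra q X" obtains F where "continuous_on X F" "T = M F"
  using assms by (auto simp: function_algebra_def)

lemma function_algebraI: "continuous_on X F \<Longrightarrow> M F \<in> function_algebra q X"
  by (auto simp: function_algebra_def)

lemma cstar_function_algebra: "cstar_subalgebra (function_algebra q X)"
  unfolding cstar_subalgebra_def
proof (intro conjI ballI allI)
  have "M (\<lambda>x. 0) = 0" using M_diff[of "\<lambda>x. 0" "\<lambda>x. 0"] by simp
  then show "0 \<in> function_algebra q X" using function_algebraI[of "\<lambda>x. 0"] by simp
next
  fix S T assume "S \<in> function_algebra q X" "T \<in> function_algebra q X"
  then obtain F G where "continuous_on X F" "S = M F" "continuous_on X G" "T = M G"
    by (auto elim!: function_algebra_cases)
  then show "S + T \<in> function_algebra q X" "S o\<^sub>L T \<in> function_algebra q X"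
    by (auto simp: M_add M_mult intro!: function_algebraI continuous_intros)
next
  fix T c assume "T \<in> function_algebra q X"
  then obtain F where "continuous_on X F" "T = M F"
    by (auto elim!: function_algebra_cases)
  then show "complex_linear T" "adj T \<in> function_algebra q X" "scalar_op c o\<^sub>L T \<in> function_algebra q X"
    by (auto simp: M_adj M_scalar complex_linear_mult_op intro!: function_algebraI continuous_intros)
qed (rule closed_function_algebra)

text \<open>Stone-Weierstrass is applied to the ring of real symbols whose multipliers lie in a
  given algebra containing \<open>G\<close>; hence the separating functions are asked to be real.
  Complex symbols are reassembled from real and imaginary parts.\<close>

lemma function_algebra_eq_generated:
  assumes G: "G \<subseteq> function_algebra q X"
    and const: "\<And>c. M (\<lambda>x. c) \<in> G"
    and sep: "\<And>x y. x \<in> X \<Longrightarrow> y \<in> X \<Longrightarrow> x \<noteq> y \<Longrightarrow>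
      \<exists>F :: 'x \<Rightarrow> real. continuous_on X F \<and> M (\<lambda>x. of_real (F x)) \<in> G \<and> F x \<noteq> F y"
  shows "generated_cstar_algebra G = function_algebra q X"
proof
  show "generated_cstar_algebra G \<subseteq> function_algebra q X"
    using G cstar_function_algebra by (auto simp: generated_cstar_algebra_def)
next
  have "T \<in> C" if T: "T \<in> function_algebra q X" and C: "cstar_subalgebra C" "G \<subseteq> C" for T C
  proof -
    from C(1) have clo: "closed C" and sca: "\<And>c S. S \<in> C \<Longrightarrow> scalar_op c o\<^sub>L S \<in> C"
      and C_add: "\<And>R S. R \<in> C \<Longrightarrow> S \<in> C \<Longrightarrow> R + S \<in> C" and C_mul: "\<And>R S. R \<in> C \<Longrightarrow> S \<in> C \<Longrightarrow> R o\<^sub>L S \<in> C"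
      by (auto simp: cstar_subalgebra_def)
    define R where "R = {F :: 'x \<Rightarrow> real. continuous_on X F \<and> M (\<lambda>x. of_real (F x)) \<in> C}"
    interpret function_ring_on R X
    proof
      fix f g assume "f \<in> R" "g \<in> R"
      then have f: "continuous_on X f" "M (\<lambda>x. of_real (f x)) \<in> C"
        and g: "continuous_on X g" "M (\<lambda>x. of_real (g x)) \<in> C" by (auto simp: R_def)
      show "(\<lambda>x. f x + g x) \<in> R" "(\<lambda>x. f x * g x) \<in> R"
        using f g C_add[OF f(2) g(2)] C_mul[OF f(2) g(2)]
        by (auto simp: R_def M_add M_mult continuous_on_of_real intro!: continuous_intros)
    next
      show "continuous_on X f" if "f \<in> R" for f using that by (simp add: R_def)
    next
      fix x y assume "x \<in> X" "y \<in> X" "x \<noteq> y"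
      from sep[OF this] show "\<exists>f\<in>R. f x \<noteq> f y" using C(2) by (auto simp: R_def)
    next
      show "(\<lambda>_. c) \<in> R" for c using const[of "of_real c"] C(2) by (auto simp: R_def)
    qed (rule compact_X)
    have real: "M (\<lambda>x. of_real (F x)) \<in> C" if F: "continuous_on X F" for F :: "'x \<Rightarrow> real"
    proof (rule closed_approachable[OF clo, THEN iffD1, rule_format])
      fix e :: real assume "e > 0"
      then obtain g where g: "g \<in> R" "\<And>x. x \<in> X \<Longrightarrow> \<bar>F x - g x\<bar> < e / 2"
        using Stone_Weierstrass_basic[OF F, of "e / 2"] by auto
      then have cg: "continuous_on X g" and gC: "M (\<lambda>x. of_real (g x)) \<in> C" by (auto simp: R_def)
      have "norm (M (\<lambda>x. of_real (g x)) - M (\<lambda>x. of_real (F x))) \<le> e / 2"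
        unfolding M_diff[OF continuous_on_of_real[OF cg] continuous_on_of_real[OF F]]
        using \<open>e > 0\<close> g(2)
        by (intro norm_M_le continuous_intros cg F)
           (auto simp: abs_minus_commute less_imp_le simp flip: of_real_diff)
      then show "\<exists>y\<in>C. dist y (M (\<lambda>x. of_real (F x))) < e"
        using gC \<open>e > 0\<close> by (intro bexI[OF _ gC]) (simp add: dist_norm)
    qed
    obtain F where F: "continuous_on X F" "T = M F" using T by (rule function_algebra_cases)
    have c: "continuous_on X (\<lambda>x. Re (F x))" "continuous_on X (\<lambda>x. Im (F x))"
      using F by (auto intro: continuous_intros)
    have "T = M (\<lambda>x. of_real (Re (F x))) + (scalar_op \<i> o\<^sub>L M (\<lambda>x. of_real (Im (F x))))"
    proof -
      have "F = (\<lambda>x. of_real (Re (F x)) + \<i> * of_real (Im (F x)))" by (rule ext) (rule complex_eq)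
      then have "T = M (\<lambda>x. of_real (Re (F x)) + \<i> * of_real (Im (F x)))" using F(2) by simp
      also have "\<dots> = M (\<lambda>x. of_real (Re (F x))) + (scalar_op \<i> o\<^sub>L M (\<lambda>x. of_real (Im (F x))))"
        by (simp only: M_scalar[OF continuous_on_of_real[OF c(2)]]
            M_add[OF continuous_on_of_real[OF c(1)] continuous_on_mult_left[OF continuous_on_of_real[OF c(2)]]])
      finally show ?thesis .
    qed
    then show ?thesis using C_add[OF real[OF c(1)] sca[OF real[OF c(2)]]] by simp
  qed
  then show "function_algebra q X \<subseteq> generated_cstar_algebra G"
    by (auto simp: generated_cstar_algebra_def)
qed

end

section \<open>Isomorphic function algebras have homeomorphic spaces\<close>

text \<open>The finite subcover argument behind two later steps: separating a point from a compact
  set, and producing an invertible element in the kernel of a character that is no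
  evaluation.\<close>

lemma compact_positive_sum:
  fixes R :: "('x::topological_space \<Rightarrow> real) set"
  assumes "compact K" "K \<subseteq> X"
    and R: "\<And>f. f \<in> R \<Longrightarrow> continuous_on X f" "\<And>f x. f \<in> R \<Longrightarrow> x \<in> X \<Longrightarrow> 0 \<le> f x"
    and zero: "(\<lambda>x. 0) \<in> R" and add: "\<And>f g. f \<in> R \<Longrightarrow> g \<in> R \<Longrightarrow> (\<lambda>x. f x + g x) \<in> R"
    and pos: "\<And>x. x \<in> K \<Longrightarrow> \<exists>f\<in>R. 0 < f x"
  shows "\<exists>f\<in>R. \<forall>x\<in>K. 0 < f x"
proof -
  have "\<exists>W. open W \<and> (\<forall>x\<in>X. x \<in> W \<longleftrightarrow> f x \<in> {0<..})" if "f \<in> R" for f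
    by (rule continuous_on_open_trace[OF R(1)[OF that] open_greaterThan]) blast
  then have "\<forall>f\<in>R. \<exists>W. open W \<and> (\<forall>x\<in>X. x \<in> W \<longleftrightarrow> f x \<in> {0<..})" by blast
  from bchoice[OF this] obtain W where W: "\<And>f. f \<in> R \<Longrightarrow> open (W f)"
    "\<And>f x. f \<in> R \<Longrightarrow> x \<in> X \<Longrightarrow> x \<in> W f \<longleftrightarrow> 0 < f x" by auto
  have "K \<subseteq> (\<Union>f\<in>R. W f)"
  proof
    fix x assume x: "x \<in> K"
    then obtain f where f: "f \<in> R" "0 < f x" using pos by blast
    then have "x \<in> W f" using x assms(2) W(2) by blast
    then show "x \<in> (\<Union>f\<in>R. W f)" using f(1) by blast
  qed
  then obtain R' where R': "R' \<subseteq> R" "finite R'" "K \<subseteq> (\<Union>f\<in>R'. W f)"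
    using compactE_image[OF assms(1), of R W] W(1) by blast
  have sum: "(\<lambda>x. \<Sum>f\<in>S. f x) \<in> R" if "finite S" "S \<subseteq> R" for S
    using that by (induction S rule: finite_induct) (auto intro: zero add)
  have "0 < (\<Sum>f\<in>R'. f x)" if x: "x \<in> K" for x
  proof -
    obtain f where f: "f \<in> R'" "x \<in> W f" using R'(3) x by blast
    then have fR: "f \<in> R" using R'(1) by blast
    have "0 < f x" using W(2)[OF fR] f(2) x assms(2) by blast
    then show ?thesis
      using R' R(2) f x assms(2) by (intro sum_pos2[of R' f]) (auto simp: subset_iff)
  qed
  then show ?thesis using sum[OF R'(2,1)] by (intro bexI[where x="\<lambda>x. \<Sum>f\<in>R'. f x"]) auto
qed

text \<open>On a compact set this condition is strong enough to give Urysohn-type functions, and it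
  can be checked directly on the space of arcs.\<close>

definition separates_points :: "'x::topological_space set \<Rightarrow> bool" where
  "separates_points X \<longleftrightarrow> (\<forall>x\<in>X. \<forall>y\<in>X. x \<noteq> y \<longrightarrow> (\<exists>F :: 'x \<Rightarrow> complex. continuous_on X F \<and> F x \<noteq> F y))"

lemma separates_pointsE:
  assumes "separates_points X" "x \<in> X" "y \<in> X" "x \<noteq> y"
  obtains F :: "'x::topological_space \<Rightarrow> complex" where "continuous_on X F" "F x \<noteq> F y"
  using assms unfolding separates_points_def by meson

text \<open>The functions \<open>cmod (F y - F x)\<close> vanish at \<open>x\<close> and are
  positive at a chosen point of \<open>K\<close>. A finite sum of them is positive on all of
  \<open>K\<close>; division by its minimum there gives the bound 1.\<close>

lemma compact_separating_function:
  fixes X :: "'x::t2_space set"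
  assumes X: "separates_points X" and K: "compact K" "K \<subseteq> X" and x: "x \<in> X" "x \<notin> K"
  obtains f :: "'x \<Rightarrow> real" where "continuous_on X f" "f x = 0" "\<And>y. y \<in> K \<Longrightarrow> 1 \<le> f y"
proof -
  let ?R = "{f :: 'x \<Rightarrow> real. continuous_on X f \<and> f x = 0 \<and> (\<forall>y\<in>X. 0 \<le> f y)}"
  have "\<exists>f\<in>?R. \<forall>y\<in>K. 0 < f y"
  proof (rule compact_positive_sum[OF K])
    fix y assume y: "y \<in> K"
    have "y \<in> X" "x \<noteq> y" using y K x by auto
    then obtain F :: "'x \<Rightarrow> complex" where F: "continuous_on X F" "F x \<noteq> F y"
      using separates_pointsE[OF X x(1)] by blast
    show "\<exists>f\<in>?R. 0 < f y"
    proof (rule bexI)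
      show "0 < cmod (F y - F x)" using F(2) by simp
      show "(\<lambda>y. cmod (F y - F x)) \<in> ?R" using F(1) by (auto intro!: continuous_intros)
    qed
  qed (auto intro: continuous_on_add)
  then obtain f where "f \<in> ?R" "\<forall>y\<in>K. 0 < f y" by (elim bexE)
  then have f: "continuous_on X f" "f x = 0" "\<And>y. y \<in> X \<Longrightarrow> 0 \<le> f y" "\<And>y. y \<in> K \<Longrightarrow> 0 < f y"
    by auto
  show ?thesis
  proof (cases "K = {}")
    case True then show ?thesis using f that by blast
  next
    case False
    obtain z where z: "z \<in> K" "\<And>y. y \<in> K \<Longrightarrow> f z \<le> f y"
      using continuous_attains_inf[OF K(1) False] continuous_on_subset[OF f(1) K(2)] by blast
    show ?thesis
      by (rule that[of "\<lambda>y. f y / f z"]) (use f(1,2) f(4)[OF z(1)] z in \<open>auto intro!: continuous_intros\<close>)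
  qed
qed

text \<open>The squared modulus factors as \<open>F - \<omega> F\<close> times its conjugate, and
  one factor in the kernel suffices.\<close>

lemma kernel_nonneg_function:
  fixes \<omega> :: "('x::topological_space \<Rightarrow> complex) \<Rightarrow> complex"
  assumes add: "\<And>F G. continuous_on X F \<Longrightarrow> continuous_on X G \<Longrightarrow> \<omega> (\<lambda>x. F x + G x) = \<omega> F + \<omega> G"
    and mult: "\<And>F G. continuous_on X F \<Longrightarrow> continuous_on X G \<Longrightarrow> \<omega> (\<lambda>x. F x * G x) = \<omega> F * \<omega> G"
    and const: "\<And>c. \<omega> (\<lambda>x. c) = c"
    and F: "continuous_on X F"
  shows "\<omega> (\<lambda>y. of_real ((cmod (F y - \<omega> F))\<^sup>2)) = 0"
proof -
  let ?G = "\<lambda>y. F y - \<omega> F"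
  have G: "continuous_on X ?G" "continuous_on X (\<lambda>y. cnj (?G y))" by (intro continuous_intros F)+
  have "\<omega> ?G = \<omega> (\<lambda>y. F y + (- \<omega> F))" by simp
  also have "\<dots> = \<omega> F + \<omega> (\<lambda>y. - \<omega> F)" by (rule add[OF F continuous_on_const])
  also have "\<dots> = 0" by (simp only: const right_minus)
  finally have "\<omega> (\<lambda>y. ?G y * cnj (?G y)) = 0" by (simp only: mult[OF G] mult_zero_left)
  then show ?thesis by (simp only: complex_norm_square)
qed

text \<open>If \<open>\<omega>\<close> were not the evaluation at any point, finitely many elements \<open>|F|\<^sup>2\<close> of its
  kernel would add up to a positive, hence invertible function.\<close>

lemma character_is_evaluation:
  fixes X :: "'x::topological_space set" and \<omega> :: "('x \<Rightarrow> complex) \<Rightarrow> complex"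
  assumes X: "compact X"
    and cong: "\<And>F G. continuous_on X F \<Longrightarrow> continuous_on X G \<Longrightarrow> (\<And>x. x \<in> X \<Longrightarrow> F x = G x) \<Longrightarrow> \<omega> F = \<omega> G"
    and add: "\<And>F G. continuous_on X F \<Longrightarrow> continuous_on X G \<Longrightarrow> \<omega> (\<lambda>x. F x + G x) = \<omega> F + \<omega> G"
    and mult: "\<And>F G. continuous_on X F \<Longrightarrow> continuous_on X G \<Longrightarrow> \<omega> (\<lambda>x. F x * G x) = \<omega> F * \<omega> G"
    and const: "\<And>c. \<omega> (\<lambda>x. c) = c"
  shows "\<exists>x\<in>X. \<forall>F. continuous_on X F \<longrightarrow> \<omega> F = F x"
proof (rule ccontr)
  assume "\<not> ?thesis"
  then have no: "\<exists>F. continuous_on X F \<and> \<omega> F \<noteq> F x" if "x \<in> X" for x using that by blast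
  define R where
    "R = {f :: 'x \<Rightarrow> real. continuous_on X f \<and> (\<forall>x\<in>X. 0 \<le> f x) \<and> \<omega> (\<lambda>x. of_real (f x)) = 0}"
  have add_R: "(\<lambda>x. f x + g x) \<in> R" if "f \<in> R" "g \<in> R" for f g
  proof -
    have f: "continuous_on X f" "\<And>x. x \<in> X \<Longrightarrow> 0 \<le> f x" "\<omega> (\<lambda>x. of_real (f x)) = 0"
      and g: "continuous_on X g" "\<And>x. x \<in> X \<Longrightarrow> 0 \<le> g x" "\<omega> (\<lambda>x. of_real (g x)) = 0"
      using that by (simp_all add: R_def)
    have "\<omega> (\<lambda>x. of_real (f x) + of_real (g x)) = 0"
      by (simp only: add[OF continuous_on_of_real[OF f(1)] continuous_on_of_real[OF g(1)]] f(3) g(3) add_0_left)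
    then show ?thesis using f(1,2) g(1,2) by (simp add: R_def continuous_on_add)
  qed
  have pos_R: "\<exists>f\<in>R. 0 < f x" if x: "x \<in> X" for x
  proof -
    obtain F where F: "continuous_on X F" "\<omega> F \<noteq> F x" using no[OF x] by blast
    let ?f = "\<lambda>y. (cmod (F y - \<omega> F))\<^sup>2"
    have "continuous_on X ?f" by (intro continuous_intros F(1))
    moreover have "\<omega> (\<lambda>y. of_real (?f y)) = 0" by (rule kernel_nonneg_function[OF add mult const F(1)])
    ultimately have "?f \<in> R" unfolding R_def by simp
    moreover have "0 < ?f x" using F(2) by simp
    ultimately show ?thesis by (intro bexI[of _ ?f])
  qed
  have zero_R: "(\<lambda>x. 0) \<in> R" using const[of 0] by (simp add: R_def)
  have "\<exists>f\<in>R. \<forall>x\<in>X. 0 < f x"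
    by (rule compact_positive_sum[OF X subset_refl _ _ zero_R add_R pos_R]) (simp_all add: R_def)
  then obtain f where "f \<in> R" "\<forall>x\<in>X. 0 < f x" by (elim bexE)
  then have f: "continuous_on X f" "\<omega> (\<lambda>x. of_real (f x)) = 0" "\<And>x. x \<in> X \<Longrightarrow> f x \<noteq> 0"
    by (auto simp: R_def)
  have c: "continuous_on X (\<lambda>x. complex_of_real (f x))" "continuous_on X (\<lambda>x. complex_of_real (1 / f x))"
    by (intro continuous_intros f(1), intro continuous_intros f(1) ballI f(3))
  have "1 = \<omega> (\<lambda>x. 1)" by (rule const[symmetric])
  also have "\<dots> = \<omega> (\<lambda>x. of_real (f x) * of_real (1 / f x))"
    by (rule cong[OF continuous_on_const continuous_on_mult[OF c]]) (simp add: f(3))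
  also have "\<dots> = 0" by (simp only: mult[OF c] f(2) mult_zero_left)
  finally show False by simp
qed

text \<open>The isomorphism induces a map \<open>h\<close> of symbols, determined up to their values
  on \<open>X\<close> and \<open>Y\<close>. For each \<open>y\<close>, the functional
  \<open>F \<mapsto> h F y\<close> is a character and hence the evaluation at a point
  \<open>\<psi> y\<close>. Surjectivity of \<open>h\<close> makes \<open>\<psi>\<close> injective,
  injectivity of \<open>h\<close> makes it surjective.\<close>

lemma function_algebra_isomorphic_imp_homeomorphic:
  fixes X :: "'x::t2_space set" and Y :: "'y::t2_space set"
  assumes "half_line_param q X" "half_line_param r Y" "separates_points X" "separates_points Y"
    and iso: "function_algebra q X \<cong>\<^sub>* function_algebra r Y"
  shows "X homeomorphic Y"
proof -
  interpret A: half_line_param q X by fact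
  interpret B: half_line_param r Y by fact
  obtain \<phi> where bij: "bij_betw \<phi> (function_algebra q X) (function_algebra r Y)"
    and hom: "\<And>S T. S \<in> function_algebra q X \<Longrightarrow> T \<in> function_algebra q X \<Longrightarrow>
      \<phi> (S + T) = \<phi> S + \<phi> T \<and> \<phi> (S o\<^sub>L T) = \<phi> S o\<^sub>L \<phi> T"
    and hom': "\<And>T c. T \<in> function_algebra q X \<Longrightarrow> \<phi> (scalar_op c o\<^sub>L T) = scalar_op c o\<^sub>L \<phi> T"
    using iso unfolding cstar_isomorphic_def by blast
  have "\<exists>G. continuous_on X F \<longrightarrow> continuous_on Y G \<and> \<phi> (A.M F) = B.M G" for F
    using bij_betw_apply[OF bij A.function_algebraI[of F]] by (blast elim: B.function_algebra_cases)
  then obtain h where hc: "\<And>F. continuous_on X F \<Longrightarrow> continuous_on Y (h F)"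
    and h: "\<And>F. continuous_on X F \<Longrightarrow> \<phi> (A.M F) = B.M (h F)" by metis
  note mem = A.function_algebraI
  have h_onto: "\<exists>F. continuous_on X F \<and> (\<forall>y\<in>Y. h F y = G y)" if G: "continuous_on Y G" for G
  proof -
    obtain T where T: "T \<in> function_algebra q X" "\<phi> T = B.M G"
      using bij_betw_imp_surj_on[OF bij] B.function_algebraI[OF G] by (metis imageE)
    then show ?thesis by (metis A.function_algebra_cases B.M_eq_iff G h hc)
  qed
  have h_inj: "F x = G x" if F: "continuous_on X F" and G: "continuous_on X G"
    and eq: "\<And>y. y \<in> Y \<Longrightarrow> h F y = h G y" and x: "x \<in> X" for F G x
  proof -
    have "B.M (h F) = B.M (h G)" using eq by (subst B.M_eq_iff) (auto intro: hc F G)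
    then have "A.M F = A.M G"
      using bij_betw_imp_inj_on[OF bij] mem[OF F] mem[OF G] h F G by (metis inj_onD)
    then show ?thesis using F G x by (simp add: A.M_eq_iff)
  qed
  have h_add: "h (\<lambda>x. F x + G x) y = h F y + h G y"
    if F: "continuous_on X F" and G: "continuous_on X G" and y: "y \<in> Y" for F G y
  proof -
    have "B.M (h (\<lambda>x. F x + G x)) = \<phi> (A.M F + A.M G)"
      by (simp add: A.M_add F G h continuous_on_add)
    also have "\<dots> = B.M (h F) + B.M (h G)"
      using hom[OF mem[OF F] mem[OF G]] h[OF F] h[OF G] by simp
    also have "\<dots> = B.M (\<lambda>y. h F y + h G y)" by (simp add: B.M_add hc F G)
    finally show ?thesis using y B.M_eq_iff hc F G by (simp add: continuous_on_add)
  qed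
  have h_mult: "h (\<lambda>x. F x * G x) y = h F y * h G y"
    if F: "continuous_on X F" and G: "continuous_on X G" and y: "y \<in> Y" for F G y
  proof -
    have "B.M (h (\<lambda>x. F x * G x)) = \<phi> (A.M F o\<^sub>L A.M G)"
      by (simp add: A.M_mult F G h continuous_on_mult)
    also have "\<dots> = B.M (h F) o\<^sub>L B.M (h G)"
      using hom[OF mem[OF F] mem[OF G]] h[OF F] h[OF G] by simp
    also have "\<dots> = B.M (\<lambda>y. h F y * h G y)" by (simp add: B.M_mult hc F G)
    finally show ?thesis using y B.M_eq_iff hc F G by (simp add: continuous_on_mult)
  qed
  have h_scale: "h (\<lambda>x. c * F x) y = c * h F y"
    if F: "continuous_on X F" and y: "y \<in> Y" for F c y
  proof -
    have "B.M (h (\<lambda>x. c * F x)) = \<phi> (scalar_op c o\<^sub>L A.M F)"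
      by (simp add: A.M_scalar F h continuous_on_mult_left)
    also have "\<dots> = scalar_op c o\<^sub>L B.M (h F)"
      using hom'[OF mem[OF F]] h[OF F] by simp
    also have "\<dots> = B.M (\<lambda>y. c * h F y)" by (simp add: B.M_scalar hc F)
    finally show ?thesis using y B.M_eq_iff hc F by (simp add: continuous_on_mult_left)
  qed
  \<comment> \<open>Preservation of the unit comes from surjectivity: some \<open>h F\<close> is 1
    on \<open>Y\<close>, and \<open>h F = h F * h 1\<close> there.\<close>
  have h_one: "h (\<lambda>x. 1) y = 1" if y: "y \<in> Y" for y
  proof -
    obtain F where F: "continuous_on X F" "\<And>y. y \<in> Y \<Longrightarrow> h F y = 1" using h_onto[of "\<lambda>y. 1"] by auto
    show ?thesis using h_mult[OF F(1), of "\<lambda>x. 1" y] F(2)[OF y] y by simp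
  qed
  have "\<exists>x\<in>X. \<forall>F. continuous_on X F \<longrightarrow> h F y = F x" if y: "y \<in> Y" for y
  proof (rule character_is_evaluation[OF A.compact_X])
    show "h F y = h G y" if "continuous_on X F" "continuous_on X G" "\<And>x. x \<in> X \<Longrightarrow> F x = G x" for F G
    proof -
      have "A.M F = A.M G" using that by (simp add: A.M_eq_iff)
      then have "B.M (h F) = B.M (h G)" using h[OF that(1)] h[OF that(2)] by simp
      then show ?thesis using y hc that B.M_eq_iff by blast
    qed
    show "h (\<lambda>x. c) y = c" for c using h_scale[of "\<lambda>x. 1" y c] h_one y by simp
  qed (use y h_add h_mult in auto)
  then obtain \<psi> where \<psi>: "\<And>y. y \<in> Y \<Longrightarrow> \<psi> y \<in> X"
    "\<And>y F. y \<in> Y \<Longrightarrow> continuous_on X F \<Longrightarrow> h F y = F (\<psi> y)" by metis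
  have cont: "continuous_on Y \<psi>"
    unfolding continuous_on_topological
  proof (intro ballI allI impI)
    fix y V assume y: "y \<in> Y" and V: "open V" "\<psi> y \<in> V"
    \<comment> \<open>A function that is 0 at \<open>\<psi> y\<close> and at least 1 off
      \<open>V\<close> turns continuity of \<open>\<psi>\<close> into that of the symbol
      \<open>h f\<close>, which is \<open>f \<circ> \<psi>\<close> on \<open>Y\<close>.\<close>
    have "compact (X - V)" using A.compact_X V(1) by (rule compact_diff)
    then obtain f :: "'x \<Rightarrow> real" where f: "continuous_on X f" "f (\<psi> y) = 0" "\<And>x. x \<in> X - V \<Longrightarrow> 1 \<le> f x"
      using compact_separating_function[OF assms(3), of "X - V" "\<psi> y"] \<psi>(1)[OF y] V(2) by blast
    have cf: "continuous_on X (\<lambda>x. complex_of_real (f x))" using f(1) by (rule continuous_on_of_real)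
    obtain A where A: "open A" "\<And>z. z \<in> Y \<Longrightarrow> z \<in> A \<longleftrightarrow> Re (h (\<lambda>x. of_real (f x)) z) \<in> {..<1}"
      using continuous_on_open_trace[OF continuous_on_Re[OF hc[OF cf]] open_lessThan] by blast
    have AY: "z \<in> A \<longleftrightarrow> f (\<psi> z) < 1" if "z \<in> Y" for z
      using A(2)[OF that] \<psi>(2)[OF that cf] by simp
    show "\<exists>A. open A \<and> y \<in> A \<and> (\<forall>z\<in>Y. z \<in> A \<longrightarrow> \<psi> z \<in> V)"
      using A(1) AY f(2,3) y \<psi>(1) by (intro exI[of _ A]) force
  qed
  have "inj_on \<psi> Y"
  proof (rule inj_onI, rule ccontr)
    fix y z assume yz: "y \<in> Y" "z \<in> Y" "\<psi> y = \<psi> z" "y \<noteq> z"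
    obtain G :: "'y \<Rightarrow> complex" where G: "continuous_on Y G" "G y \<noteq> G z"
      by (rule separates_pointsE[OF assms(4) yz(1,2,4)])
    obtain F where "continuous_on X F" "\<forall>y\<in>Y. h F y = G y" using h_onto[OF G(1)] by blast
    then show False using G(2) yz \<psi>(2)[of y F] \<psi>(2)[of z F] by simp
  qed
  moreover have "\<psi> ` Y = X"
  proof (rule ccontr)
    assume "\<psi> ` Y \<noteq> X"
    then obtain x where x: "x \<in> X" "x \<notin> \<psi> ` Y" using \<psi>(1) by blast
    have "compact (\<psi> ` Y)" using cont B.compact_X by (rule compact_continuous_image)
    then obtain f :: "'x \<Rightarrow> real" where f: "continuous_on X f" "f x = 0" "\<And>x. x \<in> \<psi> ` Y \<Longrightarrow> 1 \<le> f x"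
      using compact_separating_function[OF assms(3), of "\<psi> ` Y" x] x \<psi>(1) by blast
    \<comment> \<open>This symbol is 1 at the missed point and 0 on the image of
      \<open>\<psi>\<close>, so \<open>h\<close> would send it to zero.\<close>
    let ?F = "\<lambda>x. complex_of_real (max (1 - f x) 0)"
    have cF: "continuous_on X ?F" using f(1) by (intro continuous_intros)
    have "h ?F y = h (\<lambda>x. 0) y" if "y \<in> Y" for y
      using \<psi>(2)[OF that cF] \<psi>(2)[OF that, of "\<lambda>x. 0"] f(3)[of "\<psi> y"] that by simp
    from h_inj[OF cF _ this x(1)] show False using f(2) by simp
  qed
  ultimately obtain g where "homeomorphism Y X \<psi> g"
    using homeomorphism_compact[OF B.compact_X cont] by blast
  then show ?thesis using homeomorphic_def homeomorphic_sym by blast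
qed

lemma homeomorphic_imp_function_algebra_isomorphic:
  assumes "half_line_param q X" "half_line_param r Y" "X homeomorphic Y"
  shows "function_algebra q X \<cong>\<^sub>* function_algebra r Y"
proof -
  interpret A: half_line_param q X by fact
  interpret B: half_line_param r Y by fact
  obtain k l where kl: "homeomorphism X Y k l" using assms(3) by (auto simp: homeomorphic_def)
  then have k: "continuous_on X k" "k ` X = Y" "\<And>x. x \<in> X \<Longrightarrow> l (k x) = x"
    and l: "continuous_on Y l" "l ` Y = X" "\<And>y. y \<in> Y \<Longrightarrow> k (l y) = y"
    by (auto simp: homeomorphism_def)
  have cl: "continuous_on Y (\<lambda>y. F (l y))" if "continuous_on X F" for F :: "_ \<Rightarrow> complex"
    using continuous_on_compose2[OF that l(1)] l(2) by blast
  have ck: "continuous_on X (\<lambda>x. F (k x))" if "continuous_on Y F" for F :: "_ \<Rightarrow> complex"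
    using continuous_on_compose2[OF that k(1)] k(2) by blast
  \<comment> \<open>An operator determines its symbol on \<open>X\<close> only. Since
    \<open>l\<close> maps \<open>Y\<close> into \<open>X\<close>, the choice of the symbol does not
    affect the result.\<close>
  define \<phi> where "\<phi> T = B.M (\<lambda>y. (SOME F. continuous_on X F \<and> T = A.M F) (l y))" for T
  have \<phi>: "\<phi> (A.M F) = B.M (\<lambda>y. F (l y))" if F: "continuous_on X F" for F
  proof -
    define G where "G = (SOME G. continuous_on X G \<and> A.M F = A.M G)"
    have "continuous_on X G \<and> A.M F = A.M G" unfolding G_def by (rule someI[of _ F]) (use F in simp)
    then have G: "continuous_on X G" "\<forall>x\<in>X. F x = G x" using A.M_eq_iff[OF F] by auto
    have "\<phi> (A.M F) = B.M (\<lambda>y. G (l y))" by (simp add: \<phi>_def G_def)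
    also have "\<dots> = B.M (\<lambda>y. F (l y))"
      using G(2) l(2) by (subst B.M_eq_iff[OF cl[OF G(1)] cl[OF F]]) auto
    finally show ?thesis .
  qed
  show ?thesis
    unfolding cstar_isomorphic_def
  proof (intro exI[of _ \<phi>] conjI ballI allI)
    show "bij_betw \<phi> (function_algebra q X) (function_algebra r Y)"
      unfolding bij_betw_def
    proof (intro conjI inj_onI)
      fix S T assume "S \<in> function_algebra q X" "T \<in> function_algebra q X" and eq: "\<phi> S = \<phi> T"
      then obtain F G where FG: "continuous_on X F" "S = A.M F" "continuous_on X G" "T = A.M G"
        by (auto elim!: A.function_algebra_cases)
      then have "\<forall>y\<in>Y. F (l y) = G (l y)" using eq by (simp add: \<phi> cl B.M_eq_iff)
      then have "\<forall>x\<in>X. F x = G x" using k(2,3) by force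
      then show "S = T" using FG by (simp add: A.M_eq_iff)
    next
      show "\<phi> ` function_algebra q X = function_algebra r Y"
      proof safe
        fix T assume "T \<in> function_algebra q X"
        then obtain F where "continuous_on X F" "T = A.M F" by (rule A.function_algebra_cases)
        then show "\<phi> T \<in> function_algebra r Y" by (simp add: \<phi> cl B.function_algebraI)
      next
        fix T assume "T \<in> function_algebra r Y"
        then obtain G where G: "continuous_on Y G" "T = B.M G" by (rule B.function_algebra_cases)
        have "T = \<phi> (A.M (\<lambda>x. G (k x)))"
          unfolding G(2) \<phi>[OF ck[OF G(1)]]
          using l(3) by (subst B.M_eq_iff[OF G(1) cl[OF ck[OF G(1)]]]) simp
        then show "T \<in> \<phi> ` function_algebra q X" using A.function_algebraI[OF ck[OF G(1)]] by blast
      qed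
    qed
  next
    fix S T assume "S \<in> function_algebra q X" "T \<in> function_algebra q X"
    then obtain F G where FG: "continuous_on X F" "S = A.M F" "continuous_on X G" "T = A.M G"
      by (auto elim!: A.function_algebra_cases)
    then show "\<phi> (S + T) = \<phi> S + \<phi> T" "\<phi> (S o\<^sub>L T) = \<phi> S o\<^sub>L \<phi> T"
      by (simp_all add: A.M_add A.M_mult B.M_add B.M_mult \<phi> cl continuous_on_add continuous_on_mult)
  next
    fix T c assume "T \<in> function_algebra q X"
    then obtain F where F: "continuous_on X F" "T = A.M F" by (rule A.function_algebra_cases)
    then show "\<phi> (adj T) = adj (\<phi> T)" "\<phi> (scalar_op c o\<^sub>L T) = scalar_op c o\<^sub>L \<phi> T"
      by (simp_all add: A.M_adj B.M_adj A.M_scalar B.M_scalar \<phi> cl continuous_on_cnj continuous_on_mult_left)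
  qed
qed

section \<open>Lifts of circle homeomorphisms and translation numbers\<close>

abbreviation ei :: "real \<Rightarrow> complex" where "ei t \<equiv> cis (2 * pi * t)"

lemma ei_eq_iff: "ei s = ei t \<longleftrightarrow> s - t \<in> \<int>"
proof
  assume "ei s = ei t"
  then have "sin (2 * pi * s) = sin (2 * pi * t) \<and> cos (2 * pi * s) = cos (2 * pi * t)"
    by (metis cis.sel)
  then obtain n :: int where "2 * pi * s = 2 * pi * t + 2 * pi * n"
    using sin_cos_eq_iff by blast
  then have "2 * pi * (s - t) = 2 * pi * n" by (simp add: algebra_simps)
  then have "s - t = n" by simp
  then show "s - t \<in> \<int>" by simp
next
  assume "s - t \<in> \<int>"
  then have "ei t * ei (s - t) = ei t" by simp
  moreover have "ei t * ei (s - t) = ei s" by (simp add: cis_mult algebra_simps)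
  ultimately show "ei s = ei t" by simp
qed

lemma ei_add_int [simp]: "ei (t + of_int j) = ei t" by (subst ei_eq_iff) simp

lemma ei_surj: assumes "z \<in> circle" obtains t where "z = ei t"
proof -
  have "z = cis (Arg z)" using assms cis_Arg[of z] by (cases "z = 0") (auto simp: sgn_div_norm)
  then show ?thesis using that[of "Arg z / (2 * pi)"] by simp
qed

lemma ei_in_circle [simp]: "ei t \<in> circle" by simp

lemma continuous_on_ei [continuous_intros]:
  "continuous_on S f \<Longrightarrow> continuous_on S (\<lambda>x. ei (f x))"
  by (intro continuous_intros)

lemma dist_ei_le: "dist (ei s) (ei t) \<le> 2 * pi * \<bar>s - t\<bar>"
proof -
  have "dist (ei s) (ei t) = cmod (ei t * (ei (s - t) - 1))"
    by (simp add: dist_norm right_diff_distrib cis_mult algebra_simps)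
  also have "\<dots> = cmod (ei (s - t) - 1)" by (simp add: norm_mult)
  also have "\<dots> = 2 * \<bar>sin (2 * pi * (s - t) / 2)\<bar>"
    using dist_exp_i_1[of "2 * pi * (s - t)"] by (simp add: cis_conv_exp)
  also have "\<dots> \<le> 2 * \<bar>2 * pi * (s - t) / 2\<bar>" by (intro mult_left_mono abs_sin_x_le_abs_x) auto
  also have "\<dots> = 2 * pi * \<bar>s - t\<bar>" by (simp add: abs_mult)
  finally show ?thesis .
qed

text \<open>A uniform converse to the Lipschitz bound. On
  \<open>{\<epsilon>..1 - \<epsilon>}\<close> the distance of \<open>ei u\<close> from 1 has a
  positive minimum by compactness, so smaller chords force the fractional part of
  \<open>s - t\<close> near 0 or near 1.\<close>

lemma ei_close:
  assumes "\<epsilon> > 0"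
  obtains \<delta> where "\<delta> > 0" "\<And>s t. dist (ei s) (ei t) < \<delta> \<Longrightarrow> \<exists>j::int. \<bar>s + of_int j - t\<bar> < \<epsilon>"
proof -
  let ?K = "{\<epsilon>..1 - \<epsilon>}"
  have "\<exists>\<delta>>0. \<forall>u\<in>?K. \<delta> \<le> dist (ei u) 1"
  proof (cases "?K = {}")
    case True then show ?thesis by (intro exI[of _ 1]) auto
  next
    case False
    have "continuous_on ?K (\<lambda>u. dist (ei u) 1)" by (intro continuous_intros)
    then obtain v where v: "v \<in> ?K" "\<And>u. u \<in> ?K \<Longrightarrow> dist (ei v) 1 \<le> dist (ei u) 1"
      using continuous_attains_inf[OF compact_Icc False] by blast
    have "ei v \<noteq> ei 0"
    proof
      assume "ei v = ei 0"
      then have "v \<in> \<int>" by (subst (asm) ei_eq_iff) simp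
      then obtain k :: int where "v = of_int k" by (auto elim: Ints_cases)
      then have "0 < k" "k < 1" using v(1) assms by auto
      then show False by simp
    qed
    then have "0 < dist (ei v) 1" by simp
    then show ?thesis using v(2) by blast
  qed
  then obtain \<delta> where \<delta>: "\<delta> > 0" "\<And>u. u \<in> ?K \<Longrightarrow> \<delta> \<le> dist (ei u) 1" by blast
  show ?thesis
  proof (rule that[OF \<delta>(1)])
    fix s t assume less: "dist (ei s) (ei t) < \<delta>"
    define u where "u = frac (s - t)"
    have "ei u = ei (s - t)" by (subst ei_eq_iff) (simp add: u_def frac_def)
    then have "dist (ei u) 1 = cmod (ei t * (ei (s - t) - 1))" by (simp add: norm_mult dist_norm)
    also have "\<dots> = dist (ei s) (ei t)"
      by (simp add: dist_norm right_diff_distrib cis_mult algebra_simps)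
    finally have "u \<notin> ?K" using less \<delta>(2)[of u] by auto
    \<comment> \<open>A fractional part near 0 is corrected by the floor of \<open>s - t\<close>,
      one near 1 by the next integer.\<close>
    then consider "u < \<epsilon>" | "u > 1 - \<epsilon>" by fastforce
    then show "\<exists>j::int. \<bar>s + of_int j - t\<bar> < \<epsilon>"
    proof cases
      case 1 then show ?thesis
        by (intro exI[of _ "- \<lfloor>s - t\<rfloor>"]) (auto simp: u_def frac_def abs_if; linarith)
    next
      case 2
      have "u < 1" by (simp add: u_def frac_lt_1)
      with 2 show ?thesis
        by (intro exI[of _ "- \<lfloor>s - t\<rfloor> - 1"]) (auto simp: u_def frac_def abs_if)
    qed
  qed
qed

lemma continuous_int_valued_constant:
  fixes f :: "real \<Rightarrow> real"
  assumes "continuous_on UNIV f" "\<And>t. f t \<in> \<int>"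
  obtains j :: int where "\<And>t. f t = of_int j"
proof -
  have "f constant_on UNIV"
  proof (rule continuous_discrete_range_constant[OF connected_UNIV assms(1)])
    fix x :: real
    have "1 \<le> norm (f y - f x)" if "f y \<noteq> f x" for y
    proof -
      obtain a b :: int where "f x = of_int a" "f y = of_int b" using assms(2) by (metis Ints_cases)
      then show ?thesis using that by (simp flip: of_int_diff of_int_abs)
    qed
    then show "\<exists>e>0. \<forall>y. y \<in> UNIV \<and> f y \<noteq> f x \<longrightarrow> e \<le> norm (f y - f x)"
      by (intro exI[of _ 1]) auto
  qed
  then obtain c where "\<And>t. f t = c" by (auto simp: constant_on_def)
  then show ?thesis using assms(2)[of 0] that by (metis Ints_cases)
qed

locale degree_one_lift =
  fixes \<gamma> :: "real \<Rightarrow> real"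
  assumes cont: "continuous_on UNIV \<gamma>" and mono: "strict_mono \<gamma>" and per: "\<gamma> (t + 1) = \<gamma> t + 1"
begin

lemma less_iff [simp]: "\<gamma> s < \<gamma> t \<longleftrightarrow> s < t" and le_iff [simp]: "\<gamma> s \<le> \<gamma> t \<longleftrightarrow> s \<le> t"
  and eq_iff [simp]: "\<gamma> s = \<gamma> t \<longleftrightarrow> s = t"
  using mono by (auto simp: strict_mono_less strict_mono_less_eq strict_mono_eq)

lemma per_nat: "\<gamma> (t + real n) = \<gamma> t + real n"
proof (induction n)
  case (Suc n)
  then show ?case using per[of "t + real n"] by (simp add: algebra_simps)
qed simp

lemma per_int: "\<gamma> (t + of_int j) = \<gamma> t + of_int j"
proof (cases j rule: int_cases2)
  case (nonneg n) then show ?thesis using per_nat[of t n] by simp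
next
  case (nonpos n) then show ?thesis using per_nat[of "t - real n" n] by simp
qed

lemma surj: "\<exists>t. \<gamma> t = y"
proof -
  define j where "j = \<lfloor>y - \<gamma> 0\<rfloor>"
  have "\<gamma> (0 + of_int j) \<le> y" "y \<le> \<gamma> (0 + of_int (j + 1))"
    unfolding per_int j_def by linarith+
  then show ?thesis
    using IVT'[of \<gamma> "of_int j" y "of_int (j + 1)"] continuous_on_subset[OF cont] by auto
qed

lemma iterate: "degree_one_lift (\<gamma> ^^ n)"
proof (induction n)
  case 0 show ?case by standard (auto simp: strict_mono_def continuous_on_id)
next
  case (Suc n)
  then interpret n: degree_one_lift "\<gamma> ^^ n" .
  show ?case
    by standard
       (use continuous_on_compose[OF n.cont continuous_on_subset[OF cont]] in \<open>auto simp: strict_mono_def n.per per o_def\<close>)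
qed

text \<open>Translating \<open>s\<close> by the floor of \<open>t - s\<close> puts \<open>t\<close>
  between two consecutive translates, and monotonicity keeps the images in that order.\<close>

lemma displacement: "\<bar>(\<gamma> t - t) - (\<gamma> s - s)\<bar> < 1"
proof -
  define j where "j = \<lfloor>t - s\<rfloor>"
  have j: "s + of_int j \<le> t" "t < s + of_int (j + 1)" unfolding j_def by linarith+
  then have "\<gamma> (s + of_int j) \<le> \<gamma> t" "\<gamma> t < \<gamma> (s + of_int (j + 1))" by simp_all
  then show ?thesis using j unfolding per_int by linarith
qed

lemma uniformly_continuous: "\<epsilon> > 0 \<Longrightarrow> \<exists>\<delta>>0. \<forall>s t. \<bar>s - t\<bar> < \<delta> \<longrightarrow> \<bar>\<gamma> s - \<gamma> t\<bar> < \<epsilon>"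
proof -
  assume "\<epsilon> > 0"
  \<comment> \<open>After an integer translation \<open>s\<close> lies in \<open>{0..<1}\<close>;
    with \<open>\<bar>s - t\<bar> < 1\<close> both points are then in this window.\<close>
  have "uniformly_continuous_on {-1..2} \<gamma>"
    by (rule compact_uniformly_continuous[OF continuous_on_subset[OF cont]]) auto
  then obtain d where d: "d > 0" "\<And>s t. s \<in> {-1..2} \<Longrightarrow> t \<in> {-1..2} \<Longrightarrow> \<bar>s - t\<bar> < d \<Longrightarrow> \<bar>\<gamma> s - \<gamma> t\<bar> < \<epsilon>"
    using \<open>\<epsilon> > 0\<close> unfolding uniformly_continuous_on_def dist_real_def by metis
  have "\<bar>\<gamma> s - \<gamma> t\<bar> < \<epsilon>" if st: "\<bar>s - t\<bar> < min d 1" for s t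
  proof -
    define j where "j = \<lfloor>s\<rfloor>"
    have j: "of_int j \<le> s" "s < of_int j + 1" unfolding j_def by linarith+
    have "\<bar>\<gamma> (s + of_int (-j)) - \<gamma> (t + of_int (-j))\<bar> < \<epsilon>"
      by (rule d(2)) (use st j in auto)
    then show ?thesis unfolding per_int by simp
  qed
  then show ?thesis using d(1) by (intro exI[of _ "min d 1"]) auto
qed

lemma inverse: "degree_one_lift (inv \<gamma>)" and inv_apply [simp]: "inv \<gamma> (\<gamma> t) = t" "\<gamma> (inv \<gamma> t) = t"
proof -
  have "inj \<gamma>" by (rule injI) simp
  then show 1: "inv \<gamma> (\<gamma> t) = t" for t by simp
  show 2: "\<gamma> (inv \<gamma> t) = t" for t using surj by (metis f_inv_into_f rangeI)
  have m: "inv \<gamma> s < inv \<gamma> t" if "s < t" for s t using that 2 less_iff by metis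
  show "degree_one_lift (inv \<gamma>)"
  proof
    show "strict_mono (inv \<gamma>)" by (rule strict_monoI) (rule m)
    have "range (inv \<gamma>) = UNIV" using 1 by (metis surjI)
    then show "continuous_on UNIV (inv \<gamma>)"
      by (intro continuous_onI_mono) (use m in \<open>auto simp: le_less\<close>)
    show "inv \<gamma> (t + 1) = inv \<gamma> t + 1" for t
      using 1[of "inv \<gamma> t + 1"] unfolding per 2 .
  qed
qed

text \<open>Each application of \<open>\<gamma> ^^ m\<close> moves every point by the same amount up
  to an error below 1, and the errors of \<open>k\<close> applications add up.\<close>

lemma iterate_mult_displacement:
  "\<bar>(\<gamma> ^^ (k * m)) t - t - real k * ((\<gamma> ^^ m) t - t)\<bar> \<le> real k"
proof (induction k)
  case (Suc k)
  interpret m: degree_one_lift "\<gamma> ^^ m" by (rule iterate)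
  have "(\<gamma> ^^ (Suc k * m)) t = (\<gamma> ^^ m) ((\<gamma> ^^ (k * m)) t)" by (simp add: funpow_add)
  then show ?case
    using Suc m.displacement[of "(\<gamma> ^^ (k * m)) t" t] by (simp add: algebra_simps abs_if split: if_splits)
qed simp

text \<open>Mean displacements over \<open>m\<close> and \<open>n\<close> steps are compared through
  the mean over \<open>m * n\<close> steps, which makes them a Cauchy sequence. The uniform error 1
  is kept along with the limit: it later bounds the sets used for the semiconjugacy and rules out a
  drift without periodic points.\<close>

lemma translation_bound_exists: "\<exists>l. \<forall>t n. \<bar>(\<gamma> ^^ n) t - t - real n * l\<bar> \<le> 1"
proof -
  have ex: "\<exists>l. \<forall>n. \<bar>(\<gamma> ^^ n) t - t - real n * l\<bar> \<le> 1" for t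
  proof -
    define b where "b n = ((\<gamma> ^^ n) t - t) / real n" for n
    have bb: "\<bar>b n - b m\<bar> \<le> 1 / real n + 1 / real m" if "n > 0" "m > 0" for n m
    proof -
      have *: "\<bar>b (k * m) - b m\<bar> \<le> 1 / real m" if "k > 0" "m > 0" for k m
      proof -
        have "b (k * m) - b m = ((\<gamma> ^^ (k * m)) t - t - real k * ((\<gamma> ^^ m) t - t)) / (real k * real m)"
          using that by (simp add: b_def field_simps)
        then have "\<bar>b (k * m) - b m\<bar> \<le> real k / (real k * real m)"
          using divide_right_mono[OF iterate_mult_displacement[of k m t], of "real k * real m"]
          by (simp add: abs_divide abs_mult)
        then show ?thesis using that by simp
      qed
      show ?thesis using *[of m n] *[of n m] that by (simp add: mult.commute)
    qed
    have "Cauchy b"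
    proof (rule CauchyI')
      fix e :: real assume "e > 0"
      then obtain N where N: "N > 0" "1 / real N < e / 2"
        by (metis half_gt_zero nat_approx_posE of_nat_0_less_iff zero_less_Suc)
      have "dist (b m) (b n) < e" if "m \<ge> N" "n > m" for m n
      proof -
        have "1 / real m \<le> 1 / real N" "1 / real n \<le> 1 / real N" using that N by (auto intro!: divide_left_mono)
        then show ?thesis using bb[of m n] that N by (simp add: dist_real_def)
      qed
      then show "\<exists>M. \<forall>m\<ge>M. \<forall>n>m. dist (b m) (b n) < e" by blast
    qed
    then obtain l where l: "b \<longlonglongrightarrow> l" using Cauchy_convergent convergent_def by blast
    have "\<bar>(\<gamma> ^^ n) t - t - real n * l\<bar> \<le> 1" for n
    proof (cases "n = 0")
      case False
      have "\<bar>l - b n\<bar> \<le> 0 + 1 / real n"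
      proof (rule LIMSEQ_le)
        show "(\<lambda>k. \<bar>b k - b n\<bar>) \<longlonglongrightarrow> \<bar>l - b n\<bar>" by (intro tendsto_intros l)
        show "(\<lambda>k. 1 / real k + 1 / real n) \<longlonglongrightarrow> 0 + 1 / real n"
          by (intro tendsto_intros lim_1_over_n)
        show "\<exists>N. \<forall>k\<ge>N. \<bar>b k - b n\<bar> \<le> 1 / real k + 1 / real n"
          using bb False by (intro exI[of _ 1]) auto
      qed
      then have "real n * \<bar>b n - l\<bar> \<le> 1" using False by (simp add: field_simps abs_minus_commute)
      moreover have "real n * \<bar>b n - l\<bar> = \<bar>(\<gamma> ^^ n) t - t - real n * l\<bar>"
        using False by (simp add: b_def field_simps flip: abs_mult[of "real n", simplified])
      ultimately show ?thesis by simp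
    qed simp
    then show ?thesis by blast
  qed
  obtain l where l: "\<And>n. \<bar>(\<gamma> ^^ n) 0 - 0 - real n * l\<bar> \<le> 1" using ex[of 0] by blast
  have "\<bar>(\<gamma> ^^ n) t - t - real n * l\<bar> \<le> 1" for t n
  proof -
    obtain l' where l': "\<And>n. \<bar>(\<gamma> ^^ n) t - t - real n * l'\<bar> \<le> 1" using ex[of t] by blast
    have "l' = l"
    proof (rule ccontr)
      assume "l' \<noteq> l"
      \<comment> \<open>Three errors of size 1 compete with this: one for each orbit and one for the
        difference of their displacements.\<close>
      then obtain k :: nat where k: "3 < real k * \<bar>l' - l\<bar>" using ex_less_of_nat_mult[of "\<bar>l' - l\<bar>" 3] by auto
      interpret k: degree_one_lift "\<gamma> ^^ k" by (rule iterate)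
      have "real k * \<bar>l' - l\<bar> = \<bar>real k * l' - real k * l\<bar>"
        by (simp add: abs_mult flip: right_diff_distrib)
      then show False using k l[of k] l'[of k] k.displacement[of t 0] by linarith
    qed
    then show ?thesis using l' by simp
  qed
  then show ?thesis by blast
qed

text \<open>Poincare's translation number, singled out by the uniform bound instead of a limit. It
  belongs to the lift; passing to the circle map leaves only its fractional part.\<close>

definition transl :: real where
  "transl = (SOME l. \<forall>t n. \<bar>(\<gamma> ^^ n) t - t - real n * l\<bar> \<le> 1)"

lemma transl_bound: "\<bar>(\<gamma> ^^ n) t - t - real n * transl\<bar> \<le> 1"
  using someI_ex[OF translation_bound_exists] unfolding transl_def by blast

lemma transl_limit: "(\<lambda>n. (\<gamma> ^^ n) t / real n) \<longlonglongrightarrow> transl"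
proof -
  have "(\<lambda>n. (\<gamma> ^^ n) t / real n - transl) \<longlonglongrightarrow> 0"
  proof (rule Lim_null_comparison)
    show "(\<lambda>n. (1 + \<bar>t\<bar>) * (1 / real n)) \<longlonglongrightarrow> 0"
      using tendsto_mult_left[OF lim_1_over_n, of "1 + \<bar>t\<bar>"] by simp
    show "\<forall>\<^sub>F n in sequentially. norm ((\<gamma> ^^ n) t / real n - transl) \<le> (1 + \<bar>t\<bar>) * (1 / real n)"
    proof (rule eventually_sequentiallyI[of 1])
      fix n :: nat assume n: "1 \<le> n"
      have "(\<gamma> ^^ n) t / real n - transl = ((\<gamma> ^^ n) t - real n * transl) / real n"
        using n by (simp add: field_simps)
      moreover have "\<bar>(\<gamma> ^^ n) t - real n * transl\<bar> \<le> 1 + \<bar>t\<bar>" using transl_bound[of n t] by linarith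
      ultimately show "norm ((\<gamma> ^^ n) t / real n - transl) \<le> (1 + \<bar>t\<bar>) * (1 / real n)"
        using n by (simp add: abs_divide divide_right_mono)
    qed
  qed
  then show ?thesis by (simp add: LIM_zero_iff)
qed

lemma transl_eqI: "(\<lambda>n. (\<gamma> ^^ n) t / real n) \<longlonglongrightarrow> l \<Longrightarrow> transl = l"
  using LIMSEQ_unique transl_limit by blast

end

text \<open>Two lifts differ by a continuous integer-valued function, hence by a constant. Applied
  to \<open>\<lambda>t. \<gamma> (t + 1)\<close> this yields a degree \<open>d\<close>, positive by
  monotonicity. A degree of 2 or more would let \<gamma> reach \<open>\<gamma> 0 + 1\<close>
  strictly between 0 and 1, against injectivity of \<alpha>.\<close>

lemma circle_lift_degree_one:
  assumes "orientation_preserving_homeo \<alpha>" "circle_lift \<alpha> \<gamma>"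
  shows "degree_one_lift \<gamma>"
    and "circle_lift \<alpha> \<gamma>' \<Longrightarrow> \<exists>j::int. \<forall>t. \<gamma>' t = \<gamma> t + of_int j"
proof -
  have diff: "\<exists>j::int. \<forall>t. \<gamma>\<^sub>2 t = \<gamma>\<^sub>1 t + of_int j" if "circle_lift \<alpha> \<gamma>\<^sub>1" "circle_lift \<alpha> \<gamma>\<^sub>2" for \<gamma>\<^sub>1 \<gamma>\<^sub>2
  proof -
    have "\<gamma>\<^sub>2 t - \<gamma>\<^sub>1 t \<in> \<int>" for t
      using that ei_eq_iff[of "\<gamma>\<^sub>2 t" "\<gamma>\<^sub>1 t"] by (simp add: circle_lift_def)
    moreover have "continuous_on UNIV (\<lambda>t. \<gamma>\<^sub>2 t - \<gamma>\<^sub>1 t)"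
      using that by (auto simp: circle_lift_def intro: continuous_intros)
    ultimately obtain j :: int where "\<And>t. \<gamma>\<^sub>2 t - \<gamma>\<^sub>1 t = of_int j"
      using continuous_int_valued_constant by blast
    then show ?thesis by (metis add.commute diff_add_cancel)
  qed
  show "\<exists>j::int. \<forall>t. \<gamma>' t = \<gamma> t + of_int j" if "circle_lift \<alpha> \<gamma>'" using diff assms(2) that .
  obtain \<beta> \<gamma>\<^sub>0 where \<beta>: "homeomorphism circle circle \<alpha> \<beta>" and \<gamma>\<^sub>0: "circle_lift \<alpha> \<gamma>\<^sub>0" "strict_mono \<gamma>\<^sub>0"
    using assms(1) by (auto simp: orientation_preserving_homeo_def)
  obtain j :: int where j: "\<And>t. \<gamma> t = \<gamma>\<^sub>0 t + of_int j" using diff[OF \<gamma>\<^sub>0(1) assms(2)] by blast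
  have c: "continuous_on UNIV \<gamma>" using assms(2) by (simp add: circle_lift_def)
  have m: "strict_mono \<gamma>" using \<gamma>\<^sub>0(2) by (auto simp: strict_mono_def j)
  have lift: "\<alpha> (ei t) = ei (\<gamma> t)" for t using assms(2) by (simp add: circle_lift_def)
  have "circle_lift \<alpha> (\<lambda>t. \<gamma> (t + 1))"
    unfolding circle_lift_def
  proof (intro conjI allI)
    show "continuous_on UNIV (\<lambda>t. \<gamma> (t + 1))"
      by (rule continuous_on_compose2[OF c]) (auto intro: continuous_intros)
    show "\<alpha> (ei t) = ei (\<gamma> (t + 1))" for t using lift[of "t + 1"] ei_add_int[of t 1] by simp
  qed
  then obtain d :: int where d: "\<And>t. \<gamma> (t + 1) = \<gamma> t + of_int d" using diff[OF assms(2)] by blast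
  have "\<gamma> 0 < \<gamma> 1" using m by (simp add: strict_mono_less)
  then have "d \<ge> 1" using d[of 0] by simp
  have "d = 1"
  proof (rule ccontr)
    assume "d \<noteq> 1"
    then have "d \<ge> 2" using \<open>d \<ge> 1\<close> by simp
    then have "real_of_int d \<ge> 2" by linarith
    then have "\<gamma> 0 \<le> \<gamma> 0 + 1" "\<gamma> 0 + 1 \<le> \<gamma> 1" using d[of 0] by auto
    then obtain s where s: "0 \<le> s" "s \<le> 1" "\<gamma> s = \<gamma> 0 + 1"
      using IVT'[of \<gamma> 0 "\<gamma> 0 + 1" 1] continuous_on_subset[OF c] by auto
    have "s \<noteq> 1" using s(3) d[of 0] \<open>real_of_int d \<ge> 2\<close> by auto
    have "s \<noteq> 0" using s(3) by auto
    have "\<alpha> (ei s) = \<alpha> (ei 0)" unfolding lift s(3) using ei_add_int[of "\<gamma> 0" 1] by simp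
    then have "ei s = ei 0"
      using \<beta> ei_in_circle unfolding homeomorphism_def by metis
    then have "s \<in> \<int>" by (subst (asm) ei_eq_iff) simp
    then obtain k :: int where "s = of_int k" by (auto elim: Ints_cases)
    then have "0 < k" "k < 1" using s \<open>s \<noteq> 0\<close> \<open>s \<noteq> 1\<close> by auto
    then show False by simp
  qed
  then show "degree_one_lift \<gamma>" using c m d by unfold_locales auto
qed

text \<open>The definition ranges over all lifts. Changing the lift by an integer \<open>j\<close>
  adds \<open>n * j\<close> to the n-th iterate and \<open>j\<close> to the limit, which
  \<open>frac\<close> does not see.\<close>

lemma rotation_number_eq:
  assumes "orientation_preserving_homeo \<alpha>" "circle_lift \<alpha> \<gamma>"
  shows "rotation_number \<alpha> = frac (degree_one_lift.transl \<gamma>)"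
proof -
  interpret degree_one_lift \<gamma> using circle_lift_degree_one[OF assms] by blast
  show ?thesis
    unfolding rotation_number_def
  proof (rule the_equality)
    show "\<forall>\<gamma>' t. circle_lift \<alpha> \<gamma>' \<longrightarrow> (\<exists>l. (\<lambda>n. (\<gamma>' ^^ n) t / real n) \<longlonglongrightarrow> l \<and> frac transl = frac l)"
    proof (intro allI impI)
      fix \<gamma>' t assume "circle_lift \<alpha> \<gamma>'"
      then obtain j :: int where j: "\<And>t. \<gamma>' t = \<gamma> t + of_int j"
        using circle_lift_degree_one(2)[OF assms] by blast
      have pow: "(\<gamma>' ^^ n) t = (\<gamma> ^^ n) t + of_int (int n * j)" for n
      proof (induction n)
        case (Suc n)
        have "(\<gamma>' ^^ Suc n) t = \<gamma> ((\<gamma>' ^^ n) t) + of_int j"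
          unfolding funpow.simps o_apply by (rule j)
        then show ?case by (simp only: Suc per_int) (simp add: algebra_simps)
      qed simp
      have "(\<lambda>n. (\<gamma> ^^ n) t / real n + of_int j) \<longlonglongrightarrow> transl + of_int j"
        by (intro tendsto_intros transl_limit)
      moreover have "\<forall>\<^sub>F n in sequentially. (\<gamma> ^^ n) t / real n + of_int j = (\<gamma>' ^^ n) t / real n"
        by (rule eventually_sequentiallyI[of 1]) (simp add: pow field_simps)
      ultimately have "(\<lambda>n. (\<gamma>' ^^ n) t / real n) \<longlonglongrightarrow> transl + of_int j"
        by (rule Lim_transform_eventually)
      moreover have "frac transl = frac (transl + of_int j)" by (simp add: frac_def)
      ultimately show "\<exists>l. (\<lambda>n. (\<gamma>' ^^ n) t / real n) \<longlonglongrightarrow> l \<and> frac transl = frac l" by blast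
    qed
    fix \<tau> assume "\<forall>\<gamma>' t. circle_lift \<alpha> \<gamma>' \<longrightarrow> (\<exists>l. (\<lambda>n. (\<gamma>' ^^ n) t / real n) \<longlonglongrightarrow> l \<and> \<tau> = frac l)"
    then obtain l where "(\<lambda>n. (\<gamma> ^^ n) 0 / real n) \<longlonglongrightarrow> l" "\<tau> = frac l" using assms(2) by blast
    then show "\<tau> = frac transl" using transl_eqI by simp
  qed
qed

lemma normal_lift_eq:
  assumes "orientation_preserving_homeo \<alpha>" "circle_lift \<alpha> \<gamma>" "0 \<le> \<gamma> 0" "\<gamma> 0 < 1"
  shows "normal_lift \<alpha> = \<gamma>"
  unfolding normal_lift_def
proof (rule the_equality)
  fix \<gamma>' assume \<gamma>': "circle_lift \<alpha> \<gamma>' \<and> 0 \<le> \<gamma>' 0 \<and> \<gamma>' 0 < 1"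
  then obtain j :: int where j: "\<And>t. \<gamma>' t = \<gamma> t + of_int j"
    using circle_lift_degree_one(2)[OF assms(1,2)] by blast
  have "j = 0" using j[of 0] \<gamma>' assms(3,4) by linarith
  then show "\<gamma>' = \<gamma>" using j by auto
qed (use assms in auto)

section \<open>Rotations and their lifts\<close>

lemma degree_one_lift_rotation: "degree_one_lift (\<lambda>t. t + \<tau>)"
  by standard (auto simp: strict_mono_def intro: continuous_intros)

lemma rotation_lift: "circle_lift (rotation \<tau>) (\<lambda>t. t + \<tau>)"
  unfolding circle_lift_def rotation_def
  by (auto simp: cis_mult algebra_simps intro!: continuous_intros)

lemma rotation_orientation_preserving: "orientation_preserving_homeo (rotation \<tau>)"
proof -
  have "homeomorphism circle circle (rotation \<tau>) (rotation (- \<tau>))"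
  proof (rule homeomorphismI)
    show "continuous_on circle (rotation \<tau>)" "continuous_on circle (rotation (- \<tau>))"
      unfolding rotation_def by (intro continuous_intros)+
    show "rotation \<tau> ` circle \<subseteq> circle" "rotation (- \<tau>) ` circle \<subseteq> circle"
      by (auto simp: rotation_def norm_mult)
    have "cis (2 * pi * \<tau>) * cis (- (2 * pi * \<tau>)) = 1" by (simp add: cis_mult)
    then have *: "cis (2 * pi * \<tau>) * (cis (- (2 * pi * \<tau>)) * z) = z" 
      "cis (- (2 * pi * \<tau>)) * (cis (2 * pi * \<tau>) * z) = z" for z
      by (metis mult.assoc mult.commute mult_1)+
    show "rotation (- \<tau>) (rotation \<tau> x) = x" "rotation \<tau> (rotation (- \<tau>) x) = x" for x
      by (simp_all add: rotation_def *)
  qed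
  moreover have "strict_mono (\<lambda>t. t + \<tau>)" by (auto simp: strict_mono_def)
  ultimately show ?thesis unfolding orientation_preserving_homeo_def using rotation_lift by blast
qed

lemma rotation_iterate: "((\<lambda>t. t + \<tau>) ^^ n) t = t + real n * (\<tau> :: real)"
  by (induction n) (auto simp: algebra_simps)

lemma transl_rotation: "degree_one_lift.transl (\<lambda>t. t + \<tau>) = \<tau>"
proof -
  interpret degree_one_lift "\<lambda>t. t + \<tau>" by (rule degree_one_lift_rotation)
  show ?thesis
  proof (rule transl_eqI)
    have "(\<lambda>n. \<tau>) \<longlonglongrightarrow> \<tau>" by simp
    moreover have "\<forall>\<^sub>F n in sequentially. \<tau> = ((\<lambda>t. t + \<tau>) ^^ n) 0 / real n"
      by (rule eventually_sequentiallyI[of 1]) (simp add: rotation_iterate)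
    ultimately show "(\<lambda>n. ((\<lambda>t. t + \<tau>) ^^ n) 0 / real n) \<longlonglongrightarrow> \<tau>" by (rule Lim_transform_eventually)
  qed
qed

section \<open>Rational translation number: periodic orbits and their attraction\<close>

context degree_one_lift begin

lemma iterate_commute: "(\<gamma> ^^ n) (\<gamma> t) = \<gamma> ((\<gamma> ^^ n) t)"
  by (simp add: funpow_swap1)

text \<open>Otherwise the periodic function \<open>(\<gamma> ^^ n) t - t - m\<close> keeps its sign
  and a distance \<open>\<epsilon>\<close> from 0. Then \<open>k * n\<close> steps drift by at least
  \<open>k * \<epsilon>\<close> away from \<open>k * m\<close>, more than the error 1 of the
  translation number permits.\<close>

lemma periodic_point_exists:
  assumes n: "n > 0" and l: "transl = of_int m / real n"
  shows "\<exists>p. (\<gamma> ^^ n) p = p + of_int m"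
proof (rule ccontr)
  assume no: "\<not> ?thesis"
  interpret n: degree_one_lift "\<gamma> ^^ n" by (rule iterate)
  define f where "f t = (\<gamma> ^^ n) t - t - of_int m" for t
  have fne: "f t \<noteq> 0" for t using no by (auto simp: f_def algebra_simps)
  have fc: "continuous_on S f" for S
    unfolding f_def by (intro continuous_intros continuous_on_subset[OF n.cont]) auto
  have fper: "f (t + of_int j) = f t" for t j using n.per_int[of t j] by (simp add: f_def)
  \<comment> \<open>Multiplying by the sign treats upward and downward drift together.\<close>
  define s where "s = sgn (f 0)"
  have s: "\<bar>s\<bar> = 1" using fne[of 0] by (simp add: s_def abs_sgn)
  have pos: "0 < s * f t" for t
  proof (rule ccontr)
    assume "\<not> 0 < s * f t"
    then have neg: "s * f t \<le> 0" by simp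
    have "0 \<le> s * f 0" by (simp add: s_def sgn_real_def)
    then have "0 \<in> closed_segment (s * f t) (s * f 0)" using neg by (simp add: closed_segment_eq_real_ivl)
    then obtain x where "s * f x = 0"
      using IVT'_closed_segment_real[of 0 "\<lambda>x. s * f x" t 0] continuous_on_mult_left[OF fc] by blast
    then show False using fne s by auto
  qed
  have "\<exists>x\<in>{0..1}. \<forall>y\<in>{0..1}. s * f x \<le> s * f y"
    by (rule continuous_attains_inf) (auto intro: continuous_on_mult_left fc)
  then obtain x where x: "\<And>y. y \<in> {0..1} \<Longrightarrow> s * f x \<le> s * f y" by blast
  define \<epsilon> where "\<epsilon> = s * f x"
  have \<epsilon>: "\<epsilon> > 0" unfolding \<epsilon>_def by (rule pos)
  have ge: "\<epsilon> \<le> s * f t" for t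
    using x[of "t + of_int (- \<lfloor>t\<rfloor>)"] unfolding fper \<epsilon>_def by (simp add: le_diff_eq) linarith
  have iter: "real k * \<epsilon> \<le> s * ((\<gamma> ^^ (k * n)) 0 - real k * of_int m)" for k
  proof (induction k)
    case (Suc k)
    have "(\<gamma> ^^ (Suc k * n)) 0 = (\<gamma> ^^ n) ((\<gamma> ^^ (k * n)) 0)" by (simp add: funpow_add)
    then have "(\<gamma> ^^ (Suc k * n)) 0 = f ((\<gamma> ^^ (k * n)) 0) + (\<gamma> ^^ (k * n)) 0 + of_int m" by (simp add: f_def)
    then show ?case using Suc ge[of "(\<gamma> ^^ (k * n)) 0"] by (simp add: algebra_simps)
  qed simp
  obtain k :: nat where k: "1 < real k * \<epsilon>" using ex_less_of_nat_mult[OF \<epsilon>, of 1] by auto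
  have "real (k * n) * transl = real k * of_int m" using n by (simp add: l)
  from transl_bound[of "k * n" 0, unfolded this]
  have "\<bar>(\<gamma> ^^ (k * n)) 0 - real k * of_int m\<bar> \<le> 1" by simp
  then have "\<bar>s * ((\<gamma> ^^ (k * n)) 0 - real k * of_int m)\<bar> \<le> 1" by (simp add: abs_mult s)
  then show False using iter[of k] k by linarith
qed

lemma periodic_iterate:
  assumes "(\<gamma> ^^ n) p = p + of_int m"
  shows "(\<gamma> ^^ (n * k)) p = p + of_int (int k * m)"
proof (induction k)
  case (Suc k)
  interpret n: degree_one_lift "\<gamma> ^^ n" by (rule iterate)
  have "(\<gamma> ^^ (n * Suc k)) p = (\<gamma> ^^ n) ((\<gamma> ^^ (n * k)) p)" by (simp add: funpow_add)
  also have "\<dots> = p + of_int m + of_int (int k * m)" by (simp only: Suc n.per_int assms)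
  finally show ?case by (simp add: algebra_simps)
qed simp

text \<open>Every n-th point of the orbit of 0, brought back by multiples of \<open>m\<close>, forms
  a bounded monotone sequence. Its limit is the periodic point that the orbit approaches.\<close>

lemma asymptotic_periodic_point:
  assumes n: "n > 0" and l: "transl = of_int m / real n"
  obtains p where "(\<gamma> ^^ n) p = p + of_int m" "(\<lambda>N. (\<gamma> ^^ N) 0 - (\<gamma> ^^ N) p) \<longlonglongrightarrow> 0"
proof -
  interpret n: degree_one_lift "\<gamma> ^^ n" by (rule iterate)
  obtain p0 where p0: "(\<gamma> ^^ n) p0 = p0 + of_int m" using periodic_point_exists[OF assms] by blast
  define b where "b k = (\<gamma> ^^ (n * k)) 0 - of_int (int k * m)" for k
  have b_Suc: "b (Suc k) = (\<gamma> ^^ n) (b k) - of_int m" for k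
  proof -
    have "(\<gamma> ^^ n) (b k) = (\<gamma> ^^ n) ((\<gamma> ^^ (n * k)) 0 + of_int (- (int k * m)))" by (simp add: b_def)
    also have "\<dots> = (\<gamma> ^^ n) ((\<gamma> ^^ (n * k)) 0) + of_int (- (int k * m))" by (rule n.per_int)
    finally show ?thesis by (simp add: b_def funpow_add algebra_simps)
  qed
  have bdd: "\<bar>b k\<bar> \<le> 1" for k
  proof -
    have "real (n * k) * transl = of_int (int k * m)" using n by (simp add: l)
    from transl_bound[of "n * k" 0, unfolded this] show ?thesis by (simp add: b_def)
  qed
  \<comment> \<open>\<open>b\<close> is an orbit of the increasing map
    \<open>(\<gamma> ^^ n) t - m\<close>, so the direction of its initial step persists.\<close>
  have "monoseq b"
  proof (cases "b 0 \<le> b 1")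
    case True
    have "b k \<le> b (Suc k)" for k
      by (induction k) (use True in \<open>auto simp: b_Suc\<close>)
    then show ?thesis by (simp add: monoseq_Suc)
  next
    case False
    have "b (Suc k) \<le> b k" for k
      by (induction k) (use False in \<open>auto simp: b_Suc\<close>)
    then show ?thesis by (simp add: monoseq_Suc)
  qed
  moreover have "Bseq b" by (rule BseqI'[of _ 1]) (use bdd in simp)
  ultimately obtain p where p: "b \<longlonglongrightarrow> p" using Bseq_monoseq_convergent convergent_def by blast
  have cont_at: "isCont (\<gamma> ^^ r) t" for r t
    using degree_one_lift.cont[OF iterate, of r] by (simp add: continuous_on_eq_continuous_at)
  have "(\<lambda>k. (\<gamma> ^^ n) (b k) - of_int m) \<longlonglongrightarrow> (\<gamma> ^^ n) p - of_int m"
    by (intro tendsto_intros isCont_tendsto_compose[OF cont_at p])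
  moreover have "(\<lambda>k. b (Suc k)) \<longlonglongrightarrow> p" using p by (rule LIMSEQ_Suc)
  ultimately have "p = (\<gamma> ^^ n) p - of_int m" unfolding b_Suc by (rule LIMSEQ_unique[symmetric])
  then have fix_p: "(\<gamma> ^^ n) p = p + of_int m" by simp
  \<comment> \<open>The integer translations of both orbits cancel, which leaves one of
    \<open>n\<close> continuous maps applied to the convergent sequence \<open>b\<close>.\<close>
  have diff: "(\<gamma> ^^ N) 0 - (\<gamma> ^^ N) p = (\<gamma> ^^ (N mod n)) (b (N div n)) - (\<gamma> ^^ (N mod n)) p" for N
  proof -
    interpret r: degree_one_lift "\<gamma> ^^ (N mod n)" by (rule iterate)
    have "\<gamma> ^^ N = \<gamma> ^^ (N mod n + n * (N div n))" by simp
    then have split: "(\<gamma> ^^ N) x = (\<gamma> ^^ (N mod n)) ((\<gamma> ^^ (n * (N div n))) x)" for x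
      by (simp only: funpow_add o_apply)
    have "(\<gamma> ^^ (n * (N div n))) 0 = b (N div n) + of_int (int (N div n) * m)" by (simp add: b_def)
    then show ?thesis unfolding split periodic_iterate[OF fix_p] by (simp only: r.per_int)
  qed
  have "(\<lambda>N. (\<gamma> ^^ N) 0 - (\<gamma> ^^ N) p) \<longlonglongrightarrow> 0"
  proof (rule LIMSEQ_I)
    fix \<epsilon> :: real assume "\<epsilon> > 0"
    have "\<forall>\<^sub>F k in sequentially. \<bar>(\<gamma> ^^ r) (b k) - (\<gamma> ^^ r) p\<bar> < \<epsilon>" for r
      using tendstoD[OF isCont_tendsto_compose[OF cont_at p, of r] \<open>\<epsilon> > 0\<close>] by (simp add: dist_real_def)
    then have "\<forall>\<^sub>F k in sequentially. \<forall>r\<in>{..<n}. \<bar>(\<gamma> ^^ r) (b k) - (\<gamma> ^^ r) p\<bar> < \<epsilon>"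
      by (intro eventually_ball_finite) auto
    then obtain K where K: "\<And>k r. k \<ge> K \<Longrightarrow> r < n \<Longrightarrow> \<bar>(\<gamma> ^^ r) (b k) - (\<gamma> ^^ r) p\<bar> < \<epsilon>"
      by (auto simp: eventually_sequentially)
    have "norm ((\<gamma> ^^ N) 0 - (\<gamma> ^^ N) p - 0) < \<epsilon>" if "N \<ge> n * K" for N
      using K[of "N div n" "N mod n"] n that unfolding diff by (simp add: less_eq_div_iff_mult_less_eq mult.commute)
    then show "\<exists>N0. \<forall>N\<ge>N0. norm ((\<gamma> ^^ N) 0 - (\<gamma> ^^ N) p - 0) < \<epsilon>" by blast
  qed
  then show ?thesis using that fix_p by blast
qed

text \<open>Averaging over one period turns the periodic orbit into an orbit of the rotation.\<close>

lemma periodic_linearization: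
  assumes n: "n > 0" and p: "(\<gamma> ^^ n) p = p + of_int m"
  obtains h where "degree_one_lift h" "\<And>N. h ((\<gamma> ^^ N) p) = real N * (of_int m / real n)"
proof -
  define g where "g t = (\<Sum>k<n. (\<gamma> ^^ k) t - real k * (of_int m / real n)) / real n" for t
  note it = iterate[THEN degree_one_lift.cont] iterate[THEN degree_one_lift.less_iff] iterate[THEN degree_one_lift.per]
  interpret g: degree_one_lift g
  proof
    show "continuous_on UNIV g" unfolding g_def using n by (intro continuous_intros it) auto
    show "strict_mono g"
      unfolding g_def using n
      by (intro strict_monoI divide_strict_right_mono sum_strict_mono) (auto simp: it)
    show "g (t + 1) = g t + 1" for t
    proof -
      have "(\<gamma> ^^ k) (t + 1) - c = ((\<gamma> ^^ k) t - c) + 1" for k c by (simp add: it(3))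
      then show ?thesis unfolding g_def using n by (simp only: sum.distrib) (simp add: add_divide_distrib)
    qed
  qed
  have step: "g (\<gamma> t) = g t + of_int m / real n" if t: "(\<gamma> ^^ n) t = t + of_int m" for t
  proof -
    let ?a = "\<lambda>k. (\<gamma> ^^ k) t - real k * (of_int m / real n)"
    have "(\<gamma> ^^ k) (\<gamma> t) - real k * (of_int m / real n) = ?a (Suc k) + of_int m / real n" for k
      using iterate_commute[of k t] by (simp add: algebra_simps add_divide_distrib)
    then have "g (\<gamma> t) = ((\<Sum>k<n. ?a (Suc k)) + real n * (of_int m / real n)) / real n"
      by (simp add: g_def sum.distrib)
    \<comment> \<open>The boundary term of the telescoping sum vanishes exactly for points with
      \<open>(\<gamma> ^^ n) t = t + m\<close>; elsewhere the average need not linearize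
      \<gamma>.\<close>
    also have "(\<Sum>k<n. ?a (Suc k)) = (\<Sum>k<n. ?a k) + (?a n - ?a 0)"
      using sum_lessThan_telescope[of ?a n] by (simp add: sum_subtractf)
    also have "?a n - ?a 0 = 0" using t n by simp
    finally show ?thesis using n by (simp add: g_def add_divide_distrib)
  qed
  have orbit: "(\<gamma> ^^ n) ((\<gamma> ^^ N) p) = (\<gamma> ^^ N) p + of_int m" for N
  proof -
    interpret N: degree_one_lift "\<gamma> ^^ N" by (rule iterate)
    have "(\<gamma> ^^ n) ((\<gamma> ^^ N) p) = (\<gamma> ^^ N) ((\<gamma> ^^ n) p)"
      by (metis add.commute comp_apply funpow_add)
    then show ?thesis by (simp only: p N.per_int)
  qed
  have "g ((\<gamma> ^^ N) p) = g p + real N * (of_int m / real n)" for N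
    by (induction N) (simp_all add: step[OF orbit] algebra_simps add_divide_distrib)
  moreover have "degree_one_lift (\<lambda>t. g t - g p)"
    by standard (auto simp: strict_mono_def g.per intro!: continuous_intros g.cont)
  ultimately show ?thesis using that[of "\<lambda>t. g t - g p"] by auto
qed

end

section \<open>Irrational translation numbers\<close>

lemma irrational_orbit_dense:
  fixes l :: real
  assumes "l \<notin> \<rat>" "a < b"
  obtains n :: nat and j :: int where "n \<ge> N" "a < real n * l + of_int j" "real n * l + of_int j < b"
proof -
  \<comment> \<open>Aiming at the midpoint less \<open>N * l\<close> yields an index
    \<open>k + N\<close>, hence one beyond \<open>N\<close>.\<close>
  define c where "c = (a + b) / 2 - real N * l"
  define \<epsilon> where "\<epsilon> = (b - a) / 2"
  have "\<epsilon> > 0" using assms(2) by (simp add: \<epsilon>_def)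
  then obtain k :: nat where k: "\<bar>frac (real k * l) - frac c\<bar> < \<epsilon>"
    using Kronecker_approx_1_explicit[OF assms(1), of "frac c" \<epsilon>] frac_lt_1[of c] by (auto simp: less_imp_le)
  have "\<bar>real (k + N) * l + of_int (\<lfloor>c\<rfloor> - \<lfloor>real k * l\<rfloor>) - (a + b) / 2\<bar> < (b - a) / 2"
    using k by (simp add: frac_def c_def \<epsilon>_def algebra_simps)
  then have "a < real (k + N) * l + of_int (\<lfloor>c\<rfloor> - \<lfloor>real k * l\<rfloor>)"
    "real (k + N) * l + of_int (\<lfloor>c\<rfloor> - \<lfloor>real k * l\<rfloor>) < b"
    by (simp_all add: abs_less_iff field_simps)
  then show ?thesis by (rule that[OF le_add2])
qed

text \<open>\<open>h\<close> is only \<open>mono\<close>: it may be constant on intervals, and these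
  are the obstruction to transitivity.\<close>

locale semiconjugacy = degree_one_lift +
  fixes h :: "real \<Rightarrow> real" and l :: real
  assumes h_cont: "continuous_on UNIV h" and h_mono: "mono h" and h_per: "h (t + 1) = h t + 1"
    and h_step: "h (\<gamma> t) = h t + l" and irr: "l \<notin> \<rat>"

context degree_one_lift begin

text \<open>\<open>h\<close> is a supremum of the orbit with its drift removed, finite by the
  uniform error of the translation number. Its range contains a dense set, the values along integer
  translates of the orbit of 0, and a monotone map with dense range has no jumps.\<close>

lemma semiconjugacy_exists:
  assumes irr: "transl \<notin> \<rat>"
  shows "\<exists>h. semiconjugacy \<gamma> h transl"
proof -
  let ?l = transl
  \<comment> \<open>With \<open>k = m - n\<close> this is the set of all
    \<open>\<gamma>^k(t) - k * l\<close> over the integers \<open>k\<close>; the pair of natural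
    numbers takes the place of a negative iterate.\<close>
  define A where "A t = {u + (real n - real m) * ?l |u m n. (\<gamma> ^^ n) u = (\<gamma> ^^ m) t}" for t
  define h where "h t = Sup (A t)" for t
  have A_ex: "\<exists>u m n. (\<gamma> ^^ n) u = (\<gamma> ^^ m) t \<and> v = u + (real n - real m) * ?l" if "v \<in> A t" for v t
    using that unfolding A_def by (rule CollectE) blast
  have bound: "\<bar>v - t\<bar> \<le> 2" if v: "v \<in> A t" for v t
  proof -
    obtain u m n where *: "(\<gamma> ^^ n) u = (\<gamma> ^^ m) t" "v = u + (real n - real m) * ?l"
      using A_ex[OF v] by (elim exE conjE)
    show ?thesis
      using transl_bound[of n u] transl_bound[of m t] unfolding * by (simp add: left_diff_distrib)
  qed
  have ne: "A t \<noteq> {}" and t_in: "t \<in> A t" for t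
  proof -
    show "t \<in> A t" unfolding A_def by (intro CollectI exI[of _ t] exI[of _ 0]) auto
    then show "A t \<noteq> {}" by blast
  qed
  have bdd: "bdd_above (A t)" for t
    using bound[of _ t] by (intro bdd_aboveI[of _ "t + 2"]) fastforce
  \<comment> \<open>Both functional equations of \<open>h\<close> reduce to this: an integer
    translation and a step of \<gamma> each translate the whole set \<open>A t\<close>.\<close>
  have shift: "h s = h t + c" if "\<And>v. v \<in> A t \<Longrightarrow> v + c \<in> A s" "\<And>v. v \<in> A s \<Longrightarrow> v - c \<in> A t" for s t c
  proof (rule antisym)
    show "h s \<le> h t + c"
      unfolding h_def
    proof (rule cSup_least[OF ne])
      fix v assume "v \<in> A s"
      from cSup_upper[OF that(2)[OF this] bdd] show "v \<le> Sup (A t) + c" by simp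
    qed
    have "h t \<le> h s - c"
      unfolding h_def
    proof (rule cSup_least[OF ne])
      fix v assume "v \<in> A t"
      from cSup_upper[OF that(1)[OF this] bdd] show "v \<le> Sup (A s) - c" by simp
    qed
    then show "h t + c \<le> h s" by simp
  qed
  have h_per: "h (t + of_int j) = h t + of_int j" for t j
  proof (rule shift)
    note p = degree_one_lift.per_int[OF iterate]
    show "v + of_int j \<in> A (t + of_int j)" if v: "v \<in> A t" for v
    proof -
      obtain u m n where *: "(\<gamma> ^^ n) u = (\<gamma> ^^ m) t" "v = u + (real n - real m) * ?l"
        using A_ex[OF v] by (elim exE conjE)
      have "(\<gamma> ^^ n) (u + of_int j) = (\<gamma> ^^ m) (t + of_int j)" by (simp only: p *)
      then show ?thesis unfolding A_def *(2) by (intro CollectI exI[of _ "u + of_int j"] exI[of _ m] exI[of _ n]) auto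
    qed
    show "v - of_int j \<in> A t" if v: "v \<in> A (t + of_int j)" for v
    proof -
      obtain u m n where *: "(\<gamma> ^^ n) u = (\<gamma> ^^ m) (t + of_int j)" "v = u + (real n - real m) * ?l"
        using A_ex[OF v] by (elim exE conjE)
      have "(\<gamma> ^^ n) (u + of_int (- j)) = (\<gamma> ^^ m) t" unfolding p *(1) by simp
      then show ?thesis unfolding A_def *(2) by (intro CollectI exI[of _ "u + of_int (- j)"] exI[of _ m] exI[of _ n]) auto
    qed
  qed
  have h_step: "h (\<gamma> t) = h t + ?l" for t
  proof (rule shift)
    show "v + ?l \<in> A (\<gamma> t)" if v: "v \<in> A t" for v
    proof -
      obtain u m n where *: "(\<gamma> ^^ n) u = (\<gamma> ^^ m) t" "v = u + (real n - real m) * ?l"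
        using A_ex[OF v] by (elim exE conjE)
      have "(\<gamma> ^^ Suc n) u = (\<gamma> ^^ m) (\<gamma> t)" by (simp add: *(1) iterate_commute)
      then show ?thesis unfolding A_def *(2)
        by (intro CollectI exI[of _ u] exI[of _ m] exI[of _ "Suc n"]) (auto simp: algebra_simps)
    qed
    show "v - ?l \<in> A t" if v: "v \<in> A (\<gamma> t)" for v
    proof -
      obtain u m n where *: "(\<gamma> ^^ n) u = (\<gamma> ^^ m) (\<gamma> t)" "v = u + (real n - real m) * ?l"
        using A_ex[OF v] by (elim exE conjE)
      have "(\<gamma> ^^ n) u = (\<gamma> ^^ Suc m) t" by (simp add: *(1) iterate_commute)
      then show ?thesis unfolding A_def *(2)
        by (intro CollectI exI[of _ u] exI[of _ "Suc m"] exI[of _ n]) (auto simp: algebra_simps)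
    qed
  qed
  have h_mono: "h s \<le> h t" if "s \<le> t" for s t
    unfolding h_def
  proof (rule cSup_mono[OF ne bdd])
    fix v assume "v \<in> A s"
    from A_ex[OF this] obtain u m n where *: "(\<gamma> ^^ n) u = (\<gamma> ^^ m) s" "v = u + (real n - real m) * ?l"
      by (elim exE conjE)
    interpret n: degree_one_lift "\<gamma> ^^ n" by (rule iterate)
    interpret m: degree_one_lift "\<gamma> ^^ m" by (rule iterate)
    obtain u' where u': "(\<gamma> ^^ n) u' = (\<gamma> ^^ m) t" using n.surj by blast
    have "(\<gamma> ^^ n) u \<le> (\<gamma> ^^ n) u'" using that by (simp add: *(1) u')
    then have "u \<le> u'" by simp
    moreover have "u' + (real n - real m) * ?l \<in> A t" using u' unfolding A_def by blast
    ultimately show "\<exists>w\<in>A t. v \<le> w" unfolding *(2) by (intro bexI) auto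
  qed
  have orbit: "h ((\<gamma> ^^ n) 0 + of_int j) = h 0 + real n * ?l + of_int j" for n j
  proof -
    have "h ((\<gamma> ^^ n) 0) = h 0 + real n * ?l" by (induction n) (auto simp: h_step algebra_simps)
    then show ?thesis by (simp add: h_per)
  qed
  have dense: "\<exists>s. a < h s \<and> h s < b" if ab: "a < b" for a b
  proof -
    have "a - h 0 < b - h 0" using ab by simp
    then obtain n :: nat and j :: int where "a - h 0 < real n * ?l + of_int j" "real n * ?l + of_int j < b - h 0"
      by (rule irrational_orbit_dense[OF irr, of _ _ 0])
    then show ?thesis using orbit[of n j] by (intro exI[of _ "(\<gamma> ^^ n) 0 + of_int j"]) linarith
  qed
  have "continuous_on UNIV h"
    unfolding continuous_on_iff dist_real_def
  proof (intro ballI allI impI)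
    fix t \<epsilon> :: real assume "\<epsilon> > 0"
    obtain a b where ab: "h t < h b" "h b < h t + \<epsilon>" "h t - \<epsilon> < h a" "h a < h t"
      using dense[of "h t" "h t + \<epsilon>"] dense[of "h t - \<epsilon>" "h t"] \<open>\<epsilon> > 0\<close> by auto
    then have "a < t" "t < b" using h_mono[of t a] h_mono[of b t] by (meson linorder_not_le)+
    have "\<bar>h x - h t\<bar> < \<epsilon>" if "\<bar>x - t\<bar> < min (t - a) (b - t)" for x
    proof -
      have "a \<le> x" "x \<le> b" using that by (auto simp: abs_less_iff)
      then show ?thesis using h_mono[of a x] h_mono[of x b] ab by linarith
    qed
    then show "\<exists>d>0. \<forall>x\<in>UNIV. \<bar>x - t\<bar> < d \<longrightarrow> \<bar>h x - h t\<bar> < \<epsilon>"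
      using \<open>a < t\<close> \<open>t < b\<close> by (intro exI[of _ "min (t - a) (b - t)"]) auto
  qed
  then have "semiconjugacy \<gamma> h ?l"
    using h_mono h_per[of _ 1] h_step irr by unfold_locales (auto simp: mono_def)
  then show ?thesis by (rule exI[of _ h])
qed

end

text \<open>Accumulation on the circle expressed on the line, modulo integers. It counts indices,
  not points, so a periodic sequence accumulates at its own values.\<close>

definition orbit_limit :: "(nat \<Rightarrow> real) \<Rightarrow> real \<Rightarrow> bool" where
  "orbit_limit x t \<longleftrightarrow> (\<forall>\<epsilon>>0. \<forall>N. \<exists>n\<ge>N. \<exists>j::int. \<bar>x n + of_int j - t\<bar> < \<epsilon>)"

section \<open>Limit points of orbits as the points where the semiconjugacy grows\<close>

context semiconjugacy begin

lemma h_per_int: "h (t + of_int j) = h t + of_int j"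
proof -
  have nat: "h (t + real n) = h t + real n" for t n
  proof (induction n)
    case (Suc n) then show ?case using h_per[of "t + real n"] by (simp add: algebra_simps)
  qed simp
  show ?thesis
  proof (cases j rule: int_cases2)
    case (nonneg n) then show ?thesis using nat[of t n] by simp
  next
    case (nonpos n) then show ?thesis using nat[of "t - real n" n] by simp
  qed
qed

lemma h_le: "s \<le> t \<Longrightarrow> h s \<le> h t" using h_mono by (simp add: mono_def)

lemma h_lessD: "h s < h t \<Longrightarrow> s < t" using h_le[of t s] by linarith

lemma h_iterate: "h ((\<gamma> ^^ n) t) = h t + real n * l"
  by (induction n) (auto simp: h_step algebra_simps)

text \<open>The support of the Stieltjes measure of \<open>h\<close>, a measure that \<gamma>
  preserves.\<close>

definition support :: "real set" where
  "support = {t. \<forall>a b. a < t \<and> t < b \<longrightarrow> h a < h b}"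

text \<open>Near a point of the support, \<open>h\<close> has an interval of values, which the
  sequence \<open>c + n * \<sigma>\<close> meets modulo integers; monotonicity pulls this back to
  the line. If \<open>h\<close> is constant around \<open>t\<close>, two indices share a value
  modulo integers and \<open>\<sigma>\<close> is rational. The general step \<open>\<sigma>\<close>
  covers forward orbits with \<open>l\<close> and backward orbits with \<open>- l\<close>.\<close>

lemma orbit_limit_iff:
  assumes x: "\<And>n. h (x n) = c + real n * \<sigma>" and \<sigma>: "\<sigma> \<notin> \<rat>"
  shows "orbit_limit x t \<longleftrightarrow> t \<in> support"
proof
  assume t: "t \<in> support"
  show "orbit_limit x t"
    unfolding orbit_limit_def
  proof (intro allI impI)
    fix \<epsilon> :: real and N assume "\<epsilon> > 0"
    then have "h (t - \<epsilon>) < h (t + \<epsilon>)" using t by (auto simp: support_def)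
    then obtain n :: nat and j :: int where nj: "n \<ge> N" "h (t - \<epsilon>) - c < real n * \<sigma> + of_int j"
      "real n * \<sigma> + of_int j < h (t + \<epsilon>) - c"
      using irrational_orbit_dense[OF \<sigma>, of "h (t - \<epsilon>) - c" "h (t + \<epsilon>) - c" N] by auto
    have "h (x n + of_int j) = c + real n * \<sigma> + of_int j" by (simp add: h_per_int x)
    then have "h (t - \<epsilon>) < h (x n + of_int j)" "h (x n + of_int j) < h (t + \<epsilon>)" using nj by linarith+
    then have "t - \<epsilon> < x n + of_int j" "x n + of_int j < t + \<epsilon>" by (simp_all only: h_lessD)
    then show "\<exists>n\<ge>N. \<exists>j::int. \<bar>x n + of_int j - t\<bar> < \<epsilon>"
      using nj(1) by (intro exI[of _ n] conjI exI[of _ j]) auto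
  qed
next
  assume lim: "orbit_limit x t"
  show "t \<in> support"
    unfolding support_def
  proof (intro CollectI allI impI, rule ccontr)
    fix a b assume ab: "a < t \<and> t < b" and "\<not> h a < h b"
    then have eq: "h s = h a" if "a \<le> s" "s \<le> b" for s
      using h_le[of a s] h_le[of s b] that by linarith
    have near: "\<exists>n\<ge>N. \<exists>j::int. c + real n * \<sigma> + of_int j = h a" for N
    proof -
      have "min (t - a) (b - t) > 0" using ab by simp
      then obtain n j where "n \<ge> N" "\<bar>x n + of_int j - t\<bar> < min (t - a) (b - t)"
        using lim unfolding orbit_limit_def by blast
      then have "h (x n + of_int j) = h a" by (intro eq) auto
      then have "c + real n * \<sigma> + of_int j = h a" by (simp add: h_per_int x)
      then show ?thesis using \<open>n \<ge> N\<close> by blast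
    qed
    obtain n j where n: "c + real n * \<sigma> + of_int j = h a" using near[of 0] by blast
    obtain m i where m: "m \<ge> Suc n" "c + real m * \<sigma> + of_int i = h a" using near[of "Suc n"] by blast
    have "(real m - real n) * \<sigma> = of_int (j - i)" using n m(2) by (simp add: algebra_simps)
    then have "\<sigma> = of_int (j - i) / of_int (int m - int n)" using m(1) by (simp add: field_simps)
    then show False using \<sigma> by (metis Rats_divide Rats_of_int)
  qed
qed

lemma orbit_injective:
  assumes x: "\<And>n. h (x n) = c + real n * \<sigma>" and \<sigma>: "\<sigma> \<notin> \<rat>" and eq: "x m - x n \<in> \<int>"
  shows "m = n"
proof (rule ccontr)
  assume "m \<noteq> n"
  obtain j :: int where "x m = x n + of_int j" using eq by (metis Ints_cases add.commute diff_add_cancel)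
  then have "c + real m * \<sigma> = c + real n * \<sigma> + of_int j" by (metis h_per_int x)
  then have "\<sigma> = of_int j / of_int (int m - int n)" using \<open>m \<noteq> n\<close> by (simp add: field_simps)
  then show False using \<sigma> by (metis Rats_divide Rats_of_int)
qed

lemma support_per_int: "t + of_int j \<in> support \<longleftrightarrow> t \<in> support"
proof -
  have "t + of_int j \<in> support" if "t \<in> support" for t j
    unfolding support_def
  proof (intro CollectI allI impI)
    fix a b assume "a < t + of_int j \<and> t + of_int j < b"
    then have "h (a + of_int (- j)) < h (b + of_int (- j))" using that by (auto simp: support_def)
    then show "h a < h b" by (simp only: h_per_int)
  qed
  from this[of t j] this[of "t + of_int j" "- j"] show ?thesis by auto
qed

text \<open>The last point at which \<open>h\<close> takes the value \<open>v\<close> works: to the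
  right of it \<open>h\<close> is strictly larger, so no neighbourhood is flat.\<close>

lemma last_preimage_in_support:
  assumes "h a < v" "v < h b"
  obtains s where "a < s" "s < b" "h s = v" "s \<in> support"
proof -
  have ab: "a \<le> b" using assms h_lessD[of a b] by linarith
  define P where "P = {s \<in> {a..b}. h s = v}"
  have hc: "continuous_on {a..b} h" using h_cont continuous_on_subset by blast
  have "P \<noteq> {}" using IVT'[of h a v b] assms ab hc by (auto simp: P_def)
  moreover have "closed P" unfolding P_def
    by (rule continuous_closed_preimage_constant[OF hc closed_atLeastAtMost])
  moreover have "bdd_above P" by (auto simp: P_def)
  ultimately have "Sup P \<in> P" using closed_contains_Sup[of P] by simp
  define s where "s = Sup P"
  have s: "a \<le> s" "s \<le> b" "h s = v" using \<open>Sup P \<in> P\<close> by (auto simp: P_def s_def)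
  have after: "v < h d" if "s < d" for d
  proof (cases "d \<le> b")
    case True
    have "h d \<noteq> v"
    proof
      assume "h d = v"
      then have "d \<in> P" using True that s by (auto simp: P_def)
      then have "d \<le> s" unfolding s_def using \<open>bdd_above P\<close> by (rule cSup_upper)
      then show False using that by simp
    qed
    then show ?thesis using h_le[of s d] that s by simp
  next
    case False
    then show ?thesis using h_le[of b d] assms by simp
  qed
  have "s \<in> support"
    unfolding support_def
  proof (intro CollectI allI impI)
    fix c d assume "c < s \<and> s < d"
    then show "h c < h d" using after[of d] h_le[of c s] s by simp
  qed
  moreover have "a \<noteq> s" "s \<noteq> b" using s assms by auto
  ultimately show ?thesis using s by (intro that[of s]) auto
qed

lemma support_perfect:
  assumes t: "t \<in> support" and "\<epsilon> > 0"
  obtains s where "s \<in> support" "s \<noteq> t" "\<bar>s - t\<bar> < \<epsilon>"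
proof -
  have "h (t - \<epsilon>) < h (t + \<epsilon>)" using assms by (auto simp: support_def)
  then obtain w v where wv: "h (t - \<epsilon>) < w" "w < v" "v < h (t + \<epsilon>)"
    using dense by meson
  \<comment> \<open>Two intermediate values are at hand so that one of them differs from
    \<open>h t\<close>, which keeps its preimage away from \<open>t\<close>.\<close>
  define u where "u = (if v = h t then w else v)"
  have v: "h (t - \<epsilon>) < u" "u < h (t + \<epsilon>)" "u \<noteq> h t" using wv by (auto simp: u_def)
  obtain s where "t - \<epsilon> < s" "s < t + \<epsilon>" "h s = u" "s \<in> support"
    by (rule last_preimage_in_support[OF v(1,2)])
  then show ?thesis using v(3) by (intro that[of s]) auto
qed

lemma support_nonempty: "support \<noteq> {}"
proof -
  have "h 0 < h 0 + 1 / 2" "h 0 + 1 / 2 < h 1" using h_per[of 0] by auto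
  then obtain s where "s \<in> support" by (rule last_preimage_in_support)
  then show ?thesis by blast
qed

text \<open>A flat interval \<open>[c, d]\<close> is carried by some iterate and an integer
  translation into \<open>(a, b)\<close>. There \<open>h\<close> increases strictly, whereas the
  move only adds a constant to \<open>h\<close>.\<close>

lemma support_UNIV_if_interval:
  assumes ab: "a < b" and sub: "{a<..<b} \<subseteq> support"
  shows "support = UNIV"
proof (rule ccontr)
  assume "support \<noteq> UNIV"
  obtain c d where cd: "c < d" "h d \<le> h c"
  proof -
    obtain t c d where "c < t" "t < d" "\<not> h c < h d" using \<open>support \<noteq> UNIV\<close> unfolding support_def by blast
    then show ?thesis by (intro that[of c d]) auto
  qed
  have strict: "h s < h t" if "a < s" "s < t" "t < b" for s t
  proof -
    have "(s + t) / 2 \<in> support" using sub that by (auto simp: subset_iff)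
    then show ?thesis using that unfolding support_def by auto
  qed
  \<comment> \<open>The middle third has ends inside the interval, where strictness of
    \<open>h\<close> is known, so there is an open range of values to aim at.\<close>
  define a' b' where "a' = (2 * a + b) / 3" and "b' = (a + 2 * b) / 3"
  have ab': "a < a'" "a' < b'" "b' < b" using ab by (auto simp: a'_def b'_def)
  then obtain n :: nat and j :: int where nj: "h a' - h c < real n * l + of_int j" "real n * l + of_int j < h b' - h c"
    using irrational_orbit_dense[OF irr, of "h a' - h c" "h b' - h c" 0] strict[of a' b'] by auto
  interpret n: degree_one_lift "\<gamma> ^^ n" by (rule iterate)
  have h: "h ((\<gamma> ^^ n) s + of_int j) = h s + real n * l + of_int j" for s
    by (simp add: h_per_int h_iterate)
  have "h d = h c" using cd h_le[of c d] by simp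
  then have "h a' < h ((\<gamma> ^^ n) c + of_int j)" "h ((\<gamma> ^^ n) d + of_int j) < h b'"
    using nj unfolding h by linarith+
  then have "a' < (\<gamma> ^^ n) c + of_int j" "(\<gamma> ^^ n) d + of_int j < b'" by (simp_all only: h_lessD)
  then have "h ((\<gamma> ^^ n) c + of_int j) < h ((\<gamma> ^^ n) d + of_int j)"
    using ab' cd(1) by (intro strict) auto
  then show False using \<open>h d = h c\<close> by (simp add: h)
qed

lemma degree_one_if_support_UNIV:
  assumes "support = UNIV"
  shows "degree_one_lift (\<lambda>t. h t - h 0)"
proof
  show "strict_mono (\<lambda>t. h t - h 0)"
  proof (rule strict_monoI)
    fix s t :: real assume "s < t"
    moreover have "(s + t) / 2 \<in> support" using assms by simp
    ultimately show "h s - h 0 < h t - h 0" unfolding support_def by auto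
  qed
qed (auto simp: h_per intro!: continuous_intros h_cont)

end

section \<open>The generators of the circle algebra\<close>

text \<open>Continuity on the circle comes from \<open>ei_close\<close>: nearby points have nearby
  representatives after an integer translation, which \<open>a\<close> ignores.\<close>

lemma periodic_factor:
  fixes a :: "real \<Rightarrow> complex"
  assumes a: "continuous_on UNIV a" and per: "\<And>t. a (t + 1) = a t"
  obtains c where "continuous_on circle c" "\<And>t. a t = c (ei t)"
proof -
  have per_nat: "a (t + real n) = a t" for t n
  proof (induction n)
    case (Suc n) then show ?case using per[of "t + real n"] by (simp add: algebra_simps)
  qed simp
  have per_int: "a (t + of_int j) = a t" for t j
  proof (cases j rule: int_cases2)
    case (nonneg n) then show ?thesis using per_nat[of t n] by simp
  next
    case (nonpos n) then show ?thesis using per_nat[of "t - real n" n] by simp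
  qed
  define c where "c z = a (SOME t. z = ei t)" for z
  have c: "c (ei t) = a t" for t
  proof -
    define s where "s = (SOME s. ei t = ei s)"
    have "ei t = ei s" unfolding s_def by (rule someI) (rule refl)
    then obtain j :: int where "t - s = of_int j" unfolding ei_eq_iff by (rule Ints_cases)
    then have "t = s + of_int j" by simp
    then show ?thesis using per_int[of s j] by (simp add: c_def s_def)
  qed
  have "continuous_on circle c"
    unfolding continuous_on_iff
  proof (intro ballI allI impI)
    fix z and \<epsilon> :: real assume z: "z \<in> circle" and "\<epsilon> > 0"
    obtain t where t: "z = ei t" using z by (rule ei_surj)
    obtain d where d: "d > 0" "\<And>s. dist s t < d \<Longrightarrow> dist (a s) (a t) < \<epsilon>"
      using a \<open>\<epsilon> > 0\<close> unfolding continuous_on_iff by (metis UNIV_I)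
    obtain \<delta> where \<delta>: "\<delta> > 0" "\<And>s t. dist (ei s) (ei t) < \<delta> \<Longrightarrow> \<exists>j::int. \<bar>s + of_int j - t\<bar> < d"
      using ei_close[OF d(1)] by blast
    have "dist (c w) (c z) < \<epsilon>" if w: "w \<in> circle" "dist w z < \<delta>" for w
    proof -
      obtain s where s: "w = ei s" using w(1) by (rule ei_surj)
      obtain j :: int where "\<bar>s + of_int j - t\<bar> < d" using \<delta>(2)[of s t] w(2) s t by blast
      then have "dist (a (s + of_int j)) (a t) < \<epsilon>" by (intro d(2)) (simp add: dist_real_def)
      then show ?thesis by (simp add: s t c per_int)
    qed
    then show "\<exists>d>0. \<forall>w\<in>circle. dist w z < d \<longrightarrow> dist (c w) (c z) < \<epsilon>" using \<delta>(1) by blast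
  qed
  then show ?thesis using that c by simp
qed

lemma bounded_borel_periodic:
  assumes "continuous_on UNIV a" "\<And>t. a (t + 1) = a t"
  shows "bounded_borel a"
proof -
  obtain c where c: "continuous_on circle c" "\<And>t. a t = c (ei t)"
    by (rule periodic_factor[OF assms]) blast
  have "compact (c ` circle)" using c(1) by (intro compact_continuous_image) auto
  then have "bounded (c ` circle)" by (rule compact_imp_bounded)
  then have "bounded (range a)" by (rule bounded_subset) (auto simp: c(2))
  then show ?thesis using borel_measurable_continuous_onI[OF assms(1)] by (simp add: bounded_borel_def)
qed

context degree_one_lift begin

lemma iterate_inverse: "(\<gamma> ^^ n) ((inv \<gamma> ^^ n) t) = t" "(inv \<gamma> ^^ n) ((\<gamma> ^^ n) t) = t"
proof -
  show "(\<gamma> ^^ n) ((inv \<gamma> ^^ n) t) = t"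
    by (induction n arbitrary: t) (simp_all add: funpow_swap1)
  show "(inv \<gamma> ^^ n) ((\<gamma> ^^ n) t) = t"
    by (induction n arbitrary: t) (simp_all add: funpow_swap1)
qed

definition generators :: "(L2 \<Rightarrow>\<^sub>L L2) set" where
  "generators = {mult_op (\<lambda>t. indicator {(\<gamma> ^^ n) 0..} t * c (ei t)) |n c. continuous_on circle c}"

text \<open>The n-th conjugate of a periodic multiplier \<open>a\<close> has the symbol
  \<open>c \<circ> ei\<close> cut off at \<open>(\<gamma> ^^ n) 0\<close>, where
  \<open>a = c \<circ> ei \<circ> \<gamma> ^^ n\<close>. Composition with
  \<open>\<gamma> ^^ n\<close> or its inverse preserves periodicity, so every continuous
  \<open>c\<close> occurs at every \<open>n\<close>.\<close>

lemma circle_algebra_eq: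
  assumes \<alpha>: "orientation_preserving_homeo \<alpha>" "circle_lift \<alpha> \<gamma>" and pos: "0 \<le> \<gamma> 0" "\<gamma> 0 < 1"
    and T: "op_given_by (shift_formula \<gamma>) T" "unitary_op T"
  shows "circle_algebra \<alpha> = generated_cstar_algebra generators"
proof -
  define U where "U = compression T"
  have conj: "op_power (adj U) n o\<^sub>L compression (mult_op a) o\<^sub>L op_power U n
      = mult_op (\<lambda>t. indicator {(\<gamma> ^^ n) 0..} t * c (ei t))"
    if a: "continuous_on UNIV a" "\<And>t. a (t + 1) = a t" and c: "\<And>t. a t = c (ei ((\<gamma> ^^ n) t))" for n a c
  proof -
    interpret n: degree_one_lift "\<gamma> ^^ n" by (rule iterate)
    interpret i: degree_one_lift "inv \<gamma> ^^ n" by (rule degree_one_lift.iterate[OF inverse])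
    let ?b = "\<lambda>t. indicator {(\<gamma> ^^ n) 0..} t * c (ei t)"
    have bb: "bounded_borel a" by (rule bounded_borel_periodic[OF a])
    have "bounded_borel (\<lambda>t. a ((inv \<gamma> ^^ n) t))" by (rule bounded_borel_comp[OF bb i.cont])
    then have b: "bounded_borel ?b"
      by (intro bounded_borel_mult bounded_borel_indicator) (auto simp: c iterate_inverse)
    have "(\<lambda>t. indicator {0..} t * a t) = (\<lambda>t. ?b ((\<gamma> ^^ n) t))"
      by (auto simp: c indicator_def)
    then have "compression (mult_op a) = mult_op (\<lambda>t. ?b ((\<gamma> ^^ n) t))"
      by (simp only: compression_mult_op[OF bb])
    moreover have "op_power (adj U) n o\<^sub>L mult_op (\<lambda>t. ?b ((\<gamma> ^^ n) t)) o\<^sub>L op_power U n = mult_op ?b"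
      unfolding U_def by (rule adj_shift_power_conj[OF T cont mono pos(1) b]) simp
    ultimately show ?thesis by simp
  qed
  have "(\<Union>n. {op_power (adj U) n o\<^sub>L S o\<^sub>L op_power U n |S. S \<in> periodic_mult_ops}) = generators"
  proof (intro equalityI subsetI)
    fix R assume "R \<in> (\<Union>n. {op_power (adj U) n o\<^sub>L S o\<^sub>L op_power U n |S. S \<in> periodic_mult_ops})"
    then obtain n a where a: "continuous_on UNIV a" "\<And>t. a (t + 1) = a t"
      and R: "R = op_power (adj U) n o\<^sub>L compression (mult_op a) o\<^sub>L op_power U n"
      by (auto simp: periodic_mult_ops_def)
    interpret i: degree_one_lift "inv \<gamma> ^^ n" by (rule degree_one_lift.iterate[OF inverse])
    obtain c where c: "continuous_on circle c" "\<And>t. a ((inv \<gamma> ^^ n) t) = c (ei t)"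
    proof (rule periodic_factor[of "\<lambda>t. a ((inv \<gamma> ^^ n) t)"])
      show "continuous_on UNIV (\<lambda>t. a ((inv \<gamma> ^^ n) t))"
        by (rule continuous_on_compose2[OF a(1) i.cont]) simp
      show "a ((inv \<gamma> ^^ n) (t + 1)) = a ((inv \<gamma> ^^ n) t)" for t by (simp add: i.per a(2))
    qed blast
    have "a t = c (ei ((\<gamma> ^^ n) t))" for t using c(2)[of "(\<gamma> ^^ n) t"] by (simp add: iterate_inverse)
    from conj[OF a this] show "R \<in> generators" using c(1) unfolding generators_def R by blast
  next
    fix R assume "R \<in> generators"
    then obtain n c where c: "continuous_on circle c"
      and R: "R = mult_op (\<lambda>t. indicator {(\<gamma> ^^ n) 0..} t * c (ei t))"
      by (auto simp: generators_def)
    interpret n: degree_one_lift "\<gamma> ^^ n" by (rule iterate)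
    define a where "a t = c (ei ((\<gamma> ^^ n) t))" for t
    have a: "continuous_on UNIV a" "a (t + 1) = a t" for t
    proof -
      show "continuous_on UNIV a" unfolding a_def
        by (rule continuous_on_compose2[OF c]) (auto intro: continuous_intros n.cont)
      show "a (t + 1) = a t" for t
        unfolding a_def n.per using ei_add_int[of "(\<gamma> ^^ n) t" 1] by simp
    qed
    then have "compression (mult_op a) \<in> periodic_mult_ops" by (auto simp: periodic_mult_ops_def)
    moreover have "R = op_power (adj U) n o\<^sub>L compression (mult_op a) o\<^sub>L op_power U n"
      unfolding R by (rule conj[OF a a_def, symmetric])
    ultimately show "R \<in> (\<Union>n. {op_power (adj U) n o\<^sub>L S o\<^sub>L op_power U n |S. S \<in> periodic_mult_ops})"
      by blast
  qed
  then show ?thesis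
    unfolding circle_algebra_def normal_lift_eq[OF \<alpha> pos] op_of_eq[OF T(1)] Let_def U_def by simp
qed

end

section \<open>Translations as unitary operators\<close>

lemma sq_int_translate:
  assumes "sq_int f" shows "sq_int (\<lambda>t. f (t + \<tau>))"
proof -
  have [measurable]: "f \<in> borel_measurable borel" using assms by (simp add: sq_int_def)
  have "integrable lborel (\<lambda>t. (cmod (f (\<tau> + 1 * t)))\<^sup>2)"
    using assms by (intro lborel_integrable_real_affine[of "\<lambda>t. (cmod (f t))\<^sup>2"]) (auto simp: sq_int_def)
  then show ?thesis by (simp add: sq_int_def add.commute)
qed

text \<open>The weight is 1 and Lebesgue measure is translation invariant. This gives the comparison
  rotations the unitary shift that is assumed for \<alpha>.\<close>

lemma translation_operator_exists:
  "\<exists>T. op_given_by (shift_formula (\<lambda>t. t + \<tau>)) T \<and> unitary_op T"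
proof -
  have shift: "shift_formula (\<lambda>t. t + \<tau>) f = (\<lambda>t. f (t + \<tau>))" for f
  proof -
    have "deriv (\<lambda>t. t + \<tau>) t = 1" for t by (rule DERIV_imp_deriv) (auto intro!: derivative_eq_intros)
    then show ?thesis by (simp add: shift_formula_def[abs_def])
  qed
  have inner: "cinner (abs_L2 (\<lambda>t. f (t + \<tau>))) (abs_L2 (\<lambda>t. g (t + \<tau>))) = cinner (abs_L2 f) (abs_L2 g)"
    if f: "sq_int f" and g: "sq_int g" for f g
    using lborel_integral_real_affine[of 1 "\<lambda>t. f t * cnj (g t)" \<tau>]
    by (simp add: cinner_abs_L2 sq_int_translate f g add.commute)
  have "\<exists>T. op_given_by (\<lambda>f t. f (t + \<tau>)) T"
  proof (rule op_given_by_exists[where B=1])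
    show "AE t in lborel. f (t + \<tau>) = g (t + \<tau>)"
      if "sq_int f" "sq_int g" "AE t in lborel. f t = g t" for f g
    proof -
      have [measurable]: "f \<in> borel_measurable borel" "g \<in> borel_measurable borel"
        using that by (auto simp: sq_int_def)
      have "AE t in lborel. f (\<tau> + 1 * t) = g (\<tau> + 1 * t)"
        by (rule AE_borel_affine[of 1 "\<lambda>t. f t = g t"]) (use that in auto)
      then show ?thesis by (simp add: add.commute)
    qed
    show "norm (abs_L2 (\<lambda>t. f (t + \<tau>))) \<le> 1 * norm (abs_L2 f)" if "sq_int f" for f
      using inner[OF that that] by (simp add: norm_L2_def inner_L2_def)
  qed (auto intro: sq_int_translate)
  then obtain T where T: "op_given_by (\<lambda>f t. f (t + \<tau>)) T" ..
  have app: "T (abs_L2 f) = abs_L2 (\<lambda>t. f (t + \<tau>))" if "sq_int f" for f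
    by (rule op_given_by_apply[OF T that sq_int_translate[OF that]])
  have "unitary_op T"
    unfolding unitary_op_def
  proof (intro conjI allI)
    fix x y
    obtain f g where "sq_int f" "x = abs_L2 f" "sq_int g" "y = abs_L2 g" by (metis abs_L2_cases)
    then show "cinner (T x) (T y) = cinner x y" by (simp add: app inner)
  next
    have "\<exists>x. y = T x" for y
    proof -
      obtain f where f: "sq_int f" "y = abs_L2 f" by (rule abs_L2_cases)
      have "T (abs_L2 (\<lambda>t. f (t + - \<tau>))) = y"
        using app[OF sq_int_translate[OF f(1), of "- \<tau>"]] by (simp add: f(2))
      then show ?thesis by blast
    qed
    then show "surj (blinfun_apply T)" by (auto simp: surj_def)
  qed
  then show ?thesis using T by (auto simp: shift op_given_by_def)
qed

section \<open>The space of characters\<close>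

lemma open_enat_singleton_Times: "open ({enat n} \<times> (UNIV :: complex set))"
  by (intro open_Times open_enat) auto

lemma open_enat_atLeast: "open {enat n..}"
proof -
  have "- {enat n..} = enat ` {..<n}"
  proof (intro set_eqI)
    fix x show "x \<in> - {enat n..} \<longleftrightarrow> x \<in> enat ` {..<n}" by (cases x) auto
  qed
  then have "finite (- {enat n..})" by simp
  then have "open (- (- {enat n..}))" by (intro open_Compl finite_imp_closed)
  then show ?thesis by simp
qed

lemma open_at_infinity:
  fixes V :: "(enat \<times> complex) set"
  assumes "open V" "(\<infinity>, z) \<in> V"
  shows "\<exists>K. \<exists>\<delta>>0. \<forall>N w. enat K \<le> N \<longrightarrow> dist w z < \<delta> \<longrightarrow> (N, w) \<in> V"
proof -
  obtain A B where AB: "open A" "open B" "\<infinity> \<in> A" "z \<in> B" "A \<times> B \<subseteq> V"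
    using assms by (auto elim: open_prod_elim)
  obtain \<delta> where \<delta>: "\<delta> > 0" "\<And>w. dist w z < \<delta> \<Longrightarrow> w \<in> B" using AB(2,4) by (auto simp: open_dist)
  obtain K where K: "{enat K<..} \<subseteq> A" using AB(1,3) by (auto simp: open_enat_iff)
  show ?thesis
  proof (intro exI[of _ "Suc K"] exI[of _ \<delta>] conjI allI impI)
    show "\<delta> > 0" by (rule \<delta>(1))
    fix N w assume "enat (Suc K) \<le> N" "dist w z < \<delta>"
    then have "N \<in> A" "w \<in> B" using K \<delta>(2) by (auto simp: Suc_ile_eq)
    then show "(N, w) \<in> V" using AB(5) by blast
  qed
qed

text \<open>A member of the cover that contains infinity misses only finitely many indices.\<close>

lemma compact_UNIV_enat: "compact (UNIV :: enat set)"
proof (rule compactI)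
  fix C :: "enat set set" assume C: "\<forall>t\<in>C. open t" "UNIV \<subseteq> \<Union>C"
  then obtain A where A: "A \<in> C" "\<infinity> \<in> A" by blast
  then obtain K where K: "{enat K<..} \<subseteq> A" using C(1) by (auto simp: open_enat_iff)
  have "\<forall>n. \<exists>B\<in>C. enat n \<in> B" using C(2) by blast
  then obtain B where B: "\<And>n. B n \<in> C" "\<And>n. enat n \<in> B n" by metis
  have "x \<in> \<Union>(insert A (B ` {..K}))" for x
  proof (cases x)
    case (enat n)
    then show ?thesis using B(2)[of n] K by (cases "n \<le> K") auto
  qed (use A in auto)
  then show "\<exists>D\<subseteq>C. finite D \<and> UNIV \<subseteq> \<Union>D"
    using A B(1) by (intro exI[of _ "insert A (B ` {..K})"]) auto
qed

text \<open>The first inequality makes the arcs nondegenerate, the second keeps each of them shorter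
  than the circle, so that \<open>ei\<close> is injective on it.\<close>

locale marked_lift = degree_one_lift +
  assumes zero_less: "0 < \<gamma> 0" and less_one: "\<gamma> 0 < 1"
begin

abbreviation node :: "nat \<Rightarrow> real" where "node N \<equiv> (\<gamma> ^^ N) 0"

definition arc :: "nat \<Rightarrow> complex set" where
  "arc N = ei ` {node N..node (Suc N)}"

lemma M_arc_eq: "M_arc \<gamma> N = {enat N} \<times> arc N"
  by (simp add: M_arc_def arc_def)

lemma node_less: "node N < node (Suc N)" and node_Suc_less: "node (Suc N) < node N + 1"
proof -
  interpret N: degree_one_lift "\<gamma> ^^ N" by (rule iterate)
  have "node (Suc N) = (\<gamma> ^^ N) (\<gamma> 0)" by (simp add: funpow_swap1)
  moreover have "node N + 1 = (\<gamma> ^^ N) 1" using N.per[of 0] by simp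
  ultimately show "node N < node (Suc N)" "node (Suc N) < node N + 1" using zero_less less_one by simp_all
qed

lemma node_mono: "M \<le> N \<Longrightarrow> node M \<le> node N"
  by (rule lift_Suc_mono_le[of node]) (use node_less less_imp_le in auto)

lemma node_nonneg: "0 \<le> node N" using node_mono[of 0 N] by simp

lemma ei_inj_on_arc: "inj_on ei {node N..node (Suc N)}"
proof (rule inj_onI)
  fix s t assume st: "s \<in> {node N..node (Suc N)}" "t \<in> {node N..node (Suc N)}" "ei s = ei t"
  then obtain j :: int where j: "s - t = of_int j" unfolding ei_eq_iff by (auto elim: Ints_cases)
  have "\<bar>s - t\<bar> < 1" using st(1,2) node_Suc_less[of N] by auto
  then have "j = 0" unfolding j by linarith
  then show "s = t" using j by simp
qed

lemma compact_arc: "compact (arc N)"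
  unfolding arc_def by (intro compact_continuous_image continuous_on_ei continuous_on_id) auto

lemma M_tilde_mem: "(enat N, z) \<in> M_tilde \<gamma> \<longleftrightarrow> z \<in> arc N" "(\<infinity>, z) \<in> M_tilde \<gamma> \<longleftrightarrow> z \<in> circle"
  by (auto simp: M_tilde_def M_infinity_def M_arc_eq)

lemma M_tilde_cases:
  assumes "p \<in> M_tilde \<gamma>"
  obtains (arc) N t where "t \<in> {node N..node (Suc N)}" "p = (enat N, ei t)" | (infinity) t where "p = (\<infinity>, ei t)"
proof -
  obtain x z where p: "p = (x, z)" by (cases p)
  show ?thesis
  proof (cases x)
    case (enat N)
    then show ?thesis using assms p M_tilde_mem(1) arc(1) unfolding arc_def by auto
  next
    case infinity
    then show ?thesis using assms p M_tilde_mem(2) ei_surj infinity(1) that(2) by metis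
  qed
qed

lemma M_tilde_subset: "snd ` M_tilde \<gamma> \<subseteq> circle"
  by (auto simp: arc_def M_tilde_def M_infinity_def M_arc_eq)

text \<open>Membership restricts the circle coordinate one finite level at a time. Each such
  condition is closed because a finite level is open, and the ambient product with the circle is
  compact.\<close>

lemma compact_M_tilde: "compact (M_tilde \<gamma>)"
proof -
  have eq: "M_tilde \<gamma> = (UNIV \<times> circle) \<inter> (\<Inter>N. ((- {enat N}) \<times> UNIV) \<union> (UNIV \<times> arc N))"
    (is "_ = ?C \<inter> (\<Inter>N. ?D N)")
  proof (intro set_eqI)
    fix p :: "enat \<times> complex"
    obtain x z where p: "p = (x, z)" by (cases p)
    show "p \<in> M_tilde \<gamma> \<longleftrightarrow> p \<in> ?C \<inter> (\<Inter>N. ?D N)"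
      unfolding p by (cases x) (auto simp: M_tilde_mem arc_def)
  qed
  have "closed (?D N)" for N
    by (intro closed_Un closed_Times closed_Compl open_enat closed_UNIV compact_imp_closed[OF compact_arc])
  then show ?thesis
    unfolding eq by (intro compact_Int_closed closed_INT compact_Times compact_UNIV_enat) auto
qed

text \<open>Each arc is a relatively open level, so the levels interact only at infinity. A
  neighbourhood of a point there meets arbitrarily late arcs, hence the uniform condition.\<close>

lemma continuous_on_M_tilde:
  fixes F :: "enat \<times> complex \<Rightarrow> complex"
  assumes arcs: "\<And>N. continuous_on (arc N) (\<lambda>z. F (enat N, z))"
    and inf: "continuous_on circle (\<lambda>z. F (\<infinity>, z))"
    and unif: "\<And>\<epsilon>. \<epsilon> > 0 \<Longrightarrow> \<exists>K. \<forall>N\<ge>K. \<forall>z\<in>arc N. dist (F (enat N, z)) (F (\<infinity>, z)) < \<epsilon>"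
  shows "continuous_on (M_tilde \<gamma>) F"
  unfolding continuous_on_topological
proof (intro ballI allI impI)
  fix p B assume p: "p \<in> M_tilde \<gamma>" and B: "open B" "F p \<in> B"
  obtain x z where xz: "p = (x, z)" by (cases p)
  show "\<exists>A. open A \<and> p \<in> A \<and> (\<forall>q\<in>M_tilde \<gamma>. q \<in> A \<longrightarrow> F q \<in> B)"
  proof (cases x)
    case (enat N)
    obtain W where W: "open W" "\<And>w. w \<in> arc N \<Longrightarrow> w \<in> W \<longleftrightarrow> F (enat N, w) \<in> B"
      by (rule continuous_on_open_trace[OF arcs B(1)]) blast
    have "z \<in> arc N" using p xz enat by (simp add: M_tilde_mem)
    then have "p \<in> {enat N} \<times> W" using W(2) B(2) xz enat by auto
    moreover have "F q \<in> B" if "q \<in> M_tilde \<gamma>" "q \<in> {enat N} \<times> W" for q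
      using that W(2) by (auto simp: M_tilde_mem)
    moreover have "open ({enat N} \<times> W)" by (intro open_Times open_enat W)
    ultimately show ?thesis by blast
  next
    case infinity
    obtain \<epsilon> where \<epsilon>: "\<epsilon> > 0" "\<And>w. dist w (F p) < \<epsilon> \<Longrightarrow> w \<in> B" using B by (auto simp: open_dist)
    obtain K where K: "\<And>N z. N \<ge> K \<Longrightarrow> z \<in> arc N \<Longrightarrow> dist (F (enat N, z)) (F (\<infinity>, z)) < \<epsilon> / 2"
      using unif[of "\<epsilon> / 2"] \<epsilon>(1) by auto
    have z: "z \<in> circle" using p xz infinity by (simp add: M_tilde_mem)
    obtain \<delta> where \<delta>: "\<delta> > 0" "\<And>w. w \<in> circle \<Longrightarrow> dist w z < \<delta> \<Longrightarrow> dist (F (\<infinity>, w)) (F (\<infinity>, z)) < \<epsilon> / 2"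
      using inf z \<epsilon>(1) unfolding continuous_on_iff by (meson half_gt_zero)
    have "F q \<in> B" if q: "q \<in> M_tilde \<gamma>" "q \<in> {enat K..} \<times> ball z \<delta>" for q
    proof -
      obtain y w where yw: "q = (y, w)" by (cases q)
      have w: "w \<in> circle" "dist w z < \<delta>" using q M_tilde_subset yw by (auto simp: dist_commute)
      have "dist (F (y, w)) (F (\<infinity>, w)) < \<epsilon> / 2"
      proof (cases y)
        case (enat N) then show ?thesis using q yw K by (auto simp: M_tilde_mem)
      qed (use \<epsilon>(1) in simp)
      then have "dist (F q) (F p) < \<epsilon>"
        using \<delta>(2)[OF w] dist_triangle_half_l[of "F (y, w)" "F (\<infinity>, w)" \<epsilon> "F (\<infinity>, z)"]
        by (simp add: yw xz infinity dist_commute)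
      then show ?thesis by (rule \<epsilon>(2))
    qed
    moreover have "open ({enat K..} \<times> ball z \<delta>)" by (intro open_Times open_enat_atLeast) auto
    moreover have "p \<in> {enat K..} \<times> ball z \<delta>" using \<delta>(1) by (simp add: xz infinity)
    ultimately show ?thesis by blast
  qed
qed

text \<open>\<open>t\<close> may be an endpoint, so the interval is clipped to the arc and may have
  \<open>t\<close> only on its boundary.\<close>

lemma ei_near_open:
  assumes V: "open V" "(enat N, ei t) \<in> V" and t: "t \<in> {node N..node (Suc N)}"
  shows "\<exists>u v. node N \<le> u \<and> u < v \<and> v \<le> node (Suc N) \<and> (\<forall>s. u < s \<longrightarrow> s < v \<longrightarrow> (enat N, ei s) \<in> V)"
proof -
  have "continuous_on UNIV (\<lambda>s. (enat N, ei s))" by (intro continuous_intros)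
  then have "open ((\<lambda>s. (enat N, ei s)) -` V)" using V(1) by (rule open_vimage[rotated])
  then obtain \<epsilon> where \<epsilon>: "\<epsilon> > 0" "\<And>s. dist s t < \<epsilon> \<Longrightarrow> (enat N, ei s) \<in> V"
    using V(2) by (auto simp: open_dist)
  show ?thesis
  proof (rule exI[of _ "max (node N) (t - \<epsilon>)"], rule exI[of _ "min (node (Suc N)) (t + \<epsilon>)"],
      intro conjI allI impI)
    show "max (node N) (t - \<epsilon>) < min (node (Suc N)) (t + \<epsilon>)" using t \<epsilon>(1) node_less[of N] by auto
    show "(enat N, ei s) \<in> V" if "max (node N) (t - \<epsilon>) < s" "s < min (node (Suc N)) (t + \<epsilon>)" for s
      using that by (intro \<epsilon>(2)) (auto simp: dist_real_def)
  qed auto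
qed

end

text \<open>Excludes translation number 0, where the nodes stay below a fixed point. Now the
  intervals between consecutive nodes tile the half line.\<close>

locale unbounded_marked_lift = marked_lift +
  assumes unbounded: "\<exists>N. x < (\<gamma> ^^ N) 0"
begin

text \<open>The tiles are half-open, so \<open>param\<close> passes from a left endpoint to the next
  one and misses only the right endpoints of the arcs.\<close>

definition idx :: "real \<Rightarrow> nat" where "idx t = (LEAST N. t < node (Suc N))"

definition param :: "real \<Rightarrow> enat \<times> complex" where "param t = (enat (idx t), ei t)"

lemma idx_bounds:
  assumes "0 \<le> t" shows "node (idx t) \<le> t" "t < node (Suc (idx t))"
proof -
  obtain N where "t < node N" using unbounded by blast
  then have ex: "\<exists>N. t < node (Suc N)" using node_less[of N] by (intro exI[of _ N]) linarith
  show "t < node (Suc (idx t))" unfolding idx_def by (rule LeastI_ex[OF ex])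
  show "node (idx t) \<le> t"
  proof (cases "idx t")
    case (Suc M)
    then have "\<not> t < node (Suc M)" unfolding idx_def by (intro not_less_Least) simp
    then show ?thesis by (simp add: Suc)
  qed (use assms in simp)
qed

lemma idx_eqI: "node N \<le> t \<Longrightarrow> t < node (Suc N) \<Longrightarrow> idx t = N"
proof -
  assume N: "node N \<le> t" "t < node (Suc N)"
  then have t: "0 \<le> t" using node_nonneg[of N] by linarith
  show ?thesis
  proof (rule antisym)
    show "idx t \<le> N" using N(2) unfolding idx_def by (rule Least_le)
    show "N \<le> idx t"
      using N(1) idx_bounds(2)[OF t] node_mono[of "Suc (idx t)" N] by (intro leI notI) simp
  qed
qed

lemma idx_ge_iff: "0 \<le> t \<Longrightarrow> n \<le> idx t \<longleftrightarrow> node n \<le> t"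
  using idx_bounds[of t] node_mono[of n "idx t"] node_mono[of "Suc (idx t)" n]
  by (cases "n \<le> idx t") auto

lemma param_in: "0 \<le> t \<Longrightarrow> param t \<in> M_tilde \<gamma>"
  using idx_bounds[of t] by (auto simp: param_def M_tilde_mem arc_def intro!: imageI)

text \<open>Measurability is continuity on countably many tiles. Density at a finite level is
  immediate from the tile; at infinity the path has to return near every circle point at late
  levels.\<close>

sublocale half_line_param param "M_tilde \<gamma>"
proof
  show "compact (M_tilde \<gamma>)" by (rule compact_M_tilde)
  show "param t \<in> M_tilde \<gamma>" if "0 \<le> t" for t using that by (rule param_in)
next
  fix F :: "enat \<times> complex \<Rightarrow> complex" assume F: "continuous_on (M_tilde \<gamma>) F"
  let ?S = "\<lambda>N. {node N..<node (Suc N)}"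
  show "half_line_function param F \<in> borel_measurable borel"
  proof (rule measurable_piecewise_restrict[where C = "insert {..<0} (range ?S)"])
    show "space borel \<subseteq> \<Union>(insert {..<0} (range ?S))"
    proof
      fix t :: real
      show "t \<in> \<Union>(insert {..<0} (range ?S))"
        using idx_bounds[of t] by (cases "t < 0") auto
    qed
    fix \<Omega> assume "\<Omega> \<in> insert {..<0} (range ?S)"
    then consider "\<Omega> = {..<0}" | N where "\<Omega> = ?S N" by blast
    then show "half_line_function param F \<in> borel_measurable (restrict_space borel \<Omega>)"
    proof cases
      case 1
      have "continuous_on {..<0} (half_line_function param F)"
        by (rule continuous_on_eq[of _ "\<lambda>t. 0"]) (auto simp: half_line_function_def)
      then show ?thesis unfolding 1 by (rule borel_measurable_continuous_on_restrict)
    next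
      case 2
      have "continuous_on (?S N) (\<lambda>t. F (enat N, ei t))"
      proof (rule continuous_on_compose2[OF F])
        show "continuous_on (?S N) (\<lambda>t. (enat N, ei t))" by (intro continuous_intros)
      qed (auto simp: M_tilde_mem arc_def)
      then have "continuous_on (?S N) (half_line_function param F)"
      proof (rule continuous_on_eq)
        fix t assume t: "t \<in> ?S N"
        then have "0 \<le> t" "idx t = N" using node_nonneg[of N] idx_eqI[of N t] by auto
        then show "F (enat N, ei t) = half_line_function param F t"
          by (simp add: half_line_function_def param_def)
      qed
      then show ?thesis unfolding 2 by (rule borel_measurable_continuous_on_restrict)
    qed
  qed auto
next
  fix V :: "(enat \<times> complex) set" assume V: "open V" "V \<inter> M_tilde \<gamma> \<noteq> {}"
  then obtain p where p: "p \<in> V" "p \<in> M_tilde \<gamma>" by blast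
  have "\<exists>N t. t \<in> {node N..node (Suc N)} \<and> (enat N, ei t) \<in> V"
    using p(2)
  proof (cases rule: M_tilde_cases)
    case (arc N t) then show ?thesis using p(1) by blast
  next
    case (infinity t)
    have inV: "(\<infinity>, ei t) \<in> V" using p(1) infinity by simp
    obtain K \<delta> where K: "\<delta> > 0" "\<forall>N w. enat K \<le> N \<longrightarrow> dist w (ei t) < \<delta> \<longrightarrow> (N, w) \<in> V"
      using open_at_infinity[OF V(1) inV] by (elim exE conjE)
    \<comment> \<open>An integer translation beyond \<open>node K\<close> keeps the circle point and
      raises the level to at least \<open>K\<close>.\<close>
    define s where "s = t + of_int \<lceil>node K - t\<rceil>"
    have s: "node K \<le> s" "ei s = ei t" unfolding s_def by (linarith, simp)
    have "0 \<le> s" using s(1) node_nonneg[of K] by linarith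
    then have "K \<le> idx s" using s(1) by (simp add: idx_ge_iff)
    then have "(enat (idx s), ei s) \<in> V" using K by (simp add: s(2))
    then show ?thesis using idx_bounds[OF \<open>0 \<le> s\<close>] by (intro exI[of _ "idx s"] exI[of _ s]) auto
  qed
  then obtain N t where N: "t \<in> {node N..node (Suc N)}" "(enat N, ei t) \<in> V" by blast
  obtain u v where uv: "node N \<le> u" "u < v" "v \<le> node (Suc N)" "\<forall>s. u < s \<longrightarrow> s < v \<longrightarrow> (enat N, ei s) \<in> V"
    using ei_near_open[OF V(1) N(2,1)] by (elim exE conjE)
  have "param s \<in> V" if s: "u < s" "s < v" for s
  proof -
    have "idx s = N" using s uv(1,3) by (intro idx_eqI) auto
    then show ?thesis using uv(4) s by (simp add: param_def)
  qed
  then show "\<exists>u v. 0 \<le> u \<and> u < v \<and> (\<forall>t. u < t \<and> t < v \<longrightarrow> param t \<in> V)"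
    using uv(1,2) node_nonneg[of N] order_trans by blast
qed

end

text \<open>The symbol of a generator: a cut-off at \<open>node n\<close> on the half line is a
  restriction to the levels from \<open>n\<close> on. The value type is left open because separation
  uses real functions and the algebra complex ones.\<close>

definition level_function :: "nat \<Rightarrow> (complex \<Rightarrow> 'b::zero) \<Rightarrow> enat \<times> complex \<Rightarrow> 'b" where
  "level_function n c p = (if enat n \<le> fst p then c (snd p) else 0)"

text \<open>The levels from \<open>n\<close> on form a clopen set, so the jump between them and the
  lower ones is invisible.\<close>

lemma continuous_on_level_function:
  fixes c :: "complex \<Rightarrow> 'b::{zero,topological_space}"
  assumes "continuous_on circle c" "snd ` X \<subseteq> circle"
  shows "continuous_on X (level_function n c)"
proof -
  let ?A = "{enat n..} \<times> (UNIV :: complex set)"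
  have o: "open ?A" by (intro open_Times open_enat_atLeast) auto
  have c: "closed ?A" by (intro closed_Times closed_atLeast) auto
  have "continuous_on ((X \<inter> ?A) \<union> (X \<inter> - ?A)) (level_function n c)"
  proof (rule continuous_on_Un_local_open)
    show "openin (top_of_set (X \<inter> ?A \<union> X \<inter> - ?A)) (X \<inter> ?A)"
      "openin (top_of_set (X \<inter> ?A \<union> X \<inter> - ?A)) (X \<inter> - ?A)"
      using o c by (auto simp: openin_open open_Compl intro: exI[of _ ?A] exI[of _ "- ?A"])
    have "continuous_on (X \<inter> ?A) (\<lambda>p. c (snd p))"
      by (rule continuous_on_compose2[OF assms(1)]) (use assms(2) in \<open>auto intro: continuous_intros\<close>)
    then show "continuous_on (X \<inter> ?A) (level_function n c)"
      by (rule continuous_on_eq) (auto simp: level_function_def)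
    show "continuous_on (X \<inter> - ?A) (level_function n c)"
      by (rule continuous_on_eq[of _ "\<lambda>p. 0"]) (auto simp: level_function_def)
  qed
  moreover have "(X \<inter> ?A) \<union> (X \<inter> - ?A) = X" by blast
  ultimately show ?thesis by simp
qed

text \<open>Different circle coordinates are told apart by \<open>Re\<close> or \<open>Im\<close> at
  level 0, which cuts nothing off; equal ones by the constant 1 cut off just above the lower of the
  two levels.\<close>

lemma level_function_separates:
  fixes x y :: "enat \<times> complex"
  assumes "x \<noteq> y" "snd ` X \<subseteq> circle"
  shows "\<exists>n (c :: complex \<Rightarrow> real). continuous_on circle c \<and> level_function n c x \<noteq> level_function n c y"
proof (cases "snd x = snd y")
  case False
  then have "Re (snd x) \<noteq> Re (snd y) \<or> Im (snd x) \<noteq> Im (snd y)" by (simp add: complex_eq_iff)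
  then show ?thesis
  proof
    assume "Re (snd x) \<noteq> Re (snd y)"
    then show ?thesis
      by (intro exI[of _ 0] exI[of _ Re]) (auto simp: level_function_def zero_enat_def[symmetric] intro: continuous_intros)
  next
    assume "Im (snd x) \<noteq> Im (snd y)"
    then show ?thesis
      by (intro exI[of _ 0] exI[of _ Im]) (auto simp: level_function_def zero_enat_def[symmetric] intro: continuous_intros)
  qed
next
  case True
  then have "fst x \<noteq> fst y" using assms(1) by (metis prod.collapse)
  then have "\<exists>n. (enat n \<le> fst x) \<noteq> (enat n \<le> fst y)"
  proof (cases rule: linorder_cases[of "fst x" "fst y"])
    case less
    then obtain k where "fst x = enat k" by (cases "fst x") auto
    then show ?thesis using less by (intro exI[of _ "Suc k"]) (auto simp: Suc_ile_eq)
  next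
    case greater
    then obtain k where "fst y = enat k" by (cases "fst y") auto
    then show ?thesis using greater by (intro exI[of _ "Suc k"]) (auto simp: Suc_ile_eq)
  qed simp
  then obtain n where "(enat n \<le> fst x) \<noteq> (enat n \<le> fst y)" by blast
  then show ?thesis by (intro exI[of _ n] exI[of _ "\<lambda>z. 1"]) (auto simp: level_function_def)
qed

context unbounded_marked_lift begin

lemma separates_points_M_tilde: "separates_points (M_tilde \<gamma>)"
  unfolding separates_points_def
proof (intro ballI impI)
  fix x y :: "enat \<times> complex" assume "x \<noteq> y"
  obtain n and c :: "complex \<Rightarrow> real" where c: "continuous_on circle c"
    "level_function n c x \<noteq> level_function n c y"
    using level_function_separates[OF \<open>x \<noteq> y\<close> M_tilde_subset] by (elim exE conjE)
  have "continuous_on (M_tilde \<gamma>) (\<lambda>p. complex_of_real (level_function n c p))"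
    by (intro continuous_on_of_real continuous_on_level_function c M_tilde_subset)
  then show "\<exists>F :: _ \<Rightarrow> complex. continuous_on (M_tilde \<gamma>) F \<and> F x \<noteq> F y"
    using c(2) by (intro exI[of _ "\<lambda>p. complex_of_real (level_function n c p)"]) auto
qed

lemma generators_eq: "generators = {M (level_function n c) |n c. continuous_on circle c}"
proof -
  have "half_line_function param (level_function n c) = (\<lambda>t. indicator {node n..} t * c (ei t))" for n and c :: "complex \<Rightarrow> complex"
  proof
    fix t show "half_line_function param (level_function n c) t = indicator {node n..} t * c (ei t)"
      using idx_ge_iff[of t n] node_nonneg[of n]
      by (auto simp: half_line_function_def level_function_def param_def indicator_def)
  qed
  then show ?thesis by (simp add: generators_def)
qed

lemma generated_eq_function_algebra: "generated_cstar_algebra generators = function_algebra param (M_tilde \<gamma>)"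
proof (rule function_algebra_eq_generated)
  show "generators \<subseteq> function_algebra param (M_tilde \<gamma>)"
    unfolding generators_eq using continuous_on_level_function[OF _ M_tilde_subset]
    by (auto intro!: function_algebraI)
  show "M (\<lambda>x. c) \<in> generators" for c
  proof -
    have "(\<lambda>x. c) = level_function 0 (\<lambda>z. c)" by (auto simp: level_function_def zero_enat_def[symmetric])
    then show ?thesis unfolding generators_eq by (intro CollectI exI[of _ 0] exI[of _ "\<lambda>z. c"]) auto
  qed
  fix x y :: "enat \<times> complex" assume "x \<noteq> y"
  obtain n and c :: "complex \<Rightarrow> real" where c: "continuous_on circle c"
    "level_function n c x \<noteq> level_function n c y"
    using level_function_separates[OF \<open>x \<noteq> y\<close> M_tilde_subset] by (elim exE conjE)
  have "(\<lambda>p. complex_of_real (level_function n c p)) = level_function n (\<lambda>z. complex_of_real (c z))"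
    by (auto simp: level_function_def)
  then have "M (\<lambda>p. complex_of_real (level_function n c p)) \<in> generators"
    unfolding generators_eq using continuous_on_of_real[OF c(1)] by auto
  then show "\<exists>F :: _ \<Rightarrow> real. continuous_on (M_tilde \<gamma>) F \<and> M (\<lambda>x. of_real (F x)) \<in> generators \<and> F x \<noteq> F y"
    using c(2) continuous_on_level_function[OF c(1) M_tilde_subset] by (intro exI conjI)
qed

end

section \<open>Limits of endpoints\<close>

lemma circle_ex_ei: "z \<in> circle \<Longrightarrow> \<exists>t. z = ei t"
  by (rule ei_surj) blast+

lemma derived_set_ofD:
  "x \<in> X derived_set_of S \<Longrightarrow> openin X T \<Longrightarrow> x \<in> T \<Longrightarrow> \<exists>y. y \<noteq> x \<and> y \<in> S \<and> y \<in> T"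
  by (auto simp: in_derived_set_of)

lemma orbit_limit_dist:
  assumes "orbit_limit x t" "\<delta> > 0"
  shows "\<exists>n\<ge>N. dist (ei (x n)) (ei t) < \<delta>"
proof -
  have "\<delta> / (2 * pi) > 0" using assms(2) by simp
  then obtain n j where nj: "n \<ge> N" "\<bar>x n + of_int j - t\<bar> < \<delta> / (2 * pi)"
    using assms(1) unfolding orbit_limit_def by blast
  have "dist (ei (x n)) (ei t) \<le> 2 * pi * \<bar>x n + of_int j - t\<bar>"
    using dist_ei_le[of "x n + of_int j" t] by simp
  also have "\<dots> < \<delta>" using nj(2) by (simp add: field_simps)
  finally show ?thesis using nj(1) by blast
qed

lemma orbit_limitI:
  assumes "\<And>\<delta> N. \<delta> > 0 \<Longrightarrow> \<exists>n\<ge>N. dist (ei (x n)) (ei t) < \<delta>"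
  shows "orbit_limit x t"
  unfolding orbit_limit_def
proof (intro allI impI)
  fix \<epsilon> :: real and N assume "\<epsilon> > 0"
  then obtain \<delta> where \<delta>: "\<delta> > 0" "\<And>s t. dist (ei s) (ei t) < \<delta> \<Longrightarrow> \<exists>j::int. \<bar>s + of_int j - t\<bar> < \<epsilon>"
    using ei_close by blast
  obtain n where "n \<ge> N" "dist (ei (x n)) (ei t) < \<delta>" using assms[OF \<delta>(1)] by blast
  then show "\<exists>n\<ge>N. \<exists>j::int. \<bar>x n + of_int j - t\<bar> < \<epsilon>" using \<delta>(2) by blast
qed

text \<open>By injectivity modulo integers the limit point itself is hit by at most one index, so
  accumulation of indices and accumulation of points agree.\<close>

lemma islimpt_range_ei_iff:
  assumes inj: "\<And>m n. x m - x n \<in> \<int> \<Longrightarrow> m = n"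
  shows "ei t islimpt range (\<lambda>n. ei (x n)) \<longleftrightarrow> orbit_limit x t"
proof
  assume lim: "ei t islimpt range (\<lambda>n. ei (x n))"
  show "orbit_limit x t"
  proof (rule orbit_limitI)
    fix \<delta> :: real and N assume "\<delta> > 0"
    then have inf: "infinite (range (\<lambda>n. ei (x n)) \<inter> ball (ei t) \<delta>)"
      using lim by (simp add: islimpt_eq_infinite_ball)
    show "\<exists>n\<ge>N. dist (ei (x n)) (ei t) < \<delta>"
    proof (rule ccontr)
      assume "\<not> ?thesis"
      then have "range (\<lambda>n. ei (x n)) \<inter> ball (ei t) \<delta> \<subseteq> (\<lambda>n. ei (x n)) ` {..<N}"
        by (auto simp: dist_commute not_le)
      then show False using inf finite_subset by blast
    qed
  qed
next
  assume lim: "orbit_limit x t"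
  show "ei t islimpt range (\<lambda>n. ei (x n))"
    unfolding islimpt_approachable
  proof (intro allI impI)
    fix \<delta> :: real assume "\<delta> > 0"
    obtain N where N: "\<And>n. n \<ge> N \<Longrightarrow> ei (x n) \<noteq> ei t"
    proof (cases "\<exists>m. ei (x m) = ei t")
      case True
      then obtain m where m: "ei (x m) = ei t" by blast
      have "ei (x n) \<noteq> ei t" if "n \<ge> Suc m" for n
        using inj[of n m] that m ei_eq_iff[of "x n" "x m"] by auto
      then show ?thesis by (rule that)
    qed (use that in blast)
    obtain n where "n \<ge> N" "dist (ei (x n)) (ei t) < \<delta>" using orbit_limit_dist[OF lim \<open>\<delta> > 0\<close>] by blast
    then show "\<exists>y\<in>range (\<lambda>n. ei (x n)). y \<noteq> ei t \<and> dist y (ei t) < \<delta>" using N by blast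
  qed
qed

context marked_lift begin

text \<open>A finite level is open and contains just two endpoints, so nothing accumulates there. At
  infinity left and right endpoints run through the same sequence of nodes, shifted by one
  level.\<close>

lemma endpoint_limits_eq: "endpoint_limits \<gamma> = {\<infinity>} \<times> ei ` {t. orbit_limit node t}"
proof (intro equalityI subsetI)
  fix p assume p: "p \<in> endpoint_limits \<gamma>"
  then have pM: "p \<in> M_tilde \<gamma>" by (simp add: endpoint_limits_def in_derived_set_of)
  have near: "\<exists>y\<in>M_endpoints \<gamma>. y \<noteq> p \<and> y \<in> V" if V: "open V" "p \<in> V" for V
  proof -
    have "openin (top_of_set (M_tilde \<gamma>)) (M_tilde \<gamma> \<inter> V)" using V(1) by (simp add: openin_open_Int)
    moreover have "p \<in> M_tilde \<gamma> \<inter> V" using pM V(2) by simp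
    ultimately show ?thesis using derived_set_ofD[OF p[unfolded endpoint_limits_def]] by blast
  qed
  from pM show "p \<in> {\<infinity>} \<times> ei ` {t. orbit_limit node t}"
  proof (cases rule: M_tilde_cases)
    case (arc N t)
    let ?E = "{ei (node N), ei (node (Suc N))} - {ei t}"
    have "open ({enat N} \<times> - ?E)" by (intro open_Times open_enat open_Compl finite_imp_closed) auto
    moreover have "p \<in> {enat N} \<times> - ?E" using arc by simp
    ultimately obtain y where "y \<in> M_endpoints \<gamma>" "y \<noteq> p" "y \<in> {enat N} \<times> - ?E"
      using near by blast
    then show ?thesis using arc(2) by (auto simp: M_endpoints_def)
  next
    case (infinity t)
    have "orbit_limit node t"
    proof (rule orbit_limitI)
      fix \<delta> :: real and N assume "\<delta> > 0"
      have "open ({enat N..} \<times> ball (ei t) \<delta>)" by (intro open_Times open_enat_atLeast) auto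
      moreover have "p \<in> {enat N..} \<times> ball (ei t) \<delta>" using infinity \<open>\<delta> > 0\<close> by simp
      ultimately obtain y where y: "y \<in> M_endpoints \<gamma>" "y \<in> {enat N..} \<times> ball (ei t) \<delta>"
        using near by blast
      from y(1) obtain L where "y = (enat L, ei (node L)) \<or> y = (enat L, ei (node (Suc L)))"
        unfolding M_endpoints_def by blast
      then show "\<exists>n\<ge>N. dist (ei (node n)) (ei t) < \<delta>"
      proof
        assume "y = (enat L, ei (node L))"
        then show ?thesis using y(2) by (intro exI[of _ L]) (simp add: dist_commute)
      next
        assume "y = (enat L, ei (node (Suc L)))"
        then show ?thesis using y(2) by (intro exI[of _ "Suc L"]) (simp add: dist_commute)
      qed
    qed
    then show ?thesis using infinity by auto
  qed
next
  fix p :: "enat \<times> complex" assume "p \<in> {\<infinity>} \<times> ei ` {t. orbit_limit node t}"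
  then obtain t where t: "p = (\<infinity>, ei t)" "orbit_limit node t" by auto
  show "p \<in> endpoint_limits \<gamma>"
    unfolding endpoint_limits_def in_derived_set_of
  proof (intro conjI allI impI)
    show "p \<in> topspace (top_of_set (M_tilde \<gamma>))" by (simp add: t(1) M_tilde_mem)
    fix T assume T: "p \<in> T \<and> openin (top_of_set (M_tilde \<gamma>)) T"
    then obtain V where V: "open V" "T = M_tilde \<gamma> \<inter> V" by (auto simp: openin_open)
    have inV: "(\<infinity>, ei t) \<in> V" using T V(2) t(1) by blast
    obtain K \<delta> where K: "\<delta> > 0" "\<forall>N w. enat K \<le> N \<longrightarrow> dist w (ei t) < \<delta> \<longrightarrow> (N, w) \<in> V"
      using open_at_infinity[OF V(1) inV] by (elim exE conjE)
    obtain n where n: "n \<ge> K" "dist (ei (node n)) (ei t) < \<delta>" using orbit_limit_dist[OF t(2) K(1)] by blast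
    have "(enat n, ei (node n)) \<in> M_tilde \<gamma>" using node_less[of n] by (auto simp: M_tilde_mem arc_def)
    moreover have "(enat n, ei (node n)) \<in> V" using K(2) n by simp
    moreover have "(enat n, ei (node n)) \<in> M_endpoints \<gamma>" unfolding M_endpoints_def by blast
    ultimately show "\<exists>y. y \<noteq> p \<and> y \<in> M_endpoints \<gamma> \<and> y \<in> T"
      unfolding V(2) t(1) by (intro exI[of _ "(enat n, ei (node n))"]) simp
  qed
qed

lemma endpoint_limits_subset: "endpoint_limits \<gamma> \<subseteq> M_infinity"
  by (auto simp: endpoint_limits_eq M_infinity_def)

text \<open>The nodes approach a periodic orbit, which projects to at most \<open>n\<close> points
  and returns to each of them. The linearizing map \<open>h\<close> turns a coincidence of two of
  them into divisibility of \<open>(r - s) * m\<close> by \<open>n\<close>, which coprimality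
  excludes. The integer \<open>m\<close> accommodates translation number 1.\<close>

lemma card_endpoint_limits:
  assumes n: "n > 0" and l: "transl = of_int m / real n" and cop: "coprime m (int n)"
  shows "card (endpoint_limits \<gamma>) = n"
proof -
  obtain p where p: "(\<gamma> ^^ n) p = p + of_int m" and lim: "(\<lambda>N. node N - (\<gamma> ^^ N) p) \<longlonglongrightarrow> 0"
    by (rule asymptotic_periodic_point[OF n l])
  obtain h where h: "degree_one_lift h" "\<And>N. h ((\<gamma> ^^ N) p) = real N * (of_int m / real n)"
    using periodic_linearization[OF n p] by blast
  interpret h: degree_one_lift h by (rule h(1))
  have iter: "(\<gamma> ^^ (r + n * k)) p = (\<gamma> ^^ r) p + of_int (int k * m)" for r k
  proof -
    interpret r: degree_one_lift "\<gamma> ^^ r" by (rule iterate)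
    have "(\<gamma> ^^ (r + n * k)) p = (\<gamma> ^^ r) ((\<gamma> ^^ (n * k)) p)" by (simp only: funpow_add o_apply)
    then show ?thesis by (simp only: periodic_iterate[OF p] r.per_int)
  qed
  let ?Z = "(\<lambda>r. ei ((\<gamma> ^^ r) p)) ` {..<n}"
  have Z: "ei ((\<gamma> ^^ N) p) \<in> ?Z" for N
  proof -
    have "ei ((\<gamma> ^^ (N mod n + n * (N div n))) p) = ei ((\<gamma> ^^ (N mod n)) p)"
      unfolding iter by (rule ei_add_int)
    then show ?thesis using n by (intro image_eqI[of _ _ "N mod n"]) auto
  qed
  have close: "\<exists>K. \<forall>N\<ge>K. \<bar>node N - (\<gamma> ^^ N) p\<bar> < \<epsilon>" if "\<epsilon> > 0" for \<epsilon>
    using LIMSEQ_D[OF lim that] by simp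
  have "ei ` {t. orbit_limit node t} = ?Z"
  proof (intro equalityI subsetI)
    fix z assume "z \<in> ?Z"
    then obtain r where r: "r < n" "z = ei ((\<gamma> ^^ r) p)" by blast
    have "orbit_limit node ((\<gamma> ^^ r) p)"
      unfolding orbit_limit_def
    proof (intro allI impI)
      fix \<epsilon> :: real and N assume "\<epsilon> > 0"
      then obtain K where K: "\<And>N. N \<ge> K \<Longrightarrow> \<bar>node N - (\<gamma> ^^ N) p\<bar> < \<epsilon>" using close by blast
      let ?k = "max K N"
      let ?M = "r + n * ?k"
      have "1 * ?k \<le> n * ?k" using n by (intro mult_le_mono1) simp
      then have ge: "?M \<ge> ?k" by linarith
      have "\<bar>node ?M + of_int (- (int ?k * m)) - (\<gamma> ^^ r) p\<bar> < \<epsilon>"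
        using K[of ?M] ge unfolding iter by (simp add: algebra_simps)
      then show "\<exists>n\<ge>N. \<exists>j::int. \<bar>node n + of_int j - (\<gamma> ^^ r) p\<bar> < \<epsilon>"
        using ge by (intro exI[of _ ?M] conjI exI[of _ "- (int ?k * m)"]) auto
    qed
    then show "z \<in> ei ` {t. orbit_limit node t}" using r(2) by blast
  next
    fix z assume "z \<in> ei ` {t. orbit_limit node t}"
    then obtain t where t: "orbit_limit node t" "z = ei t" by blast
    show "z \<in> ?Z"
    proof (rule ccontr)
      assume no: "z \<notin> ?Z"
      have "closed ?Z" by (intro finite_imp_closed) simp
      then obtain d where d: "d > 0" "\<And>w. w \<in> ?Z \<Longrightarrow> d \<le> dist z w"
        using no separate_point_closed[of ?Z z] by blast
      \<comment> \<open>After the factor \<open>2 * pi\<close> this contributes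
        \<open>d / 2\<close>; the other half is the distance of the node from
        \<open>z\<close>.\<close>
      have "d / (4 * pi) > 0" using d(1) by simp
      then obtain K where K: "\<And>N. N \<ge> K \<Longrightarrow> \<bar>node N - (\<gamma> ^^ N) p\<bar> < d / (4 * pi)" using close by blast
      have "d / 2 > 0" using d(1) by simp
      then obtain N where N: "N \<ge> K" "dist (ei (node N)) (ei t) < d / 2" using orbit_limit_dist[OF t(1)] by blast
      have "dist (ei (node N)) (ei ((\<gamma> ^^ N) p)) \<le> 2 * pi * \<bar>node N - (\<gamma> ^^ N) p\<bar>" by (rule dist_ei_le)
      also have "\<dots> < d / 2" using K[OF N(1)] by (simp add: field_simps)
      finally have "dist z (ei ((\<gamma> ^^ N) p)) < d"
        using N(2) dist_triangle_half_r[of "ei (node N)" z d "ei ((\<gamma> ^^ N) p)"] t(2) by simp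
      then show False using d(2)[OF Z[of N]] by simp
    qed
  qed
  moreover have "inj_on (\<lambda>r. ei ((\<gamma> ^^ r) p)) {..<n}"
  proof (rule inj_onI)
    fix r s assume rs: "r \<in> {..<n}" "s \<in> {..<n}" "ei ((\<gamma> ^^ r) p) = ei ((\<gamma> ^^ s) p)"
    then obtain j :: int where "(\<gamma> ^^ r) p - (\<gamma> ^^ s) p = of_int j" unfolding ei_eq_iff by (auto elim: Ints_cases)
    then have "(\<gamma> ^^ r) p = (\<gamma> ^^ s) p + of_int j" by simp
    then have "h ((\<gamma> ^^ r) p) = h ((\<gamma> ^^ s) p) + of_int j" by (simp only: h.per_int)
    then have "real r * of_int m = real s * of_int m + of_int j * real n"
      unfolding h(2) using n by (simp add: field_simps)
    then have "of_int ((int r - int s) * m) = (of_int (j * int n) :: real)" by (simp add: algebra_simps)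
    then have "(int r - int s) * m = j * int n" by (simp only: of_int_eq_iff)
    then have "int n dvd (int r - int s) * m" by simp
    then have dvd: "int n dvd int r - int s" using cop by (simp add: coprime_commute coprime_dvd_mult_left_iff)
    show "r = s"
    proof (rule ccontr)
      assume "r \<noteq> s"
      then have "int n \<le> \<bar>int r - int s\<bar>" using dvd_imp_le_int[OF _ dvd] by simp
      then show False using rs(1,2) by auto
    qed
  qed
  ultimately show ?thesis
    by (simp add: endpoint_limits_eq card_cartesian_product card_image)
qed

end

section \<open>Endpoint limits and transitivity for irrational translation number\<close>

locale marked_semiconjugacy = marked_lift + semiconjugacy
begin

lemma endpoint_limits_support: "endpoint_limits \<gamma> = {\<infinity>} \<times> ei ` support"
proof -
  have "Collect (orbit_limit node) = support"
    using orbit_limit_iff[OF h_iterate irr] by (intro set_eqI) simp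
  then show ?thesis unfolding endpoint_limits_eq by simp
qed

lemma ei_in_support: "ei t \<in> ei ` support \<longleftrightarrow> t \<in> support"
proof
  assume "ei t \<in> ei ` support"
  then obtain s where s: "s \<in> support" "ei t = ei s" by blast
  then obtain j :: int where "t - s = of_int j" unfolding ei_eq_iff by (auto elim: Ints_cases)
  then have "t = s + of_int j" by simp
  then show "t \<in> support" using s(1) by (simp only: support_per_int)
qed simp

lemma ei_support_eq_circle: "ei ` support = circle \<longleftrightarrow> support = UNIV"
proof
  assume "ei ` support = circle"
  then have "ei t \<in> ei ` support" for t by simp
  then show "support = UNIV" unfolding ei_in_support by blast
next
  assume "support = UNIV"
  then have "z \<in> ei ` support" if "z \<in> circle" for z using circle_ex_ei[OF that] by blast
  then show "ei ` support = circle" using ei_in_circle by blast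
qed

text \<open>Along both halves of an orbit the values of \<open>h\<close> form an arithmetic
  progression of irrational step, \<open>l\<close> forwards and \<open>- l\<close> backwards. Each
  half therefore accumulates exactly on the projected support, whatever the starting point.\<close>

lemma topologically_transitive_iff:
  assumes \<alpha>: "orientation_preserving_homeo \<alpha>" "circle_lift \<alpha> \<gamma>"
  shows "topologically_transitive \<alpha> \<longleftrightarrow> support = UNIV"
proof -
  interpret i: degree_one_lift "inv \<gamma>" by (rule inverse)
  have lift: "\<alpha> (ei t) = ei (\<gamma> t)" for t using \<alpha>(2) by (simp add: circle_lift_def)
  have fwd: "(\<alpha> ^^ n) (ei s) = ei ((\<gamma> ^^ n) s)" for n s by (induction n) (simp_all add: lift)
  obtain \<beta> where "homeomorphism circle circle \<alpha> \<beta>" using \<alpha>(1) by (auto simp: orientation_preserving_homeo_def)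
  then have "inj_on \<alpha> circle" by (metis homeomorphism_def inj_on_inverseI)
  then have inv: "inv_into circle \<alpha> (ei t) = ei (inv \<gamma> t)" for t
    using inv_into_f_f[of \<alpha> circle "ei (inv \<gamma> t)"] by (simp add: lift)
  have bwd: "(inv_into circle \<alpha> ^^ n) (ei s) = ei ((inv \<gamma> ^^ n) s)" for n s
    by (induction n) (simp_all add: inv)
  have h_bwd: "h ((inv \<gamma> ^^ n) s) = h s + real n * (- l)" for n s
    using h_iterate[of n "(inv \<gamma> ^^ n) s"] by (simp add: iterate_inverse)
  have irr': "- l \<notin> \<rat>" using irr Rats_minus_iff by blast
  have "ei t islimpt full_orbit \<alpha> (ei s) \<longleftrightarrow> t \<in> support" for s t
  proof -
    have "ei t islimpt range (\<lambda>n. ei ((\<gamma> ^^ n) s)) \<longleftrightarrow> orbit_limit (\<lambda>n. (\<gamma> ^^ n) s) t"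
      by (rule islimpt_range_ei_iff) (rule orbit_injective[OF h_iterate irr])
    moreover have "orbit_limit (\<lambda>n. (\<gamma> ^^ n) s) t \<longleftrightarrow> t \<in> support"
      by (rule orbit_limit_iff[OF h_iterate irr])
    moreover have "ei t islimpt range (\<lambda>n. ei ((inv \<gamma> ^^ n) s)) \<longleftrightarrow> orbit_limit (\<lambda>n. (inv \<gamma> ^^ n) s) t"
      by (rule islimpt_range_ei_iff) (rule orbit_injective[OF h_bwd irr'])
    moreover have "orbit_limit (\<lambda>n. (inv \<gamma> ^^ n) s) t \<longleftrightarrow> t \<in> support"
      by (rule orbit_limit_iff[OF h_bwd irr'])
    ultimately show ?thesis unfolding full_orbit_def fwd bwd islimpt_Un by simp
  qed
  moreover have "y \<in> circle" if y: "y islimpt full_orbit \<alpha> (ei s)" for y s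
  proof -
    have "full_orbit \<alpha> (ei s) \<subseteq> circle" unfolding full_orbit_def fwd bwd by auto
    then have "y islimpt circle" using y islimpt_subset by blast
    then show ?thesis using closed_limpt closed_sphere by blast
  qed
  ultimately have lim_iff: "ei t islimpt full_orbit \<alpha> (ei s) \<longleftrightarrow> t \<in> support"
    and lim_in: "y islimpt full_orbit \<alpha> (ei s) \<Longrightarrow> y \<in> circle" for s t y
    by blast+
  have eq: "{y. y islimpt full_orbit \<alpha> (ei s)} = ei ` support" for s
  proof (intro equalityI subsetI)
    fix y assume y: "y \<in> {y. y islimpt full_orbit \<alpha> (ei s)}"
    then have "y \<in> circle" by (intro lim_in) simp
    then obtain t where "y = ei t" by (rule ei_surj)
    then show "y \<in> ei ` support" using y lim_iff by simp
  next
    fix y assume "y \<in> ei ` support"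
    then show "y \<in> {y. y islimpt full_orbit \<alpha> (ei s)}" using lim_iff by blast
  qed
  have "{y. y islimpt full_orbit \<alpha> x} = ei ` support" if "x \<in> circle" for x
    using eq circle_ex_ei[OF that] by blast
  then have "topologically_transitive \<alpha> \<longleftrightarrow> ei ` support = circle"
    unfolding topologically_transitive_def using ei_in_circle by blast
  then show ?thesis by (simp only: ei_support_eq_circle)
qed

lemma infinity_point_nbhd:
  assumes T: "openin (top_of_set M_infinity) T" and t: "(\<infinity>, ei t) \<in> T"
  shows "\<exists>\<epsilon>>0. \<forall>s. \<bar>s - t\<bar> < \<epsilon> \<longrightarrow> (\<infinity>, ei s) \<in> T"
proof -
  obtain V where V: "open V" "T = M_infinity \<inter> V" using T by (auto simp: openin_open)
  have "continuous_on UNIV (\<lambda>s. (\<infinity> :: enat, ei s))" by (intro continuous_intros)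
  then have "open ((\<lambda>s. (\<infinity>, ei s)) -` V)" using V(1) by (rule open_vimage[rotated])
  moreover have "t \<in> (\<lambda>s. (\<infinity>, ei s)) -` V" using t V(2) by simp
  ultimately obtain \<epsilon> where "\<epsilon> > 0" "\<And>s. dist s t < \<epsilon> \<Longrightarrow> (\<infinity>, ei s) \<in> V"
    unfolding open_dist by blast
  then show ?thesis unfolding V(2) by (auto simp: M_infinity_def dist_real_def)
qed

text \<open>One inclusion is closedness of the support, transferred through \<open>ei_close\<close>;
  the other is the absence of isolated points in it.\<close>

lemma endpoint_limits_perfect: "perfect_in (top_of_set M_infinity) (endpoint_limits \<gamma>)"
  unfolding perfect_in_def
proof (intro conjI equalityI subsetI)
  show "endpoint_limits \<gamma> \<noteq> {}" using support_nonempty by (simp add: endpoint_limits_support)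
next
  fix p assume p: "p \<in> top_of_set M_infinity derived_set_of endpoint_limits \<gamma>"
  then have "p \<in> M_infinity" by (simp add: in_derived_set_of)
  then obtain z where z: "p = (\<infinity>, z)" "z \<in> circle" by (auto simp: M_infinity_def)
  then obtain t where t: "p = (\<infinity>, ei t)" using circle_ex_ei[OF z(2)] by blast
  have "t \<in> support"
    unfolding support_def
  proof (intro CollectI allI impI)
    fix a b assume ab: "a < t \<and> t < b"
    have "min (t - a) (b - t) > 0" using ab by simp
    then obtain \<delta> where \<delta>: "\<delta> > 0"
      "\<And>s t'. dist (ei s) (ei t') < \<delta> \<Longrightarrow> \<exists>j::int. \<bar>s + of_int j - t'\<bar> < min (t - a) (b - t)"
      using ei_close by blast
    let ?T = "M_infinity \<inter> (UNIV \<times> ball (ei t) \<delta>)"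
    have "open ((UNIV :: enat set) \<times> ball (ei t) \<delta>)" by (intro open_Times) auto
    then have "openin (top_of_set M_infinity) ?T" by (simp add: openin_open_Int)
    moreover have "p \<in> ?T" using \<delta>(1) by (simp add: t M_infinity_def)
    ultimately obtain y where y: "y \<in> endpoint_limits \<gamma>" "y \<in> ?T"
      using derived_set_ofD[OF p] by blast
    then obtain s where s: "s \<in> support" "y = (\<infinity>, ei s)" by (auto simp: endpoint_limits_support)
    have "dist (ei s) (ei t) < \<delta>" using y(2) s(2) by (simp add: dist_commute)
    then obtain j :: int where j: "\<bar>s + of_int j - t\<bar> < min (t - a) (b - t)" using \<delta>(2) by blast
    then have "a < s + of_int j" "s + of_int j < b" by auto
    moreover have "s + of_int j \<in> support" using s(1) by (simp only: support_per_int)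
    ultimately show "h a < h b" unfolding support_def by blast
  qed
  then show "p \<in> endpoint_limits \<gamma>" by (simp add: t endpoint_limits_support)
next
  fix p assume "p \<in> endpoint_limits \<gamma>"
  then obtain t where t: "t \<in> support" "p = (\<infinity>, ei t)" by (auto simp: endpoint_limits_support)
  show "p \<in> top_of_set M_infinity derived_set_of endpoint_limits \<gamma>"
    unfolding in_derived_set_of
  proof (intro conjI allI impI)
    show "p \<in> topspace (top_of_set M_infinity)" by (simp add: t(2) M_infinity_def)
    fix T assume "p \<in> T \<and> openin (top_of_set M_infinity) T"
    then obtain \<epsilon> where \<epsilon>: "\<epsilon> > 0" "\<And>s. \<bar>s - t\<bar> < \<epsilon> \<Longrightarrow> (\<infinity>, ei s) \<in> T"
      using infinity_point_nbhd[of T t] t(2) by blast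
    \<comment> \<open>Distinct reals at distance below 1 have distinct images on the circle.\<close>
    have "min \<epsilon> 1 > 0" using \<epsilon>(1) by simp
    from support_perfect[OF t(1) this]
    obtain s where s: "s \<in> support" "s \<noteq> t" "\<bar>s - t\<bar> < min \<epsilon> 1" .
    have "ei s \<noteq> ei t"
    proof
      assume "ei s = ei t"
      then obtain j :: int where j: "s - t = of_int j" unfolding ei_eq_iff by (auto elim: Ints_cases)
      then have "\<bar>real_of_int j\<bar> < 1" using s(3) by simp
      then have "j = 0" by linarith
      then show False using j s(2) by simp
    qed
    moreover have "(\<infinity>, ei s) \<in> endpoint_limits \<gamma>" using s(1) by (simp add: endpoint_limits_support)
    moreover have "(\<infinity>, ei s) \<in> T" using \<epsilon>(2) s(3) by simp
    ultimately show "\<exists>y. y \<noteq> p \<and> y \<in> endpoint_limits \<gamma> \<and> y \<in> T"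
      unfolding t(2) by (intro exI[of _ "(\<infinity>, ei s)"]) simp
  qed
qed

lemma infinite_endpoint_limits: "infinite (endpoint_limits \<gamma>)"
proof
  assume "finite (endpoint_limits \<gamma>)"
  note fin = this
  obtain p where p: "p \<in> endpoint_limits \<gamma>" using endpoint_limits_perfect unfolding perfect_in_def by blast
  let ?T = "M_infinity \<inter> - (endpoint_limits \<gamma> - {p})"
  have "open (- (endpoint_limits \<gamma> - {p}))" using fin by (intro open_Compl finite_imp_closed) simp
  then have T: "openin (top_of_set M_infinity) ?T" by (simp add: openin_open_Int)
  have "p \<in> top_of_set M_infinity derived_set_of endpoint_limits \<gamma>"
    using p endpoint_limits_perfect by (simp add: perfect_in_def)
  moreover have "p \<in> ?T" using p endpoint_limits_subset by blast
  ultimately show False using derived_set_ofD[OF _ T] by blast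
qed

text \<open>The set is closed because it is perfect, and an interior point would put a whole
  interval into the support, which then is everything.\<close>

lemma endpoint_limits_nowhere_dense:
  assumes "support \<noteq> UNIV"
  shows "nowhere_dense_in (top_of_set M_infinity) (endpoint_limits \<gamma>)"
proof -
  have "top_of_set M_infinity closure_of endpoint_limits \<gamma> = endpoint_limits \<gamma>"
    unfolding closure_of_alt using endpoint_limits_perfect endpoint_limits_subset by (auto simp: perfect_in_def)
  moreover have "p \<notin> top_of_set M_infinity interior_of endpoint_limits \<gamma>" for p
  proof
    assume "p \<in> top_of_set M_infinity interior_of endpoint_limits \<gamma>"
    then obtain T where T: "openin (top_of_set M_infinity) T" "p \<in> T" "T \<subseteq> endpoint_limits \<gamma>"
      by (auto simp: interior_of_def)
    then have "p \<in> endpoint_limits \<gamma>" by blast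
    then obtain t where t: "p = (\<infinity>, ei t)" by (auto simp: endpoint_limits_support)
    obtain \<epsilon> where \<epsilon>: "\<epsilon> > 0" "\<forall>s. \<bar>s - t\<bar> < \<epsilon> \<longrightarrow> (\<infinity>, ei s) \<in> T"
      using infinity_point_nbhd[OF T(1) T(2)[unfolded t]] by blast
    have "{t - \<epsilon><..<t + \<epsilon>} \<subseteq> support"
    proof
      fix s assume "s \<in> {t - \<epsilon><..<t + \<epsilon>}"
      then have "\<bar>s - t\<bar> < \<epsilon>" by auto
      then have "(\<infinity>, ei s) \<in> endpoint_limits \<gamma>" using \<epsilon>(2) T(3) by blast
      then have "ei s \<in> ei ` support" by (simp add: endpoint_limits_support)
      then show "s \<in> support" by (simp only: ei_in_support)
    qed
    then show False using support_UNIV_if_interval[of "t - \<epsilon>" "t + \<epsilon>"] assms \<epsilon>(1) by simp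
  qed
  ultimately show ?thesis unfolding nowhere_dense_in_def by auto
qed

lemma endpoint_limits_eq_infinity: "endpoint_limits \<gamma> = M_infinity \<longleftrightarrow> support = UNIV"
  unfolding endpoint_limits_support M_infinity_def ei_support_eq_circle[symmetric] by auto

end

section \<open>Homeomorphisms between the character spaces\<close>

context marked_lift begin

definition arc_coord :: "nat \<Rightarrow> complex \<Rightarrow> real" where
  "arc_coord N = the_inv_into {node N..node (Suc N)} ei"

lemma arc_coord_ei: "t \<in> {node N..node (Suc N)} \<Longrightarrow> arc_coord N (ei t) = t"
  unfolding arc_coord_def by (rule the_inv_into_f_f[OF ei_inj_on_arc])

lemma continuous_on_arc_coord: "continuous_on (arc N) (arc_coord N)"
  unfolding arc_def
  by (rule continuous_on_inv) (auto simp: arc_coord_ei intro: continuous_intros)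

text \<open>The map is \<open>k\<close> at infinity and \<open>L N \<circ> k\<close> on the arc
  \<open>N\<close>, where \<open>L N\<close> is the affine map carrying the \<open>k\<close>-image
  of that arc onto the arc of the rotation. The error of this correction tends to 0, so the pieces
  fit together continuously at infinity.\<close>

lemma homeomorphic_M_tilde_rotation:
  assumes k: "degree_one_lift k" and \<tau>: "0 < \<tau>" "\<tau> < 1"
    and lim: "(\<lambda>N. k (node N) - real N * \<tau>) \<longlonglongrightarrow> 0"
  shows "M_tilde \<gamma> homeomorphic M_tilde (\<lambda>t. t + \<tau>)"
proof -
  interpret k: degree_one_lift k by (rule k)
  interpret R: marked_lift "\<lambda>t. t + \<tau>"
    using degree_one_lift_rotation[of \<tau>] \<tau> by (simp add: marked_lift_def marked_lift_axioms_def)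
  have Rnode: "R.node N = real N * \<tau>" for N by (simp add: rotation_iterate del: funpow.simps)
  have Rarc: "R.arc N = ei ` {real N * \<tau>..real (Suc N) * \<tau>}" for N
    unfolding R.arc_def Rnode ..
  define e where "e N = k (node N) - real N * \<tau>" for N
  define L where "L N s = real N * \<tau> + \<tau> * ((s - k (node N)) / (k (node (Suc N)) - k (node N)))" for N s
  have gap: "k (node N) < k (node (Suc N))" for N using node_less[of N] by simp
  have L_strict: "L N s < L N s' \<longleftrightarrow> s < s'" for N s s'
    unfolding L_def using \<tau>(1) gap[of N] by (simp add: divide_less_cancel)
  have L_ends: "L N (k (node N)) = real N * \<tau>" "L N (k (node (Suc N))) = real (Suc N) * \<tau>" for N
    unfolding L_def using gap[of N] by (simp_all add: algebra_simps)
  have L_le: "L N s \<le> L N s' \<longleftrightarrow> s \<le> s'" for N s s' using L_strict[of N s' s] by linarith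
  have L_range: "L N (k t) \<in> {real N * \<tau>..real (Suc N) * \<tau>}" if "t \<in> {node N..node (Suc N)}" for N t
    using that unfolding L_ends[symmetric, of N] atLeastAtMost_iff L_le k.le_iff .
  have L_close: "\<bar>L N (k t) - k t\<bar> \<le> \<bar>e N\<bar> + \<bar>e (Suc N)\<bar>" if t: "t \<in> {node N..node (Suc N)}" for N t
  proof -
    \<comment> \<open>In this barycentric coordinate the correction is the convex combination of the
      errors at the two ends, up to sign.\<close>
    define u where "u = (k t - k (node N)) / (k (node (Suc N)) - k (node N))"
    have u: "0 \<le> u" "u \<le> 1" using t gap[of N] by (auto simp: u_def)
    have "u * (k (node (Suc N)) - k (node N)) = k t - k (node N)" using gap[of N] by (simp add: u_def)
    then have "L N (k t) - k t = - ((1 - u) * e N + u * e (Suc N))"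
      unfolding L_def e_def u_def[symmetric] by (simp add: algebra_simps)
    then have "\<bar>L N (k t) - k t\<bar> \<le> (1 - u) * \<bar>e N\<bar> + u * \<bar>e (Suc N)\<bar>"
      using abs_triangle_ineq[of "(1 - u) * e N" "u * e (Suc N)"] u by (simp add: abs_mult)
    moreover have "(1 - u) * \<bar>e N\<bar> \<le> \<bar>e N\<bar>" "u * \<bar>e (Suc N)\<bar> \<le> \<bar>e (Suc N)\<bar>"
      using u by (auto intro: mult_left_le_one_le)
    ultimately show ?thesis by linarith
  qed
  obtain c where c: "continuous_on circle c" "\<And>t. ei (k t) = c (ei t)"
  proof (rule periodic_factor[of "\<lambda>t. ei (k t)"])
    show "continuous_on UNIV (\<lambda>t. ei (k t))" by (intro continuous_on_ei k.cont)
    show "ei (k (t + 1)) = ei (k t)" for t unfolding k.per using ei_add_int[of "k t" 1] by simp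
  qed blast
  define G where "G p = (case fst p of enat N \<Rightarrow> ei (L N (k (arc_coord N (snd p)))) | \<infinity> \<Rightarrow> c (snd p))" for p
  have G_arc: "G (enat N, ei t) = ei (L N (k t))" if "t \<in> {node N..node (Suc N)}" for N t
    using that by (simp add: G_def arc_coord_ei)
  have G_inf: "G (\<infinity>, ei t) = ei (k t)" for t by (simp add: G_def c(2))
  have "continuous_on (M_tilde \<gamma>) G"
  proof (rule continuous_on_M_tilde)
    show "continuous_on (arc N) (\<lambda>z. G (enat N, z))" for N
    proof -
      have "continuous_on (arc N) (\<lambda>z. k (arc_coord N z))"
        by (rule continuous_on_compose2[OF k.cont continuous_on_arc_coord]) simp
      then have "continuous_on (arc N) (\<lambda>z. L N (k (arc_coord N z)))"
        unfolding L_def using gap[of N] by (intro continuous_intros) auto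
      then show ?thesis unfolding G_def by (simp add: continuous_on_ei)
    qed
    show "continuous_on circle (\<lambda>z. G (\<infinity>, z))" using c(1) by (simp add: G_def)
    fix \<epsilon> :: real assume "\<epsilon> > 0"
    \<comment> \<open>Two errors of this size, times the Lipschitz constant \<open>2 * pi\<close> of
      \<open>ei\<close>, stay below \<open>\<epsilon>\<close>.\<close>
    then have "\<epsilon> / (4 * pi) > 0" by simp
    from LIMSEQ_D[OF lim this] obtain K where K: "\<And>N. N \<ge> K \<Longrightarrow> \<bar>e N\<bar> < \<epsilon> / (4 * pi)"
      by (auto simp: e_def)
    have "dist (G (enat N, z)) (G (\<infinity>, z)) < \<epsilon>" if N: "N \<ge> K" and z: "z \<in> arc N" for N z
    proof -
      obtain t where t: "t \<in> {node N..node (Suc N)}" "z = ei t" using z by (auto simp: arc_def)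
      have "\<bar>L N (k t) - k t\<bar> < \<epsilon> / (4 * pi) + \<epsilon> / (4 * pi)"
        using L_close[OF t(1)] K[OF N] K[of "Suc N"] N by linarith
      then have "2 * pi * \<bar>L N (k t) - k t\<bar> < 2 * pi * (\<epsilon> / (4 * pi) + \<epsilon> / (4 * pi))"
        by (intro mult_strict_left_mono) auto
      also have "\<dots> = \<epsilon>" by simp
      finally have less: "2 * pi * \<bar>L N (k t) - k t\<bar> < \<epsilon>" .
      have "dist (G (enat N, z)) (G (\<infinity>, z)) \<le> 2 * pi * \<bar>L N (k t) - k t\<bar>"
        unfolding t(2) G_arc[OF t(1)] G_inf by (rule dist_ei_le)
      with less show ?thesis by linarith
    qed
    then show "\<exists>K. \<forall>N\<ge>K. \<forall>z\<in>arc N. dist (G (enat N, z)) (G (\<infinity>, z)) < \<epsilon>" by blast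
  qed
  then have cont: "continuous_on (M_tilde \<gamma>) (\<lambda>p. (fst p, G p))"
    by (intro continuous_on_Pair continuous_on_fst continuous_on_id)
  have "inj_on (\<lambda>p. (fst p, G p)) (M_tilde \<gamma>)"
  proof (rule inj_onI)
    fix p q assume p: "p \<in> M_tilde \<gamma>" and q: "q \<in> M_tilde \<gamma>" and eq: "(fst p, G p) = (fst q, G q)"
    show "p = q"
      using p
    proof (cases rule: M_tilde_cases)
      case (arc N t)
      from q show ?thesis
      proof (cases rule: M_tilde_cases)
        case arc': (arc N' t')
        have N: "N' = N" using eq arc(2) arc'(2) by simp
        have t': "t' \<in> {node N..node (Suc N)}" using arc'(1) N by simp
        have "ei (L N (k t)) = ei (L N (k t'))"
          using eq arc(2) arc'(2) N G_arc[OF arc(1)] G_arc[OF t'] by simp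
        then have "L N (k t) = L N (k t')"
          using inj_onD[OF R.ei_inj_on_arc[of N]] L_range[OF arc(1)] L_range[OF t'] unfolding Rnode by blast
        then have "k t = k t'" using L_strict[of N "k t" "k t'"] L_strict[of N "k t'" "k t"] by linarith
        then show ?thesis using arc(2) arc'(2) N by simp
      next
        case (infinity t') then show ?thesis using eq arc(2) by simp
      qed
    next
      case (infinity t)
      from q show ?thesis
      proof (cases rule: M_tilde_cases)
        case (arc N' t') then show ?thesis using eq infinity by simp
      next
        case inf': (infinity t')
        have "ei (k t) = ei (k t')" using eq infinity inf' G_inf by simp
        then obtain j :: int where "k t - k t' = of_int j" unfolding ei_eq_iff by (auto elim: Ints_cases)
        then have "k t = k (t' + of_int j)" by (simp only: k.per_int)
        then have "t = t' + of_int j" by simp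
        then show ?thesis using infinity inf' by simp
      qed
    qed
  qed
  moreover have "(\<lambda>p. (fst p, G p)) ` M_tilde \<gamma> = M_tilde (\<lambda>t. t + \<tau>)"
  proof (intro equalityI subsetI)
    fix y assume "y \<in> (\<lambda>p. (fst p, G p)) ` M_tilde \<gamma>"
    then obtain p where p: "p \<in> M_tilde \<gamma>" "y = (fst p, G p)" by blast
    from p(1) show "y \<in> M_tilde (\<lambda>t. t + \<tau>)"
    proof (cases rule: M_tilde_cases)
      case (arc N t)
      then have "y = (enat N, ei (L N (k t)))" using p(2) G_arc by simp
      then show ?thesis using L_range[OF arc(1)] unfolding Rarc by (simp only: R.M_tilde_mem Rarc) blast
    next
      case (infinity t)
      then have "y = (\<infinity>, ei (k t))" using p(2) G_inf by simp
      then show ?thesis by (simp add: R.M_tilde_mem)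
    qed
  next
    fix y assume "y \<in> M_tilde (\<lambda>t. t + \<tau>)"
    then show "y \<in> (\<lambda>p. (fst p, G p)) ` M_tilde \<gamma>"
    proof (cases rule: R.M_tilde_cases)
      case (arc N s)
      have s: "s \<in> {real N * \<tau>..real (Suc N) * \<tau>}" using arc(1) unfolding Rnode .
      \<comment> \<open>The right-hand side is the preimage of \<open>s\<close> under
        \<open>L N\<close>; monotonicity then places \<open>t\<close> in the arc.\<close>
      obtain t where t: "k t = k (node N) + (s - real N * \<tau>) / \<tau> * (k (node (Suc N)) - k (node N))"
        using k.surj by blast
      have Lt: "L N (k t) = s" unfolding t L_def using \<tau>(1) gap[of N] by simp
      have "L N (k (node N)) \<le> L N (k t)" "L N (k t) \<le> L N (k (node (Suc N)))"
        unfolding L_ends Lt using s by simp_all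
      then have tN: "t \<in> {node N..node (Suc N)}" unfolding L_le by simp
      then have "(enat N, ei t) \<in> M_tilde \<gamma>" by (auto simp: M_tilde_mem arc_def)
      moreover have "y = (\<lambda>p. (fst p, G p)) (enat N, ei t)" using arc(2) G_arc[OF tN] Lt by simp
      ultimately show ?thesis by (rule rev_image_eqI)
    next
      case (infinity s)
      obtain t where t: "k t = s" using k.surj by blast
      have "(\<infinity>, ei t) \<in> M_tilde \<gamma>" by (simp add: M_tilde_mem)
      moreover have "y = (\<lambda>p. (fst p, G p)) (\<infinity>, ei t)" using infinity G_inf[of t] t by simp
      ultimately show ?thesis by (rule rev_image_eqI)
    qed
  qed
  ultimately show ?thesis
    using homeomorphism_compact[OF compact_M_tilde cont] unfolding homeomorphic_def by blast
qed

end

section \<open>Topological invariants of the character space\<close>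

definition open_connected_part :: "'a::topological_space set \<Rightarrow> 'a set" where
  "open_connected_part X = \<Union>{C. connected C \<and> openin (top_of_set X) C}"

text \<open>Together with \<open>open_connected_part\<close> this recovers the endpoints and the
  circle at infinity from the topology alone, so that an arbitrary homeomorphism respects
  both.\<close>

definition open_noncut_points :: "'a::topological_space set \<Rightarrow> 'a set" where
  "open_noncut_points X = {p. \<exists>C. connected C \<and> openin (top_of_set X) C \<and> p \<in> C \<and> connected (C - {p})}"

lemma homeomorphism_open_connected:
  assumes h: "homeomorphism X Y f g" and C: "openin (top_of_set X) C" "connected C"
  shows "openin (top_of_set Y) (f ` C)" "connected (f ` C)"
proof -
  have "C \<subseteq> X" using C(1) by (auto dest: openin_imp_subset)
  then show "connected (f ` C)"
    using h C(2) by (intro connected_continuous_image) (auto simp: homeomorphism_def intro: continuous_on_subset)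
  show "openin (top_of_set Y) (f ` C)" by (rule homeomorphism_imp_open_map[OF h C(1)])
qed

lemma homeomorphism_open_connected_part:
  assumes h: "homeomorphism X Y f g"
  shows "f ` open_connected_part X = open_connected_part Y"
proof -
  have sub: "f ` open_connected_part X \<subseteq> open_connected_part Y" if "homeomorphism X Y f g" for X Y f g
    using homeomorphism_open_connected[OF that] unfolding open_connected_part_def by blast
  have "y \<in> f ` open_connected_part X" if y: "y \<in> open_connected_part Y" for y
  proof -
    have "g y \<in> open_connected_part X" using sub[OF homeomorphism_symD[OF h]] y by blast
    moreover have "y \<in> Y" using y by (auto simp: open_connected_part_def dest: openin_imp_subset)
    then have "y = f (g y)" using h by (simp add: homeomorphism_def)
    ultimately show ?thesis by blast
  qed
  then show ?thesis using sub[OF h] by blast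
qed

lemma homeomorphism_open_noncut_points:
  assumes h: "homeomorphism X Y f g"
  shows "f ` open_noncut_points X = open_noncut_points Y"
proof -
  have sub: "f p \<in> open_noncut_points Y" if h: "homeomorphism X Y f g" and p: "p \<in> open_noncut_points X" for X Y f g p
  proof -
    obtain C where C: "connected C" "openin (top_of_set X) C" "p \<in> C" "connected (C - {p})"
      using p unfolding open_noncut_points_def by blast
    have CX: "C \<subseteq> X" using C(2) by (rule openin_imp_subset)
    have inj: "inj_on f X" using h by (metis homeomorphism_def inj_on_inverseI)
    have "f ` C - {f p} = f ` (C - {p})"
      using inj_on_image_set_diff[OF inj, of C "{p}"] CX C(3) by auto
    moreover have "connected (f ` (C - {p}))"
      using h C(4) CX by (intro connected_continuous_image) (auto simp: homeomorphism_def intro: continuous_on_subset)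
    ultimately have "connected (f ` C - {f p})" by simp
    then show ?thesis
      using homeomorphism_open_connected[OF h C(2,1)] C(3) unfolding open_noncut_points_def by blast
  qed
  have "y \<in> f ` open_noncut_points X" if y: "y \<in> open_noncut_points Y" for y
  proof -
    have "g y \<in> open_noncut_points X" using sub[OF homeomorphism_symD[OF h] y] .
    moreover have "y \<in> Y" using y by (auto simp: open_noncut_points_def dest: openin_imp_subset)
    then have "y = f (g y)" using h by (simp add: homeomorphism_def)
    ultimately show ?thesis by blast
  qed
  then show ?thesis using sub[OF h] by blast
qed

lemma homeomorphism_derived_set_of:
  assumes h: "homeomorphism X Y f g" and S: "S \<subseteq> X"
  shows "f ` (top_of_set X derived_set_of S) = top_of_set Y derived_set_of (f ` S)"
proof -
  have sub: "f p \<in> top_of_set Y derived_set_of (f ` S)"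
    if h: "homeomorphism X Y f g" and S: "S \<subseteq> X" and p: "p \<in> top_of_set X derived_set_of S" for X Y f g S p
    unfolding in_derived_set_of
  proof (intro conjI allI impI)
    have pX: "p \<in> X" using p by (simp add: in_derived_set_of)
    then show "f p \<in> topspace (top_of_set Y)" using h by (auto simp: homeomorphism_def)
    fix T assume T: "f p \<in> T \<and> openin (top_of_set Y) T"
    have "openin (top_of_set X) (X \<inter> f -` T)"
      using T h continuous_openin_preimage[of X f Y T] by (auto simp: homeomorphism_def)
    then obtain y where y: "y \<noteq> p" "y \<in> S" "y \<in> X \<inter> f -` T"
      using derived_set_ofD[OF p] T pX by blast
    have "f y \<noteq> f p" using y(1,3) pX h by (metis IntD1 homeomorphism_def)
    then show "\<exists>z. z \<noteq> f p \<and> z \<in> f ` S \<and> z \<in> T" using y by blast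
  qed
  have "y \<in> f ` (top_of_set X derived_set_of S)" if y: "y \<in> top_of_set Y derived_set_of (f ` S)" for y
  proof -
    have fS: "f ` S \<subseteq> Y" using h S by (auto simp: homeomorphism_def)
    have "g ` f ` S = S" using h S by (force simp: homeomorphism_def subset_iff image_iff)
    then have "g y \<in> top_of_set X derived_set_of S" using sub[OF homeomorphism_symD[OF h] fS y] by simp
    moreover have "y \<in> Y" using y by (simp add: in_derived_set_of)
    then have "y = f (g y)" using h by (simp add: homeomorphism_def)
    ultimately show ?thesis by blast
  qed
  then show ?thesis using sub[OF h S] by blast
qed

context unbounded_marked_lift begin

lemma openin_M_arc: "openin (top_of_set (M_tilde \<gamma>)) (M_arc \<gamma> N)"
proof -
  have "M_arc \<gamma> N = M_tilde \<gamma> \<inter> ({enat N} \<times> UNIV)" by (auto simp: M_arc_eq M_tilde_mem)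
  then show ?thesis by (simp add: openin_open_Int open_enat_singleton_Times)
qed

lemma connected_interval_image:
  assumes "connected I" shows "connected ((\<lambda>t. (enat N, ei t)) ` I)"
  by (rule connected_continuous_image[OF _ assms]) (intro continuous_intros)

lemma M_arc_image: "M_arc \<gamma> N = (\<lambda>t. (enat N, ei t)) ` {node N..node (Suc N)}"
  by (auto simp: M_arc_eq arc_def)

text \<open>The path enters every nonempty open set, so the set contains a point of finite level;
  that level is clopen and by connectedness holds the whole set.\<close>

lemma open_connected_subset_arc:
  assumes C: "connected C" "openin (top_of_set (M_tilde \<gamma>)) C" and p: "p \<in> C"
  obtains N where "C \<subseteq> M_arc \<gamma> N"
proof -
  obtain V where V: "open V" "C = M_tilde \<gamma> \<inter> V" using C(2) by (auto simp: openin_open)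
  then have "V \<inter> M_tilde \<gamma> \<noteq> {}" using p by blast
  from dense[OF V(1) this] obtain u v where uv: "0 \<le> u" "u < v" "\<forall>t. u < t \<and> t < v \<longrightarrow> param t \<in> V"
    by blast
  let ?t = "(u + v) / 2" let ?N = "idx ?t"
  have "param ?t \<in> C" using uv param_in[of ?t] V(2) by simp
  then have in_C: "(enat ?N, ei ?t) \<in> C" by (simp add: param_def)
  let ?A = "{enat ?N} \<times> (UNIV :: complex set)" and ?B = "(- {enat ?N}) \<times> (UNIV :: complex set)"
  have "open ?A" "open ?B" by (auto intro!: open_Times open_enat open_Compl)
  moreover have "C \<subseteq> ?A \<union> ?B" "?A \<inter> ?B \<inter> C = {}" by auto
  ultimately have "?A \<inter> C = {} \<or> ?B \<inter> C = {}" using connectedD[OF C(1), of ?A ?B] by blast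
  then have "C \<subseteq> ?A" using in_C by auto
  then have "C \<subseteq> M_arc \<gamma> ?N" using V(2) by (auto simp: M_arc_eq M_tilde_mem)
  then show ?thesis by (rule that)
qed

lemma open_connected_part_M_tilde: "M_tilde \<gamma> - open_connected_part (M_tilde \<gamma>) = M_infinity"
proof -
  have "open_connected_part (M_tilde \<gamma>) = (\<Union>N. M_arc \<gamma> N)"
  proof (intro equalityI subsetI)
    fix p assume "p \<in> open_connected_part (M_tilde \<gamma>)"
    then obtain C where C: "connected C" "openin (top_of_set (M_tilde \<gamma>)) C" "p \<in> C"
      by (auto simp: open_connected_part_def)
    obtain N where "C \<subseteq> M_arc \<gamma> N" by (rule open_connected_subset_arc[OF C])
    then show "p \<in> (\<Union>N. M_arc \<gamma> N)" using C(3) by blast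
  next
    fix p assume "p \<in> (\<Union>N. M_arc \<gamma> N)"
    then obtain N where N: "p \<in> M_arc \<gamma> N" by blast
    have "connected (M_arc \<gamma> N)" unfolding M_arc_image by (rule connected_interval_image) simp
    then show "p \<in> open_connected_part (M_tilde \<gamma>)"
      using N openin_M_arc unfolding open_connected_part_def by blast
  qed
  then show ?thesis by (auto simp: M_tilde_def M_infinity_def M_arc_eq)
qed

text \<open>Around an interior point the arc coordinate takes values on both sides of
  \<open>t\<close> but not \<open>t\<close> itself, so removing the point disconnects. At an
  endpoint the whole arc serves as the neighbourhood.\<close>

lemma open_noncut_points_M_tilde: "open_noncut_points (M_tilde \<gamma>) = M_endpoints \<gamma>"
proof (intro equalityI subsetI)
  fix p assume "p \<in> open_noncut_points (M_tilde \<gamma>)"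
  then obtain C where C: "connected C" "openin (top_of_set (M_tilde \<gamma>)) C" "p \<in> C" and conn: "connected (C - {p})"
    unfolding open_noncut_points_def by blast
  obtain N where N: "C \<subseteq> M_arc \<gamma> N" by (rule open_connected_subset_arc[OF C])
  then have "p \<in> M_arc \<gamma> N" using C(3) by blast
  then obtain t where t: "t \<in> {node N..node (Suc N)}" "p = (enat N, ei t)" unfolding M_arc_image by blast
  have "t = node N \<or> t = node (Suc N)"
  proof (rule ccontr)
    assume "\<not> ?thesis"
    then have inner: "node N < t" "t < node (Suc N)" using t(1) by auto
    obtain V where V: "open V" "C = M_tilde \<gamma> \<inter> V" using C(2) by (auto simp: openin_open)
    have "continuous_on UNIV (\<lambda>s. (enat N, ei s))" by (intro continuous_intros)
    then have "open ((\<lambda>s. (enat N, ei s)) -` V)" using V(1) by (rule open_vimage[rotated])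
    moreover have "t \<in> (\<lambda>s. (enat N, ei s)) -` V" using C(3) V(2) t(2) by simp
    ultimately obtain \<epsilon> where \<epsilon>: "\<epsilon> > 0" "\<And>s. dist s t < \<epsilon> \<Longrightarrow> s \<in> (\<lambda>s. (enat N, ei s)) -` V"
      unfolding open_dist by blast
    \<comment> \<open>Half of \<open>\<epsilon>\<close> gives the strict inequality; the other terms
      keep \<open>t - d\<close> and \<open>t + d\<close> on the arc.\<close>
    define d where "d = min (\<epsilon> / 2) (min (t - node N) (node (Suc N) - t))"
    have d: "d > 0" "d < \<epsilon>" "node N \<le> t - d" "t + d \<le> node (Suc N)" using \<epsilon>(1) inner by (auto simp: d_def)
    let ?S = "(\<lambda>q. arc_coord N (snd q)) ` (C - {p})"
    have in_S: "s \<in> ?S" if s: "s \<in> {node N..node (Suc N)}" "dist s t < \<epsilon>" "s \<noteq> t" for s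
    proof -
      have "(enat N, ei s) \<in> C" using \<epsilon>(2)[OF s(2)] s(1) V(2) by (auto simp: M_tilde_mem arc_def)
      moreover have "ei s \<noteq> ei t" using s t(1) inj_onD[OF ei_inj_on_arc] by blast
      ultimately have "(enat N, ei s) \<in> C - {p}" using t(2) by simp
      then show ?thesis using arc_coord_ei[OF s(1)] by (intro image_eqI[of _ _ "(enat N, ei s)"]) simp_all
    qed
    have "continuous_on (C - {p}) (\<lambda>q. arc_coord N (snd q))"
      by (rule continuous_on_compose2[OF continuous_on_arc_coord])
         (use N in \<open>auto simp: M_arc_eq intro: continuous_intros\<close>)
    then have "connected ?S" using conn by (rule connected_continuous_image)
    moreover have "t - d \<in> ?S" by (rule in_S) (use d t(1) in \<open>auto simp: dist_real_def\<close>)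
    moreover have "t + d \<in> ?S" by (rule in_S) (use d t(1) in \<open>auto simp: dist_real_def\<close>)
    ultimately have "{t - d..t + d} \<subseteq> ?S" by (rule connected_contains_Icc)
    then have "t \<in> ?S" using d(1) by auto
    then obtain q where q: "q \<in> C - {p}" "t = arc_coord N (snd q)" by blast
    then obtain s where s: "s \<in> {node N..node (Suc N)}" "q = (enat N, ei s)" using N unfolding M_arc_image by blast
    then have "s = t" using q(2) arc_coord_ei[OF s(1)] by simp
    then show False using q(1) s(2) t(2) by simp
  qed
  then show "p \<in> M_endpoints \<gamma>" unfolding M_endpoints_def t(2) by blast
next
  fix p assume "p \<in> M_endpoints \<gamma>"
  then obtain N t where t: "p = (enat N, ei t)" "t = node N \<or> t = node (Suc N)" unfolding M_endpoints_def by blast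
  have tN: "t \<in> {node N..node (Suc N)}" using t(2) node_less[of N] by auto
  have "inj_on (\<lambda>t. (enat N, ei t)) {node N..node (Suc N)}"
    using ei_inj_on_arc[of N] by (auto simp: inj_on_def)
  from inj_on_image_set_diff[OF this, of "{node N..node (Suc N)}" "{t}"] tN
  have diff: "M_arc \<gamma> N - {p} = (\<lambda>t. (enat N, ei t)) ` ({node N..node (Suc N)} - {t})"
    unfolding M_arc_image t(1) by simp
  have "{node N..node (Suc N)} - {t} = {node N<..node (Suc N)} \<or> {node N..node (Suc N)} - {t} = {node N..<node (Suc N)}"
    using t(2) by auto
  then have "connected ({node N..node (Suc N)} - {t})"
    by (elim disjE) (simp_all only: connected_Ioc connected_Ico)
  then have "connected (M_arc \<gamma> N - {p})" unfolding diff by (rule connected_interval_image)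
  moreover have "connected (M_arc \<gamma> N)" unfolding M_arc_image by (rule connected_interval_image) simp
  moreover have "p \<in> M_arc \<gamma> N" using tN t(1) unfolding M_arc_image by blast
  ultimately show "p \<in> open_noncut_points (M_tilde \<gamma>)"
    using openin_M_arc unfolding open_noncut_points_def by blast
qed

end

text \<open>The two properties match the two kinds of rotations by a positive angle: finite limit
  sets for rational ones, the full circle for irrational ones.\<close>

lemma homeomorphic_M_tilde_invariants:
  assumes \<gamma>: "unbounded_marked_lift \<gamma>" and \<delta>: "unbounded_marked_lift \<delta>"
    and hom: "M_tilde \<gamma> homeomorphic M_tilde \<delta>"
  shows "finite (endpoint_limits \<delta>) \<Longrightarrow> finite (endpoint_limits \<gamma>)"
    and "endpoint_limits \<delta> = M_infinity \<Longrightarrow> endpoint_limits \<gamma> = M_infinity"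
proof -
  interpret A: unbounded_marked_lift \<gamma> by (rule \<gamma>)
  interpret B: unbounded_marked_lift \<delta> by (rule \<delta>)
  obtain f g where h: "homeomorphism (M_tilde \<gamma>) (M_tilde \<delta>) f g" using hom by (auto simp: homeomorphic_def)
  then have inj: "inj_on f (M_tilde \<gamma>)" and im: "f ` M_tilde \<gamma> = M_tilde \<delta>"
    by (auto simp: homeomorphism_def intro: inj_on_inverseI)
  have sub: "M_endpoints \<gamma> \<subseteq> M_tilde \<gamma>"
    unfolding A.open_noncut_points_M_tilde[symmetric] open_noncut_points_def by (auto dest: openin_imp_subset)
  have lim: "f ` endpoint_limits \<gamma> = endpoint_limits \<delta>"
    unfolding endpoint_limits_def homeomorphism_derived_set_of[OF h sub]
    unfolding A.open_noncut_points_M_tilde[symmetric] B.open_noncut_points_M_tilde[symmetric]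
      homeomorphism_open_noncut_points[OF h] ..
  have infty: "f ` M_infinity = M_infinity"
  proof -
    have "open_connected_part (M_tilde \<gamma>) \<subseteq> M_tilde \<gamma>"
      unfolding open_connected_part_def by (auto dest: openin_imp_subset)
    from inj_on_image_set_diff[OF inj Diff_subset this]
    have "f ` (M_tilde \<gamma> - open_connected_part (M_tilde \<gamma>)) = M_tilde \<delta> - open_connected_part (M_tilde \<delta>)"
      by (simp add: im homeomorphism_open_connected_part[OF h] del: image_diff_subset)
    then show ?thesis unfolding A.open_connected_part_M_tilde B.open_connected_part_M_tilde .
  qed
  have limM: "endpoint_limits \<gamma> \<subseteq> M_tilde \<gamma>" "M_infinity \<subseteq> M_tilde \<gamma>"
    by (auto simp: endpoint_limits_def in_derived_set_of M_tilde_def)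
  show "finite (endpoint_limits \<gamma>)" if "finite (endpoint_limits \<delta>)"
    using that inj_on_subset[OF inj limM(1)] unfolding lim[symmetric] by (rule finite_imageD)
  show "endpoint_limits \<gamma> = M_infinity" if "endpoint_limits \<delta> = M_infinity"
    using inj_on_image_eq_iff[OF inj limM] that lim infty by simp
qed

section \<open>Rotations and the classification\<close>

context marked_lift begin

text \<open>Both end values can occur, because the normalization constrains \<gamma> only at 0:
  elsewhere \<gamma> may have a point with \<open>\<gamma> p = p\<close> or one with
  \<open>\<gamma> p = p + 1\<close>.\<close>

lemma transl_range: "0 \<le> transl" "transl \<le> 1"
proof -
  have le: "node N \<le> real N" for N
  proof (induction N)
    case (Suc N) then show ?case using node_Suc_less[of N] by simp
  qed simp
  show "0 \<le> transl"
    by (rule LIMSEQ_le_const[OF transl_limit[of 0]]) (use node_nonneg in auto)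
  show "transl \<le> 1"
  proof (rule LIMSEQ_le_const2[OF transl_limit[of 0]])
    have "node n / real n \<le> 1" for n using le[of n] by (cases "n = 0") auto
    then show "\<exists>N. \<forall>n\<ge>N. node n / real n \<le> 1" by blast
  qed
qed

lemma unbounded_if_transl_pos:
  assumes "0 < transl" shows "unbounded_marked_lift \<gamma>"
proof
  fix x
  obtain N :: nat where N: "x + 1 < real N * transl" using ex_less_of_nat_mult[OF assms] by blast
  then show "\<exists>N. x < node N" using transl_bound[of N 0] by (intro exI[of _ N]) linarith
qed

text \<open>The two orbits may run off to infinity, so it is the uniform continuity of
  \<open>h\<close> that preserves their closeness.\<close>

lemma linearization_limit:
  assumes "degree_one_lift h" and p: "\<And>N. h ((\<gamma> ^^ N) p) = real N * l"
    and lim: "(\<lambda>N. node N - (\<gamma> ^^ N) p) \<longlonglongrightarrow> 0"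
  shows "(\<lambda>N. h (node N) - real N * l) \<longlonglongrightarrow> 0"
proof (rule LIMSEQ_I)
  interpret h: degree_one_lift h by fact
  fix \<epsilon> :: real assume "\<epsilon> > 0"
  then obtain \<delta> where \<delta>: "\<delta> > 0" "\<And>s t. \<bar>s - t\<bar> < \<delta> \<Longrightarrow> \<bar>h s - h t\<bar> < \<epsilon>"
    using h.uniformly_continuous by blast
  obtain K where K: "\<And>N. N \<ge> K \<Longrightarrow> \<bar>node N - (\<gamma> ^^ N) p\<bar> < \<delta>" using LIMSEQ_D[OF lim \<delta>(1)] by auto
  have "norm (h (node N) - real N * l - 0) < \<epsilon>" if "N \<ge> K" for N
    using \<delta>(2)[OF K[OF that]] by (simp add: p)
  then show "\<exists>K. \<forall>N\<ge>K. norm (h (node N) - real N * l - 0) < \<epsilon>" by blast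
qed

end

section \<open>The algebras of rotations\<close>

lemma marked_lift_rotation: "0 < \<tau> \<Longrightarrow> \<tau> < 1 \<Longrightarrow> unbounded_marked_lift (\<lambda>t. t + \<tau>)"
  using marked_lift.unbounded_if_transl_pos[of "\<lambda>t. t + \<tau>"] degree_one_lift_rotation[of \<tau>]
  by (simp add: marked_lift_def marked_lift_axioms_def transl_rotation)

lemma (in unbounded_marked_lift) circle_algebra_function_algebra:
  assumes "orientation_preserving_homeo \<alpha>" "circle_lift \<alpha> \<gamma>"
    and "\<exists>T. op_given_by (shift_formula \<gamma>) T \<and> unitary_op T"
  shows "circle_algebra \<alpha> = function_algebra param (M_tilde \<gamma>)"
proof -
  obtain T where "op_given_by (shift_formula \<gamma>) T" "unitary_op T" using assms(3) by blast
  from circle_algebra_eq[OF assms(1,2) _ _ this] show ?thesis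
    using zero_less less_one by (simp add: generated_eq_function_algebra)
qed

lemma circle_algebra_rotation:
  assumes "0 < \<tau>" "\<tau> < 1"
  shows "circle_algebra (rotation \<tau>) = function_algebra (unbounded_marked_lift.param (\<lambda>t. t + \<tau>)) (M_tilde (\<lambda>t. t + \<tau>))"
  by (rule unbounded_marked_lift.circle_algebra_function_algebra[OF marked_lift_rotation[OF assms]
      rotation_orientation_preserving rotation_lift translation_operator_exists])

lemma finite_endpoint_limits_rotation:
  assumes \<tau>: "0 < \<tau>" "\<tau> < 1" and "\<tau> \<in> \<rat>"
  shows "finite (endpoint_limits (\<lambda>t. t + \<tau>))"
proof -
  interpret unbounded_marked_lift "\<lambda>t. t + \<tau>" by (rule marked_lift_rotation[OF \<tau>])
  obtain m n :: nat where mn: "n \<noteq> 0" "\<bar>\<tau>\<bar> = real m / real n" "coprime m n"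
    using Rats_abs_nat_div_natE[OF assms(3)] by blast
  have "card (endpoint_limits (\<lambda>t. t + \<tau>)) = n"
    by (rule card_endpoint_limits[where m = "int m"]) (use mn \<tau> in \<open>auto simp: transl_rotation\<close>)
  then show ?thesis using mn(1) by (intro card_ge_0_finite) simp
qed

lemma endpoint_limits_irrational_rotation:
  assumes \<tau>: "0 < \<tau>" "\<tau> < 1" and irr: "\<tau> \<notin> \<rat>"
  shows "endpoint_limits (\<lambda>t. t + \<tau>) = M_infinity"
proof -
  interpret unbounded_marked_lift "\<lambda>t. t + \<tau>" by (rule marked_lift_rotation[OF \<tau>])
  interpret marked_semiconjugacy "\<lambda>t. t + \<tau>" "\<lambda>t. t" \<tau>
    by unfold_locales (use irr in \<open>auto simp: mono_def intro: continuous_intros\<close>)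
  have "support = UNIV" by (auto simp: support_def)
  then show ?thesis by (simp only: endpoint_limits_eq_infinity)
qed

text \<open>For the rotation by 0 there are no proper arcs, and the circle with the path
  \<open>ei\<close> takes the place of the character space.\<close>

lemma half_line_param_circle: "half_line_param ei circle"
proof
  fix F :: "complex \<Rightarrow> complex" assume F: "continuous_on circle F"
  have "continuous_on UNIV (\<lambda>t. F (ei t))"
    by (rule continuous_on_compose2[OF F]) (auto intro: continuous_intros)
  then have [measurable]: "(\<lambda>t. F (ei t)) \<in> borel_measurable borel" by (rule borel_measurable_continuous_onI)
  show "half_line_function ei F \<in> borel_measurable borel"
    unfolding half_line_function_def[abs_def] by measurable
next
  fix V :: "complex set" assume V: "open V" "V \<inter> circle \<noteq> {}"
  then obtain z where z: "z \<in> V" "z \<in> circle" by blast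
  then obtain t where t: "ei t \<in> V" using circle_ex_ei by blast
  define s where "s = t + of_int \<lceil>- t\<rceil>"
  have s: "0 \<le> s" "ei s \<in> V" using t unfolding s_def by (linarith, simp)
  have "continuous_on UNIV (\<lambda>s. ei s)" by (intro continuous_intros)
  then have "open (ei -` V)" using V(1) by (rule open_vimage[rotated])
  then obtain \<epsilon> where \<epsilon>: "\<epsilon> > 0" "\<And>r. dist r s < \<epsilon> \<Longrightarrow> r \<in> ei -` V" using s(2) unfolding open_dist by blast
  have "ei r \<in> V" if "s < r" "r < s + \<epsilon>" for r using \<epsilon>(2)[of r] that by (simp add: dist_real_def)
  then show "\<exists>u v. 0 \<le> u \<and> u < v \<and> (\<forall>t. u < t \<and> t < v \<longrightarrow> ei t \<in> V)"
    using s(1) \<epsilon>(1) by (intro exI[of _ s] conjI exI[of _ "s + \<epsilon>"]) auto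
qed auto

text \<open>All iterates fix 0, so every generator is cut off at 0 only. The inclusion is enough to
  bound the idempotents from above.\<close>

lemma circle_algebra_rotation_zero: "circle_algebra (rotation 0) \<subseteq> function_algebra ei circle"
proof -
  interpret P: half_line_param ei circle by (rule half_line_param_circle)
  interpret degree_one_lift "\<lambda>t. t + 0" by (rule degree_one_lift_rotation)
  obtain T where T: "op_given_by (shift_formula (\<lambda>t. t + 0)) T" "unitary_op T"
    using translation_operator_exists by blast
  have eq: "circle_algebra (rotation 0) = generated_cstar_algebra generators"
    by (rule circle_algebra_eq[OF rotation_orientation_preserving rotation_lift _ _ T]) auto
  have "mult_op (\<lambda>t. indicator {0..} t * c (ei t)) \<in> function_algebra ei circle"
    if "continuous_on circle c" for c
    using P.function_algebraI[OF that] by (simp add: half_line_function_def[abs_def])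
  moreover have "((\<lambda>t. t + 0) ^^ n) 0 = (0 :: real)" for n
    by (simp only: rotation_iterate)
  ultimately have "generators \<subseteq> function_algebra ei circle"
    unfolding generators_def by (auto simp del: add_0_right)
  then show ?thesis
    unfolding eq using P.cstar_function_algebra by (auto simp: generated_cstar_algebra_def)
qed

text \<open>An idempotent symbol takes the values 0 and 1, so it is constant on the connected
  circle.\<close>

lemma idempotent_circle:
  assumes T: "T \<in> function_algebra ei circle" "T o\<^sub>L T = T"
  shows "T \<in> (\<lambda>c. mult_op (half_line_function ei (\<lambda>z. c))) ` {0, 1}"
proof -
  interpret P: half_line_param ei circle by (rule half_line_param_circle)
  obtain F where F: "continuous_on circle F" "T = P.M F" using T(1) by (rule P.function_algebra_cases)
  then have "\<forall>z\<in>circle. F z * F z = F z"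
    using T(2) by (simp only: P.M_mult) (simp only: P.M_eq_iff continuous_on_mult)
  then have vals: "F z \<in> {0, 1}" if "z \<in> circle" for z using that by fastforce
  have "continuous_on UNIV (\<lambda>t. F (ei t))"
    by (rule continuous_on_compose2[OF F(1)]) (auto intro: continuous_intros)
  moreover have "finite (range (\<lambda>t. F (ei t)))"
    by (rule finite_subset[of _ "{0, 1}"]) (use vals[OF ei_in_circle] in auto)
  ultimately have "(\<lambda>t. F (ei t)) constant_on UNIV"
    by (intro continuous_finite_range_constant connected_UNIV)
  then obtain c where c: "\<And>t. F (ei t) = c" by (auto simp: constant_on_def)
  have "F z = c" if "z \<in> circle" for z using circle_ex_ei[OF that] c by blast
  then have "T = P.M (\<lambda>z. c)" unfolding F(2) by (subst P.M_eq_iff[OF F(1)]) auto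
  moreover have "c \<in> {0, 1}" using vals[of "ei 0"] c[of 0] by simp
  ultimately show ?thesis by blast
qed

text \<open>The algebra of the identity has only two idempotents, but the one of an unbounded lift
  contains the indicators of all the half lines \<open>[\<gamma>\<^sup>n(0),\<infinity>)\<close>.\<close>

lemma (in unbounded_marked_lift) not_isomorphic_rotation_zero:
  "\<not> function_algebra param (M_tilde \<gamma>) \<cong>\<^sub>* circle_algebra (rotation 0)"
proof
  assume "function_algebra param (M_tilde \<gamma>) \<cong>\<^sub>* circle_algebra (rotation 0)"
  then obtain \<phi> where bij: "bij_betw \<phi> (function_algebra param (M_tilde \<gamma>)) (circle_algebra (rotation 0))"
    and hom: "\<And>S T. S \<in> function_algebra param (M_tilde \<gamma>) \<Longrightarrow> T \<in> function_algebra param (M_tilde \<gamma>) \<Longrightarrow>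
      \<phi> (S o\<^sub>L T) = \<phi> S o\<^sub>L \<phi> T"
    unfolding cstar_isomorphic_def by blast
  define F :: "nat \<Rightarrow> enat \<times> complex \<Rightarrow> complex" where "F n = level_function n (\<lambda>z. 1)" for n
  have cF: "continuous_on (M_tilde \<gamma>) (F n)" for n
    unfolding F_def by (intro continuous_on_level_function M_tilde_subset) auto
  have "(\<lambda>x. F n x * F n x) = F n" for n by (auto simp: F_def level_function_def)
  then have idem: "M (F n) o\<^sub>L M (F n) = M (F n)" for n by (simp add: M_mult cF)
  have inj: "M (F m) \<noteq> M (F n)" if "m < n" for m n
  proof -
    have "(enat m, ei (node m)) \<in> M_tilde \<gamma>" using node_less[of m] by (auto simp: M_tilde_mem arc_def)
    moreover have "F m (enat m, ei (node m)) \<noteq> F n (enat m, ei (node m))"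
      using that by (simp add: F_def level_function_def)
    ultimately show ?thesis using M_eq_iff[OF cF cF] by blast
  qed
  have "inj (\<lambda>n. \<phi> (M (F n)))"
  proof (rule injI)
    fix m n assume "\<phi> (M (F m)) = \<phi> (M (F n))"
    then have "M (F m) = M (F n)"
      by (rule inj_onD[OF bij_betw_imp_inj_on[OF bij] _ function_algebraI[OF cF] function_algebraI[OF cF]])
    then show "m = n" using inj[of m n] inj[of n m] by (cases m n rule: linorder_cases) auto
  qed
  moreover have "range (\<lambda>n. \<phi> (M (F n))) \<subseteq> (\<lambda>c. mult_op (half_line_function ei (\<lambda>z. c))) ` {0, 1}"
  proof (rule image_subsetI, rule idempotent_circle)
    fix n
    show "\<phi> (M (F n)) \<in> function_algebra ei circle"
      using bij_betw_apply[OF bij function_algebraI[OF cF]] circle_algebra_rotation_zero by blast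
    show "\<phi> (M (F n)) o\<^sub>L \<phi> (M (F n)) = \<phi> (M (F n))"
      using hom[OF function_algebraI[OF cF] function_algebraI[OF cF], of n n] by (simp add: idem)
  qed
  ultimately show False
    using finite_imageD finite_subset infinite_UNIV_nat by (metis finite.emptyI finite.insertI finite_imageI)
qed

text \<open>The guard on the rational isomorphism removes rotation number 0, where the comparison
  rotation is the identity: its algebra has only the trivial idempotents, while that of \<alpha>
  contains the cut-offs at infinitely many nodes.\<close>

theorem theorem4p6:
  fixes \<alpha> :: "complex \<Rightarrow> complex" and \<gamma> :: "real \<Rightarrow> real"
  assumes "orientation_preserving_homeo \<alpha>"
    and "\<alpha> 1 \<noteq> 1"
    and "circle_lift \<alpha> \<gamma>" and "0 < \<gamma> 0" and "\<gamma> 0 < 1"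
    and "\<exists>T. op_given_by (shift_formula \<gamma>) T \<and> unitary_op T"
  shows
    "(\<forall>m n :: nat. n > 0 \<and> coprime m n \<and> rotation_number \<alpha> = real m / real n \<longrightarrow>
        endpoint_limits \<gamma> \<subseteq> M_infinity \<and> card (endpoint_limits \<gamma>) = n \<and>
        (rotation (real m / real n) 1 \<noteq> 1 \<longrightarrow>
           circle_algebra \<alpha> \<cong>\<^sub>* circle_algebra (rotation (real m / real n)))) \<and>
     (rotation_number \<alpha> \<notin> \<rat> \<longrightarrow>
        (topologically_transitive \<alpha> \<longrightarrow>
           M_infinity = endpoint_limits \<gamma> \<and>
           circle_algebra \<alpha> \<cong>\<^sub>* circle_algebra (rotation (rotation_number \<alpha>))) \<and>
        (\<not> topologically_transitive \<alpha> \<longrightarrow>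
           endpoint_limits \<gamma> \<subseteq> M_infinity \<and>
           perfect_in (top_of_set M_infinity) (endpoint_limits \<gamma>) \<and>
           nowhere_dense_in (top_of_set M_infinity) (endpoint_limits \<gamma>) \<and>
           (\<forall>\<tau>\<in>{0..<1}. \<not> circle_algebra \<alpha> \<cong>\<^sub>* circle_algebra (rotation \<tau>))))"
proof -
  interpret marked_lift \<gamma>
    using circle_lift_degree_one(1)[OF assms(1,3)] assms(4,5) by (simp add: marked_lift_def marked_lift_axioms_def)
  have rot: "rotation_number \<alpha> = frac transl" by (rule rotation_number_eq[OF assms(1,3)])
  \<comment> \<open>The translation number lies in [0,1], and both end values have fractional part
    0.\<close>
  have transl_eq: "transl = rotation_number \<alpha>" "0 < transl" "transl < 1" if "rotation_number \<alpha> \<noteq> 0"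
  proof -
    have "transl \<noteq> 0" "transl \<noteq> 1" using that unfolding rot by auto
    then show "0 < transl" "transl < 1" using transl_range by linarith+
    then show "transl = rotation_number \<alpha>" unfolding rot by (simp add: frac_eq)
  qed
  \<comment> \<open>The rational and the transitive case meet here; they differ only in the
    linearizing map \<open>k\<close>.\<close>
  have iso: "circle_algebra \<alpha> \<cong>\<^sub>* circle_algebra (rotation transl)"
    if k: "degree_one_lift k" "(\<lambda>N. k (node N) - real N * transl) \<longlonglongrightarrow> 0" and l: "0 < transl" "transl < 1" for k
  proof -
    interpret unbounded_marked_lift \<gamma> by (rule unbounded_if_transl_pos[OF l(1)])
    interpret R: unbounded_marked_lift "\<lambda>t. t + transl" by (rule marked_lift_rotation[OF l])
    show ?thesis
      unfolding circle_algebra_function_algebra[OF assms(1,3,6)] circle_algebra_rotation[OF l]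
      by (rule homeomorphic_imp_function_algebra_isomorphic[OF half_line_param_axioms R.half_line_param_axioms
          homeomorphic_M_tilde_rotation[OF k(1) l k(2)]])
  qed
  have rational: "endpoint_limits \<gamma> \<subseteq> M_infinity \<and> card (endpoint_limits \<gamma>) = n \<and>
        (rotation (real m / real n) 1 \<noteq> 1 \<longrightarrow>
           circle_algebra \<alpha> \<cong>\<^sub>* circle_algebra (rotation (real m / real n)))"
    if mn: "n > 0" "coprime m n" "rotation_number \<alpha> = real m / real n" for m n :: nat
  proof (intro conjI impI endpoint_limits_subset)
    \<comment> \<open>The numerator of the translation number itself, which differs from
      \<open>m\<close> when that number is 1; adding a multiple of \<open>n\<close> preserves
      coprimality.\<close>
    define m' where "m' = int m + \<lfloor>transl\<rfloor> * int n"
    have "transl = real m / real n + of_int \<lfloor>transl\<rfloor>" using mn(3) unfolding rot by (simp add: frac_def)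
    then have l: "transl = of_int m' / real n" using mn(1) unfolding m'_def by (simp add: field_simps)
    have "coprime (int m) (int n)" using mn(2) by simp
    moreover have "gcd (int n) (\<lfloor>transl\<rfloor> * int n + int m) = gcd (int n) (int m)" by (rule gcd_add_mult)
    ultimately have "coprime m' (int n)"
      unfolding coprime_iff_gcd_eq_1 m'_def by (metis gcd.commute add.commute)
    then show "card (endpoint_limits \<gamma>) = n" by (rule card_endpoint_limits[OF mn(1) l])
    assume moved: "rotation (real m / real n) 1 \<noteq> 1"
    have "rotation_number \<alpha> \<noteq> 0"
    proof
      assume "rotation_number \<alpha> = 0"
      then have "rotation (real m / real n) 1 = 1" unfolding mn(3) by (simp only: rotation_def) simp
      with moved show False by simp
    qed
    note tr = transl_eq[OF this]
    obtain p where p: "(\<gamma> ^^ n) p = p + of_int m'" "(\<lambda>N. node N - (\<gamma> ^^ N) p) \<longlonglongrightarrow> 0"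
      by (rule asymptotic_periodic_point[OF mn(1) l])
    obtain h where h: "degree_one_lift h" "\<And>N. h ((\<gamma> ^^ N) p) = real N * (of_int m' / real n)"
      using periodic_linearization[OF mn(1) p(1)] by blast
    have "(\<lambda>N. h (node N) - real N * transl) \<longlonglongrightarrow> 0"
      by (rule linearization_limit[OF h(1) _ p(2)]) (simp add: h(2) l)
    from iso[OF h(1) this tr(2,3)]
    show "circle_algebra \<alpha> \<cong>\<^sub>* circle_algebra (rotation (real m / real n))" unfolding tr(1) mn(3) .
  qed
  have irrational: "(topologically_transitive \<alpha> \<longrightarrow>
           M_infinity = endpoint_limits \<gamma> \<and>
           circle_algebra \<alpha> \<cong>\<^sub>* circle_algebra (rotation (rotation_number \<alpha>))) \<and>
        (\<not> topologically_transitive \<alpha> \<longrightarrow>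
           endpoint_limits \<gamma> \<subseteq> M_infinity \<and>
           perfect_in (top_of_set M_infinity) (endpoint_limits \<gamma>) \<and>
           nowhere_dense_in (top_of_set M_infinity) (endpoint_limits \<gamma>) \<and>
           (\<forall>\<tau>\<in>{0..<1}. \<not> circle_algebra \<alpha> \<cong>\<^sub>* circle_algebra (rotation \<tau>)))"
    if irr: "rotation_number \<alpha> \<notin> \<rat>"
  proof -
    have "rotation_number \<alpha> \<noteq> 0" using irr by auto
    note tr = transl_eq[OF this]
    interpret unbounded_marked_lift \<gamma> by (rule unbounded_if_transl_pos[OF tr(2)])
    have "transl \<notin> \<rat>" using irr tr(1) by simp
    then obtain h where "semiconjugacy \<gamma> h transl" using semiconjugacy_exists by blast
    then interpret marked_semiconjugacy \<gamma> h transl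
      by (intro marked_semiconjugacy.intro marked_lift_axioms)
    note transitive = topologically_transitive_iff[OF assms(1,3)]
    have "circle_algebra \<alpha> \<cong>\<^sub>* circle_algebra (rotation transl)" if "support = UNIV"
    proof (rule iso[OF degree_one_if_support_UNIV[OF that] _ tr(2,3)])
      \<comment> \<open>The conjugacy linearizes the orbit of 0 exactly, so the sequence is
        identically 0.\<close>
      show "(\<lambda>N. h (node N) - h 0 - real N * transl) \<longlonglongrightarrow> 0" by (simp add: h_iterate)
    qed
    moreover have "\<not> circle_algebra \<alpha> \<cong>\<^sub>* circle_algebra (rotation \<tau>)"
      if supp: "support \<noteq> UNIV" and \<tau>: "\<tau> \<in> {0..<1}" for \<tau>
    proof (cases "\<tau> = 0")
      case True
      then show ?thesis
        using not_isomorphic_rotation_zero by (simp add: circle_algebra_function_algebra[OF assms(1,3,6)])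
    next
      case False
      then have \<tau>': "0 < \<tau>" "\<tau> < 1" using \<tau> by auto
      interpret R: unbounded_marked_lift "\<lambda>t. t + \<tau>" by (rule marked_lift_rotation[OF \<tau>'])
      show ?thesis
      proof
        assume "circle_algebra \<alpha> \<cong>\<^sub>* circle_algebra (rotation \<tau>)"
        then have "M_tilde \<gamma> homeomorphic M_tilde (\<lambda>t. t + \<tau>)"
          unfolding circle_algebra_function_algebra[OF assms(1,3,6)] circle_algebra_rotation[OF \<tau>']
          by (rule function_algebra_isomorphic_imp_homeomorphic[OF half_line_param_axioms R.half_line_param_axioms
              separates_points_M_tilde R.separates_points_M_tilde])
        note inv = homeomorphic_M_tilde_invariants[OF unbounded_marked_lift_axioms R.unbounded_marked_lift_axioms this]
        show False
        \<comment> \<open>The limit set of \<alpha> is infinite but not the whole circle, which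
          contradicts either kind of rotation.\<close>
        proof (cases "\<tau> \<in> \<rat>")
          case True
          then show False using inv(1)[OF finite_endpoint_limits_rotation[OF \<tau>']] infinite_endpoint_limits by blast
        next
          case False
          then show False using inv(2)[OF endpoint_limits_irrational_rotation[OF \<tau>']] supp
            by (simp add: endpoint_limits_eq_infinity)
        qed
      qed
    qed
    ultimately show ?thesis
      using endpoint_limits_eq_infinity endpoint_limits_subset endpoint_limits_perfect endpoint_limits_nowhere_dense
      unfolding transitive tr(1) by blast
  qed
  show ?thesis using rational irrational by blast
qed

end
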